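(* Let $\Gamma$ be a subgroup of finite index in $\mathrm{SL}_3(\mathbb{Z})$ and let $E$ be a real quadratic field. Then $H(\Gamma,E)$ is the $\mathbb{Q}$-span of all classes $[f,\gamma f,da]_\Gamma$, where $f,a\in\mathbb{Z}^3$, $d\in\mathrm{SL}_3(\mathbb{Z})$ and $\gamma\in\Gamma$ arise from all possible choices in the following steps: (1) choose a unital $h\in\mathrm{GL}_2(\mathbb{Z})$, choose $u\in\mathbb{Z}^2$, set $\epsilon=\det(h)$, and form $M(h,u)=\begin{bmatrix}h&u\\0&\epsilon\end{bmatrix}\in\mathrm{SL}_3(\mathbb{Z})$ (block form with respect to the partition $(2,1)$); (2) find an eigenbasis of $E^3$ for $M(h,u)$ of the form $\{b,b',a\}$, where $b\in E^3$, $b'$ is its Galois conjugate, and $a\in\mathbb{Z}^3$; (3) choose $d$ in $E(a,b)$, a fixed set of representatives of the double cosets $\Gamma\backslash\mathrm{SL}_3(\mathbb{Z})/\mathrm{SL}_3(\mathbb{Z})_{a,b}$, where $\mathrm{SL}_3(\mathbb{Z})_{a,b}=\{g\in\mathrm{SL}_3(\mathbb{Z}): gb\in E^\times b,\ ga\in\mathbb{Q}^\times a\}$; (4) let $\gamma$ be the smallest positive power of $dM(h,u)d^{-1}$ lying in $\Gamma$; (5) set $f=de$, where $e={}^t(1,0,0)$.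
   Context: For a field $K\supseteq\mathbb{Q}$, the Tits building $T(K^3)$ is the simplicial complex whose vertices are the subspaces $0\ne V\ne K^3$, with simplices the flags. The Steinberg module $\mathrm{St}(K^3)$ (with $\mathbb{Q}$-coefficients) is the reduced homology $\tilde H_1(T(K^3),\mathbb{Q})$, a left $\mathrm{GL}_3(K)$-module. For a basis $v_1,v_2,v_3$ of $K^3$, the modular symbol $[v_1,v_2,v_3]\in\mathrm{St}(K^3)$ is the fundamental class of the circle (hexagon) whose vertices are the subspaces spanned by proper nonempty subsets of $\{v_1,v_2,v_3\}$, oriented so that $g[v_1,v_2,v_3]=[gv_1,gv_2,gv_3]$ for $g\in\mathrm{GL}_3(K)$; one sets $[w_1,w_2,w_3]=0$ if the $w_i$ are linearly dependent. The inclusion $\mathbb{Q}^3\subset E^3$ identifies $\mathrm{St}=\mathrm{St}(\mathbb{Q}^3)$ with the $\mathbb{Q}$-span of the modular symbols in $\mathrm{St}(E^3)$ with rational entries. For $\Gamma\subset\mathrm{GL}_3(\mathbb{Q})$, $[m]_\Gamma$ denotes the image of $[m]$ in the coinvariants $\mathrm{St}_\Gamma=H_0(\Gamma,\mathrm{St})$. With $C=\mathrm{St}(E^3)/\mathrm{St}(\mathbb{Q}^3)$, $H(\Gamma,E)$ is defined as the image of the connecting homomorphism $H_1(\Gamma,C)\to H_0(\Gamma,\mathrm{St}(\mathbb{Q}^3))$ of the short exact sequence $0\to\mathrm{St}(\mathbb{Q}^3)\to\mathrm{St}(E^3)\to C\to 0$. A matrix $h\in\mathrm{GL}_2(\mathbb{Z})$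 is unital if there exists $\beta\in E\setminus\mathbb{Q}$ with $h\,{}^t(\beta,1)\in E^\times\,{}^t(\beta,1)$. *)

theory Defs
  imports "HOL-Analysis.Analysis" "HOL-Algebra.AbelCoset" "HOL-Algebra.Module" "HOL-Library.Poly_Mapping"
begin

section \<open>Modules over the rationals\<close>

definition rat_ring :: "rat ring"
  where "rat_ring = \<lparr> carrier = UNIV, mult = (*), one = 1, zero = 0, add = (+) \<rparr>"

definition rat_span :: "(rat, 'a, 'm) module_scheme \<Rightarrow> 'a set \<Rightarrow> 'a set"
  where "rat_span M S = \<Inter> {H. submodule H rat_ring M \<and> S \<subseteq> H}"

text \<open>The map of cosets \<open>x + Q \<mapsto> f x + P\<close> into \<open>M / P\<close> induced by a linear map \<open>f\<close> that sends
  \<open>Q\<close> into \<open>P\<close>: the union below is then over one and the same coset.\<close>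

definition coset_map :: "('b, 'm) ring_scheme \<Rightarrow> 'b set \<Rightarrow> ('a \<Rightarrow> 'b) \<Rightarrow> 'a set \<Rightarrow> 'b set"
  where "coset_map M P f X = (\<Union>x\<in>X. P +>\<^bsub>M\<^esub> f x)"

text \<open>The multiplicative fields of a module record carry no meaning.\<close>

definition quotient_module :: "(rat, 'a, 'm) module_scheme \<Rightarrow> 'a set \<Rightarrow> (rat, 'a set) module"
  where "quotient_module M P =
    \<lparr> carrier = a_rcosets\<^bsub>M\<^esub> P, mult = undefined, one = undefined,
      zero = P, add = (<+>\<^bsub>M\<^esub>),
      smult = (\<lambda>q. coset_map M P (\<lambda>x. q \<odot>\<^bsub>M\<^esub> x)) \<rparr>"


section \<open>Group homology in degrees 0 and 1\<close>

text \<open>A left module over a group \<open>G\<close> is a module \<open>M\<close> together with an action \<open>\<rho>\<close>. Homology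
  is that of the inhomogeneous bar complex, where \<open>M\<close> becomes a right module through
  \<open>m \<cdot> g = \<rho> (g\<^sup>-\<^sup>1) m\<close>; a chain \<open>\<Sum> m\<^sub>x \<otimes> x\<close> is the finitely supported function
  \<open>x \<mapsto> m\<^sub>x\<close>.\<close>

definition fin_supp_module :: "'i set \<Rightarrow> (rat, 'a, 'm) module_scheme \<Rightarrow> (rat, 'i \<Rightarrow> 'a) module"
  where "fin_supp_module I M =
    \<lparr> carrier = {c. (\<forall>x\<in>I. c x \<in> carrier M) \<and> (\<forall>x. x \<notin> I \<longrightarrow> c x = \<zero>\<^bsub>M\<^esub>) \<and>
                    finite {x. c x \<noteq> \<zero>\<^bsub>M\<^esub>}},
      mult = undefined, one = undefined,
      zero = (\<lambda>_. \<zero>\<^bsub>M\<^esub>), add = (\<lambda>c d x. c x \<oplus>\<^bsub>M\<^esub> d x),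
      smult = (\<lambda>q c x. q \<odot>\<^bsub>M\<^esub> c x) \<rparr>"

abbreviation bar1 :: "('g, 'n) monoid_scheme \<Rightarrow> (rat, 'a, 'm) module_scheme \<Rightarrow> (rat, 'g \<Rightarrow> 'a) module"
  where "bar1 G M \<equiv> fin_supp_module (carrier G) M"

abbreviation bar2 ::
    "('g, 'n) monoid_scheme \<Rightarrow> (rat, 'a, 'm) module_scheme \<Rightarrow> (rat, 'g \<times> 'g \<Rightarrow> 'a) module"
  where "bar2 G M \<equiv> fin_supp_module (carrier G \<times> carrier G) M"

text \<open>\<open>d (m \<otimes> [g]) = m \<cdot> g - m\<close>\<close>

definition bar_d1 ::
    "('g, 'n) monoid_scheme \<Rightarrow> (rat, 'a, 'm) module_scheme \<Rightarrow> ('g \<Rightarrow> 'a \<Rightarrow> 'a) \<Rightarrow> ('g \<Rightarrow> 'a) \<Rightarrow> 'a"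
  where "bar_d1 G M \<rho> c =
    (\<Oplus>\<^bsub>M\<^esub>g\<in>{g. c g \<noteq> \<zero>\<^bsub>M\<^esub>}. \<rho> (inv\<^bsub>G\<^esub> g) (c g) \<ominus>\<^bsub>M\<^esub> c g)"

text \<open>\<open>d (m \<otimes> [g|h]) = m \<cdot> g \<otimes> [h] - m \<otimes> [gh] + m \<otimes> [g]\<close>\<close>

definition bar_d2 ::
    "('g, 'n) monoid_scheme \<Rightarrow> (rat, 'a, 'm) module_scheme \<Rightarrow> ('g \<Rightarrow> 'a \<Rightarrow> 'a) \<Rightarrow>
     ('g \<times> 'g \<Rightarrow> 'a) \<Rightarrow> 'g \<Rightarrow> 'a"
  where "bar_d2 G M \<rho> c x =
    (\<Oplus>\<^bsub>M\<^esub>p\<in>{p. c p \<noteq> \<zero>\<^bsub>M\<^esub>}.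
       (if snd p = x then \<rho> (inv\<^bsub>G\<^esub> (fst p)) (c p) else \<zero>\<^bsub>M\<^esub>)
       \<ominus>\<^bsub>M\<^esub> (if fst p \<otimes>\<^bsub>G\<^esub> snd p = x then c p else \<zero>\<^bsub>M\<^esub>)
       \<oplus>\<^bsub>M\<^esub> (if fst p = x then c p else \<zero>\<^bsub>M\<^esub>))"

definition bar_Z1 ::
    "('g, 'n) monoid_scheme \<Rightarrow> (rat, 'a, 'm) module_scheme \<Rightarrow> ('g \<Rightarrow> 'a \<Rightarrow> 'a) \<Rightarrow> ('g \<Rightarrow> 'a) set"
  where "bar_Z1 G M \<rho> = {c \<in> carrier (bar1 G M). bar_d1 G M \<rho> c = \<zero>\<^bsub>M\<^esub>}"

definition bar_B1 ::
    "('g, 'n) monoid_scheme \<Rightarrow> (rat, 'a, 'm) module_scheme \<Rightarrow> ('g \<Rightarrow> 'a \<Rightarrow> 'a) \<Rightarrow> ('g \<Rightarrow> 'a) set"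
  where "bar_B1 G M \<rho> = bar_d2 G M \<rho> ` carrier (bar2 G M)"

definition H1 ::
    "('g, 'n) monoid_scheme \<Rightarrow> (rat, 'a, 'm) module_scheme \<Rightarrow> ('g \<Rightarrow> 'a \<Rightarrow> 'a) \<Rightarrow>
     (rat, ('g \<Rightarrow> 'a) set) module"
  where "H1 G M \<rho> = quotient_module ((bar1 G M)\<lparr>carrier := bar_Z1 G M \<rho>\<rparr>) (bar_B1 G M \<rho>)"

definition coinvariant_relations ::
    "('g, 'n) monoid_scheme \<Rightarrow> (rat, 'a, 'm) module_scheme \<Rightarrow> ('g \<Rightarrow> 'a \<Rightarrow> 'a) \<Rightarrow> 'a set"
  where "coinvariant_relations G M \<rho> =
    rat_span M {\<rho> g m \<ominus>\<^bsub>M\<^esub> m | g m. g \<in> carrier G \<and> m \<in> carrier M}"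

definition H0 ::
    "('g, 'n) monoid_scheme \<Rightarrow> (rat, 'a, 'm) module_scheme \<Rightarrow> ('g \<Rightarrow> 'a \<Rightarrow> 'a) \<Rightarrow> (rat, 'a set) module"
  where "H0 G M \<rho> = quotient_module M (coinvariant_relations G M \<rho>)"

definition H0_class ::
    "('g, 'n) monoid_scheme \<Rightarrow> (rat, 'a, 'm) module_scheme \<Rightarrow> ('g \<Rightarrow> 'a \<Rightarrow> 'a) \<Rightarrow> 'a \<Rightarrow> 'a set"
  where "H0_class G M \<rho> m = coinvariant_relations G M \<rho> +>\<^bsub>M\<^esub> m"

text \<open>The connecting homomorphism \<open>H\<^sub>1(G, C) \<rightarrow> H\<^sub>0(G, A)\<close> of a short exact sequence
  \<open>0 \<rightarrow> A \<rightarrow> B \<rightarrow> C \<rightarrow> 0\<close> with maps \<open>i\<close> and \<open>p\<close>: lift a cycle representing \<open>X\<close> along \<open>p\<close> to a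
  chain \<open>w\<close> with coefficients in \<open>B\<close>, take its boundary and pull that back along \<open>i\<close>.\<close>

definition connecting_hom ::
    "('g, 'n) monoid_scheme \<Rightarrow> (rat, 'a, 'k) module_scheme \<Rightarrow> ('g \<Rightarrow> 'a \<Rightarrow> 'a) \<Rightarrow>
     (rat, 'b, 'l) module_scheme \<Rightarrow> ('g \<Rightarrow> 'b \<Rightarrow> 'b) \<Rightarrow> ('a \<Rightarrow> 'b) \<Rightarrow> ('b \<Rightarrow> 'c) \<Rightarrow>
     ('g \<Rightarrow> 'c) set \<Rightarrow> 'a set"
  where "connecting_hom G A \<alpha> B \<beta> i p X =
    (THE Y. \<exists>w \<in> carrier (bar1 G B). \<exists>a \<in> carrier A.
       (\<lambda>g. p (w g)) \<in> X \<and> bar_d1 G B \<beta> w = i a \<and> Y = H0_class G A \<alpha> a)"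


section \<open>The Tits building and the Steinberg module\<close>

definition lin_ext :: "('a \<Rightarrow> 'b \<Rightarrow>\<^sub>0 rat) \<Rightarrow> ('a \<Rightarrow>\<^sub>0 rat) \<Rightarrow> 'b \<Rightarrow>\<^sub>0 rat"
  where "lin_ext F c = (\<Sum>x\<in>Poly_Mapping.keys c. Poly_Mapping.map ((*) (Poly_Mapping.lookup c x)) (F x))"

text \<open>A flag is written as the list of its members in increasing order, which orients the
  simplex; the list \<open>[]\<close> is the empty simplex of the augmented complex.\<close>

definition tits_flags :: "nat \<Rightarrow> ('k::field ^ 3) set list set"
  where "tits_flags n =
    {xs. length xs = n \<and> sorted_wrt (\<subset>) xs \<and>
         (\<forall>V \<in> set xs. vec.subspace V \<and> V \<noteq> {0} \<and> V \<noteq> UNIV)}"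

definition tits_chains :: "nat \<Rightarrow> (rat, ('k::field ^ 3) set list \<Rightarrow>\<^sub>0 rat) module"
  where "tits_chains n =
    \<lparr> carrier = {c. Poly_Mapping.keys c \<subseteq> tits_flags n},
      mult = undefined, one = undefined, zero = 0, add = (+),
      smult = (\<lambda>q. Poly_Mapping.map ((*) q)) \<rparr>"

definition simplicial_boundary :: "('v list \<Rightarrow>\<^sub>0 rat) \<Rightarrow> 'v list \<Rightarrow>\<^sub>0 rat"
  where "simplicial_boundary =
    lin_ext (\<lambda>xs. \<Sum>j<length xs. Poly_Mapping.single (take j xs @ drop (Suc j) xs) ((- 1) ^ j))"

text \<open>Chains of simplicial degree \<open>d\<close> are supported on flags of length \<open>d + 1\<close>.\<close>

definition tits_cycles1 :: "(rat, ('k::field ^ 3) set list \<Rightarrow>\<^sub>0 rat) module"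
  where "tits_cycles1 =
    (tits_chains 2)\<lparr>carrier := {c \<in> carrier (tits_chains 2). simplicial_boundary c = 0}\<rparr>"

definition tits_boundaries1 :: "(('k::field ^ 3) set list \<Rightarrow>\<^sub>0 rat) set"
  where "tits_boundaries1 = simplicial_boundary ` carrier (tits_chains 3)"

type_synonym 'k steinberg = "(('k ^ 3) set list \<Rightarrow>\<^sub>0 rat) set"

definition steinberg :: "(rat, 'k::field_char_0 steinberg) module"
  where "steinberg = quotient_module tits_cycles1 tits_boundaries1"

text \<open>The map of Steinberg modules induced by a map of flags \<open>V \<mapsto> F V\<close>.\<close>

definition steinberg_map ::
    "(('k ^ 3) set \<Rightarrow> ('l ^ 3) set) \<Rightarrow> 'k::field_char_0 steinberg \<Rightarrow> 'l::field_char_0 steinberg"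
  where "steinberg_map F =
    coset_map tits_cycles1 tits_boundaries1 (lin_ext (\<lambda>xs. Poly_Mapping.single (map F xs) 1))"

definition steinberg_action :: "'k ^ 3 ^ 3 \<Rightarrow> 'k::field_char_0 steinberg \<Rightarrow> 'k steinberg"
  where "steinberg_action g = steinberg_map ((`) ((*v) g))"

definition int_action :: "int ^ 3 ^ 3 \<Rightarrow> 'k::field_char_0 steinberg \<Rightarrow> 'k steinberg"
  where "int_action g = steinberg_action (map_matrix of_int g)"

definition is_basis3 :: "'k::field ^ 3 \<Rightarrow> 'k ^ 3 \<Rightarrow> 'k ^ 3 \<Rightarrow> bool"
  where "is_basis3 v1 v2 v3 \<longleftrightarrow>
    card {v1, v2, v3} = 3 \<and> vec.independent {v1, v2, v3} \<and> vec.span {v1, v2, v3} = UNIV"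

text \<open>The fundamental cycle of the hexagon with vertices \<open>\<langle>v\<^sub>1\<rangle>, \<langle>v\<^sub>1, v\<^sub>2\<rangle>, \<langle>v\<^sub>2\<rangle>, \<dots>\<close>: the flag
  \<open>\<langle>v\<^sub>i\<rangle> \<subset> \<langle>v\<^sub>i, v\<^sub>j\<rangle>\<close> has as coefficient the sign of the permutation \<open>(i, j, k)\<close>.\<close>

definition hexagon :: "'k::field ^ 3 \<Rightarrow> 'k ^ 3 \<Rightarrow> 'k ^ 3 \<Rightarrow> ('k ^ 3) set list \<Rightarrow>\<^sub>0 rat"
  where "hexagon v1 v2 v3 =
    (let flag = (\<lambda>v w. Poly_Mapping.single [vec.span {v}, vec.span {v, w}] 1)
     in flag v1 v2 - flag v2 v1 + flag v2 v3 - flag v3 v2 + flag v3 v1 - flag v1 v3)"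

definition modular_symbol :: "'k ^ 3 \<Rightarrow> 'k ^ 3 \<Rightarrow> 'k ^ 3 \<Rightarrow> 'k::field_char_0 steinberg"
  where "modular_symbol v1 v2 v3 =
    (if is_basis3 v1 v2 v3 then tits_boundaries1 +>\<^bsub>tits_cycles1\<^esub> hexagon v1 v2 v3
     else \<zero>\<^bsub>steinberg\<^esub>)"


section \<open>Integral matrices and the extension of scalars\<close>

definition SL3Z :: "(int ^ 3 ^ 3) monoid"
  where "SL3Z = \<lparr> carrier = {g. det g = 1}, mult = (**), one = mat 1 \<rparr>"

definition vec_map :: "('a \<Rightarrow> 'b) \<Rightarrow> 'a ^ 'n \<Rightarrow> 'b ^ 'n"
  where "vec_map f v = (\<chi> i. f (v $ i))"

text \<open>The inclusion \<open>St(\<rat>\<^sup>3) \<rightarrow> St(E\<^sup>3)\<close> is induced by \<open>V \<mapsto> E \<cdot> V\<close>; on modular symbols it is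
  given by the inclusion of \<open>\<rat>\<^sup>3\<close> in \<open>E\<^sup>3\<close>.\<close>

definition steinberg_incl :: "rat steinberg \<Rightarrow> 'e::field_char_0 steinberg"
  where "steinberg_incl = steinberg_map (\<lambda>V. vec.span (vec_map of_rat ` V))"

definition steinberg_rat :: "'e::field_char_0 steinberg set"
  where "steinberg_rat = steinberg_incl ` carrier steinberg"

definition steinberg_quotient :: "(rat, 'e::field_char_0 steinberg set) module"
  where "steinberg_quotient = quotient_module steinberg steinberg_rat"

definition steinberg_quotient_action ::
    "int ^ 3 ^ 3 \<Rightarrow> 'e::field_char_0 steinberg set \<Rightarrow> 'e steinberg set"
  where "steinberg_quotient_action g = coset_map steinberg steinberg_rat (int_action g)"

abbreviation SL3Z_subgroup :: "(int ^ 3 ^ 3) set \<Rightarrow> (int ^ 3 ^ 3) monoid"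
  where "SL3Z_subgroup \<Gamma> \<equiv> SL3Z\<lparr>carrier := \<Gamma>\<rparr>"

abbreviation steinberg_coinvariants :: "(int ^ 3 ^ 3) set \<Rightarrow> (rat, rat steinberg set) module"
  where "steinberg_coinvariants \<Gamma> \<equiv> H0 (SL3Z_subgroup \<Gamma>) steinberg int_action"

text \<open>The class of \<open>[v\<^sub>1, v\<^sub>2, v\<^sub>3]\<close> in the coinvariants of \<open>St(\<rat>\<^sup>3)\<close>.\<close>

definition modular_symbol_class ::
    "(int ^ 3 ^ 3) set \<Rightarrow> int ^ 3 \<Rightarrow> int ^ 3 \<Rightarrow> int ^ 3 \<Rightarrow> rat steinberg set"
  where "modular_symbol_class \<Gamma> v1 v2 v3 =
    H0_class (SL3Z_subgroup \<Gamma>) steinberg int_action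
      (modular_symbol (vec_map of_int v1) (vec_map of_int v2) (vec_map of_int v3))"

definition H_field :: "(int ^ 3 ^ 3) set \<Rightarrow> 'e::field_char_0 itself \<Rightarrow> rat steinberg set set"
  where "H_field \<Gamma> (_ :: 'e itself) =
    connecting_hom (SL3Z_subgroup \<Gamma>) (steinberg :: (rat, rat steinberg) module) int_action
      (steinberg :: (rat, 'e steinberg) module) int_action
      steinberg_incl (\<lambda>x. steinberg_rat +>\<^bsub>steinberg\<^esub> x)
    ` carrier (H1 (SL3Z_subgroup \<Gamma>) (steinberg_quotient :: (rat, 'e steinberg set) module)
        steinberg_quotient_action)"


section \<open>Real quadratic fields and unital matrices\<close>

definition field_hom :: "('a::field \<Rightarrow> 'b::field) \<Rightarrow> bool"
  where "field_hom f \<longleftrightarrow>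
    f 1 = 1 \<and> (\<forall>x y. f (x + y) = f x + f y) \<and> (\<forall>x y. f (x * y) = f x * f y)"

text \<open>The field is a type of its own, of degree 2 over \<open>\<rat>\<close> and embeddable in the reals.\<close>

definition real_quadratic_field :: "'e::field_char_0 itself \<Rightarrow> bool"
  where "real_quadratic_field (_ :: 'e itself) \<longleftrightarrow>
    vector_space.dim (\<lambda>(q::rat) (x::'e). of_rat q * x) UNIV = 2 \<and>
    (\<exists>f :: 'e \<Rightarrow> real. field_hom f)"

definition galois_conj :: "'e::field_char_0 \<Rightarrow> 'e"
  where "galois_conj = (THE \<sigma>. field_hom \<sigma> \<and> bij \<sigma> \<and> \<sigma> \<noteq> id)"

definition unital :: "'e::field_char_0 itself \<Rightarrow> int ^ 2 ^ 2 \<Rightarrow> bool"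
  where "unital (_ :: 'e itself) h \<longleftrightarrow> invertible h \<and>
    (\<exists>\<beta>::'e. \<beta> \<notin> \<rat> \<and>
      (\<exists>c. c \<noteq> 0 \<and> map_matrix of_int h *v vector [\<beta>, 1] = c *s (vector [\<beta>, 1] :: 'e ^ 2)))"

definition block_matrix :: "int ^ 2 ^ 2 \<Rightarrow> int ^ 2 \<Rightarrow> int ^ 3 ^ 3"
  where "block_matrix h u = vector
    [vector [h $ 1 $ 1, h $ 1 $ 2, u $ 1],
     vector [h $ 2 $ 1, h $ 2 $ 2, u $ 2],
     vector [0,         0,         det h]]"

definition eigenbasis :: "'k::field ^ 3 ^ 3 \<Rightarrow> 'k ^ 3 \<Rightarrow> 'k ^ 3 \<Rightarrow> 'k ^ 3 \<Rightarrow> bool"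
  where "eigenbasis A v1 v2 v3 \<longleftrightarrow>
    is_basis3 v1 v2 v3 \<and> (\<forall>v \<in> {v1, v2, v3}. \<exists>c. A *v v = c *s v)"

definition line_stabilizer :: "int ^ 3 \<Rightarrow> 'e::field_char_0 ^ 3 \<Rightarrow> (int ^ 3 ^ 3) set"
  where "line_stabilizer a b = {g \<in> carrier SL3Z.
    (\<exists>c. c \<noteq> 0 \<and> map_matrix of_int g *v b = c *s b) \<and>
    (\<exists>q::rat. q \<noteq> 0 \<and> map_matrix of_int g *v vec_map of_int a = q *s vec_map of_int a)}"

definition double_cosets ::
    "('g, 'n) monoid_scheme \<Rightarrow> 'g set \<Rightarrow> 'g set \<Rightarrow> 'g set set"
  where "double_cosets G H K = {(H #>\<^bsub>G\<^esub> g) <#>\<^bsub>G\<^esub> K | g. g \<in> carrier G}"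

definition double_coset_reps ::
    "('g, 'n) monoid_scheme \<Rightarrow> 'g set \<Rightarrow> 'g set \<Rightarrow> 'g set \<Rightarrow> bool"
  where "double_coset_reps G H K R \<longleftrightarrow>
    R \<subseteq> carrier G \<and> (\<forall>D \<in> double_cosets G H K. \<exists>!r. r \<in> R \<inter> D)"

definition smallest_power :: "('g, 'n) monoid_scheme \<Rightarrow> 'g set \<Rightarrow> 'g \<Rightarrow> 'g"
  where "smallest_power G H x = x [^]\<^bsub>G\<^esub> (LEAST n::nat. 0 < n \<and> x [^]\<^bsub>G\<^esub> n \<in> H)"

end

theory Submission
  imports Defs
begin

text \<open>
Since \<open>T(K\<^sup>3)\<close> is a graph, \<open>St(K\<^sup>3)\<close> is its space of cycles, and \<open>H(\<Gamma>, E)\<close> is the space of classes of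
those rational cycles that are sums of terms \<open>\<gamma> m - m\<close> with \<open>m\<close> in \<open>St(E\<^sup>3)\<close>.

A nonrational point \<open>\<langle>b\<rangle>\<close> lies on a unique rational line \<open>\<langle>b, b'\<rangle>\<close> and a nonrational line contains a
unique rational point \<open>\<langle>a\<rangle>\<close>. Hence a cycle without flags of two nonrational members is rational, and
\<open>St(E\<^sup>3) / St(\<rat>\<^sup>3)\<close> is free on the flags \<open>\<langle>b\<rangle> \<subset> \<langle>a, b\<rangle>\<close> with two nonrational members; the modular symbol
\<open>[b, f, a]\<close> with any rational \<open>f\<close> in \<open>\<langle>b, b'\<rangle>\<close> lifts the generator of such a flag. If \<open>\<gamma>\<close> fixes the
flag then \<open>\<gamma>[b, f, a] - [b, f, a] = [f, \<gamma>f, a]\<close>, so these symbols give elements of \<open>H(\<Gamma>, E)\<close>.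
Conversely, choosing the lifts compatibly along every \<open>\<Gamma>\<close>-orbit of flags yields a retraction of
\<open>St(E\<^sup>3)\<close> onto \<open>St(\<rat>\<^sup>3)\<close> which is equivariant up to the span of these symbols.

Moving \<open>\<langle>b, b'\<rangle>\<close> to the plane of the first two coordinates by an element of \<open>SL\<^sub>3(\<int>)\<close>, and this element to
the chosen double coset representative, turns the stabilizer of a flag into matrices \<open>M(h, u)\<close> with
\<open>h\<close> unital; an element of \<open>\<Gamma>\<close> that fixes the flag is its own smallest power in \<open>\<Gamma>\<close>.
\<close>

section \<open>Modules over the rationals\<close>

text \<open>As a \<Gamma>-module, \<open>C\<close> is a permutation module on flags, so its first
  homology could be computed with Shapiro's lemma. The retraction takes the place of that
  computation: only boundaries of chains with values in St(E^3) have to be followed, and no homology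
  group has to be identified.

  The lifts [b, f, a] cannot be chosen equivariantly, because the stabilizer of a flag moves
  \<open>f\<close> along the line through \<open>b\<close> and \<open>b'\<close>. The defect is
  [f, \<gamma> f, a], and this is the origin of the classes in the theorem. In standard position
  \<open>f\<close> can always be e = (1, 0, 0), whence \<open>f = d e\<close> in the statement.

  Two features of the statement need care. Nothing in it forces the eigenvector \<open>b\<close>
  into the plane of the first two coordinates; where \<open>b\<close> lies outside, the symbol has
  to be shown to be zero. Moreover \<open>f\<close> and \<open>\<gamma> f\<close> may be
  proportional, so that the symbol is zero by convention; the alternating sum of six flags that
  defines the hexagon then vanishes too, so one formula serves both cases.\<close>

abbreviation rat_module :: "(rat, 'a, 'm) module_scheme \<Rightarrow> bool"
  where "rat_module M \<equiv> module rat_ring M"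

definition rat_hom :: "(rat, 'a, 'm) module_scheme \<Rightarrow> (rat, 'b, 'n) module_scheme \<Rightarrow> ('a \<Rightarrow> 'b) \<Rightarrow> bool"
  where "rat_hom M N f \<longleftrightarrow> rat_module M \<and> rat_module N \<and>
    (\<forall>x\<in>carrier M. f x \<in> carrier N) \<and>
    (\<forall>x\<in>carrier M. \<forall>y\<in>carrier M. f (x \<oplus>\<^bsub>M\<^esub> y) = f x \<oplus>\<^bsub>N\<^esub> f y) \<and>
    (\<forall>q. \<forall>x\<in>carrier M. f (q \<odot>\<^bsub>M\<^esub> x) = q \<odot>\<^bsub>N\<^esub> f x)"

lemma rat_ring_simps [simp]:
  "carrier rat_ring = UNIV" "x \<otimes>\<^bsub>rat_ring\<^esub> y = x * y" "\<one>\<^bsub>rat_ring\<^esub> = 1"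
  "\<zero>\<^bsub>rat_ring\<^esub> = 0" "x \<oplus>\<^bsub>rat_ring\<^esub> y = x + y"
  by (simp_all add: rat_ring_def)

lemma cring_rat_ring: "cring rat_ring"
proof (rule cringI)
  show "abelian_group rat_ring"
    by (rule abelian_groupI) (auto simp: algebra_simps intro: exI[of _ "- x" for x])
  show "comm_monoid rat_ring"
    by (rule comm_monoidI) auto
qed (auto simp: algebra_simps)

text \<open>Negatives need not be supplied: \<open>0 \<odot> x = \<zero>\<close> and distributivity
  make \<open>(- 1) \<odot> x\<close> an inverse of \<open>x\<close>.\<close>

lemma rat_module_intro:
  fixes M :: "(rat, 'a, 'm) module_scheme" (structure)
  assumes "\<And>x y. x \<in> carrier M \<Longrightarrow> y \<in> carrier M \<Longrightarrow> x \<oplus> y \<in> carrier M"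
    and "\<zero> \<in> carrier M"
    and "\<And>x y z. x \<in> carrier M \<Longrightarrow> y \<in> carrier M \<Longrightarrow> z \<in> carrier M \<Longrightarrow> (x \<oplus> y) \<oplus> z = x \<oplus> (y \<oplus> z)"
    and "\<And>x y. x \<in> carrier M \<Longrightarrow> y \<in> carrier M \<Longrightarrow> x \<oplus> y = y \<oplus> x"
    and "\<And>x. x \<in> carrier M \<Longrightarrow> \<zero> \<oplus> x = x"
    and "\<And>x. x \<in> carrier M \<Longrightarrow> 0 \<odot> x = \<zero>"
    and "\<And>q x. x \<in> carrier M \<Longrightarrow> q \<odot> x \<in> carrier M"
    and "\<And>p q x. x \<in> carrier M \<Longrightarrow> (p + q) \<odot> x = p \<odot> x \<oplus> q \<odot> x"
    and "\<And>q x y. x \<in> carrier M \<Longrightarrow> y \<in> carrier M \<Longrightarrow> q \<odot> (x \<oplus> y) = q \<odot> x \<oplus> q \<odot> y"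
    and "\<And>p q x. x \<in> carrier M \<Longrightarrow> (p * q) \<odot> x = p \<odot> (q \<odot> x)"
    and "\<And>x. x \<in> carrier M \<Longrightarrow> 1 \<odot> x = x"
  shows "rat_module M"
proof (rule moduleI)
  have neg: "(- 1) \<odot> x \<oplus> x = \<zero>" if "x \<in> carrier M" for x
    using assms(8)[of x "-1" 1] assms(6)[of x] assms(11)[of x] that by simp
  show "abelian_group M"
  proof (rule abelian_groupI)
    show "\<exists>y\<in>carrier M. y \<oplus> x = \<zero>" if "x \<in> carrier M" for x
      using neg[OF that] assms(7)[OF that] by (intro bexI)
  qed (fact assms)+
qed (use assms in \<open>auto simp: cring_rat_ring\<close>)

lemma rat_module_abelian_group: "rat_module M \<Longrightarrow> abelian_group M"
  by (simp add: module_def)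

lemma
  assumes "rat_hom M N f"
  shows rat_hom_dom: "rat_module M" and rat_hom_cod: "rat_module N"
    and rat_hom_closed: "x \<in> carrier M \<Longrightarrow> f x \<in> carrier N"
    and rat_hom_add: "x \<in> carrier M \<Longrightarrow> y \<in> carrier M \<Longrightarrow> f (x \<oplus>\<^bsub>M\<^esub> y) = f x \<oplus>\<^bsub>N\<^esub> f y"
    and rat_hom_smult: "x \<in> carrier M \<Longrightarrow> f (q \<odot>\<^bsub>M\<^esub> x) = q \<odot>\<^bsub>N\<^esub> f x"
  using assms by (auto simp: rat_hom_def)

lemma rat_hom_intro:
  assumes "rat_module M" "rat_module N" "\<And>x. x \<in> carrier M \<Longrightarrow> f x \<in> carrier N"
    and "\<And>x y. x \<in> carrier M \<Longrightarrow> y \<in> carrier M \<Longrightarrow> f (x \<oplus>\<^bsub>M\<^esub> y) = f x \<oplus>\<^bsub>N\<^esub> f y"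
    and "\<And>q x. x \<in> carrier M \<Longrightarrow> f (q \<odot>\<^bsub>M\<^esub> x) = q \<odot>\<^bsub>N\<^esub> f x"
  shows "rat_hom M N f"
  using assms by (auto simp: rat_hom_def)

lemma rat_hom_zero:
  assumes "rat_hom M N f"
  shows "f \<zero>\<^bsub>M\<^esub> = \<zero>\<^bsub>N\<^esub>"
proof -
  interpret M: module rat_ring M using assms by (rule rat_hom_dom)
  interpret N: module rat_ring N using assms by (rule rat_hom_cod)
  have "f (0 \<odot>\<^bsub>M\<^esub> \<zero>\<^bsub>M\<^esub>) = 0 \<odot>\<^bsub>N\<^esub> f \<zero>\<^bsub>M\<^esub>" by (rule rat_hom_smult[OF assms M.zero_closed])
  then show ?thesis using M.smult_l_null[of "\<zero>\<^bsub>M\<^esub>"] N.smult_l_null[of "f \<zero>\<^bsub>M\<^esub>"] rat_hom_closed[OF assms]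
    by simp
qed

lemma rat_module_minus_eq:
  assumes "rat_module M" "x \<in> carrier M"
  shows "\<ominus>\<^bsub>M\<^esub> x = (- 1) \<odot>\<^bsub>M\<^esub> x"
proof -
  interpret M: module rat_ring M by fact
  have "\<ominus>\<^bsub>rat_ring\<^esub> 1 = (-1 :: rat)"
    using M.R.minus_equality[of "-1" 1] by simp
  then show ?thesis using M.smult_l_minus[of 1 x] M.smult_one[of x] assms(2) by simp
qed

lemma rat_hom_uminus:
  assumes "rat_hom M N f" "x \<in> carrier M"
  shows "f (\<ominus>\<^bsub>M\<^esub> x) = \<ominus>\<^bsub>N\<^esub> f x"
  using assms by (simp add: rat_module_minus_eq rat_hom_dom rat_hom_cod rat_hom_closed rat_hom_smult)

lemma rat_hom_minus:
  assumes "rat_hom M N f" "x \<in> carrier M" "y \<in> carrier M"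
  shows "f (x \<ominus>\<^bsub>M\<^esub> y) = f x \<ominus>\<^bsub>N\<^esub> f y"
proof -
  interpret M: module rat_ring M using assms(1) by (rule rat_hom_dom)
  show ?thesis unfolding a_minus_def
    using assms by (simp add: rat_hom_add rat_hom_uminus)
qed

lemma rat_hom_comp:
  assumes "rat_hom M N f" "rat_hom N P g"
  shows "rat_hom M P (\<lambda>x. g (f x))"
  using assms by (auto simp: rat_hom_def)

lemma rat_hom_id: "rat_module M \<Longrightarrow> rat_hom M M (\<lambda>x. x)"
  by (auto simp: rat_hom_def)

lemma rat_hom_zero_map:
  assumes "rat_module M" "rat_module N" shows "rat_hom M N (\<lambda>x. \<zero>\<^bsub>N\<^esub>)"
proof -
  interpret N: module rat_ring N by fact
  show ?thesis using assms N.smult_r_null by (intro rat_hom_intro) auto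
qed

lemma rat_hom_add_map:
  assumes "rat_hom M N f" "rat_hom M N g"
  shows "rat_hom M N (\<lambda>x. f x \<oplus>\<^bsub>N\<^esub> g x)"
proof -
  interpret M: module rat_ring M using assms(1) by (rule rat_hom_dom)
  interpret N: module rat_ring N using assms(1) by (rule rat_hom_cod)
  note c [simp] = rat_hom_closed[OF assms(1)] rat_hom_closed[OF assms(2)]
  show ?thesis using assms
    by (intro rat_hom_intro)
      (simp_all add: rat_hom_dom rat_hom_cod rat_hom_add rat_hom_smult N.smult_r_distr N.a_ac)
qed

lemma rat_hom_smult_map:
  assumes "rat_hom M N f"
  shows "rat_hom M N (\<lambda>x. q \<odot>\<^bsub>N\<^esub> f x)"
proof -
  interpret M: module rat_ring M using assms(1) by (rule rat_hom_dom)
  interpret N: module rat_ring N using assms(1) by (rule rat_hom_cod)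
  note c [simp] = rat_hom_closed[OF assms(1)]
  show ?thesis using assms
    by (intro rat_hom_intro)
      (simp_all add: rat_hom_dom rat_hom_cod rat_hom_add rat_hom_smult N.smult_r_distr mult.commute
        flip: N.smult_assoc1[simplified])
qed

lemma rat_hom_cong:
  assumes "rat_hom M N f" "\<And>x. x \<in> carrier M \<Longrightarrow> f x = g x"
  shows "rat_hom M N g"
proof -
  interpret M: module rat_ring M using assms(1) by (rule rat_hom_dom)
  show ?thesis using assms by (auto simp: rat_hom_def)
qed

lemma rat_hom_minus_map:
  assumes "rat_hom M N f" "rat_hom M N g"
  shows "rat_hom M N (\<lambda>x. f x \<ominus>\<^bsub>N\<^esub> g x)"
  by (rule rat_hom_cong[OF rat_hom_add_map[OF assms(1) rat_hom_smult_map[OF assms(2), of "-1"]]])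
    (use assms in \<open>simp add: a_minus_def rat_module_minus_eq rat_hom_cod rat_hom_closed\<close>)

lemma rat_submodule_intro:
  assumes "rat_module M" "H \<subseteq> carrier M" "\<zero>\<^bsub>M\<^esub> \<in> H"
    and "\<And>x y. x \<in> H \<Longrightarrow> y \<in> H \<Longrightarrow> x \<oplus>\<^bsub>M\<^esub> y \<in> H"
    and "\<And>q x. x \<in> H \<Longrightarrow> q \<odot>\<^bsub>M\<^esub> x \<in> H"
  shows "submodule H rat_ring M"
proof -
  interpret M: module rat_ring M by fact
  show ?thesis using assms(2-)
    by (intro M.submoduleI) (auto simp: rat_module_minus_eq[OF assms(1)] subset_iff)
qed

lemma
  assumes "rat_module M" "submodule H rat_ring M"
  shows submodule_subset: "H \<subseteq> carrier M"
    and submodule_zero: "\<zero>\<^bsub>M\<^esub> \<in> H"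
    and submodule_add: "x \<in> H \<Longrightarrow> y \<in> H \<Longrightarrow> x \<oplus>\<^bsub>M\<^esub> y \<in> H"
    and submodule_smult: "x \<in> H \<Longrightarrow> q \<odot>\<^bsub>M\<^esub> x \<in> H"
proof -
  interpret M: module rat_ring M by fact
  interpret H: subgroup H "add_monoid M" using assms(2) by (rule submodule.axioms)
  show "H \<subseteq> carrier M" "\<zero>\<^bsub>M\<^esub> \<in> H" using H.subset H.one_closed by auto
  show "x \<in> H \<Longrightarrow> y \<in> H \<Longrightarrow> x \<oplus>\<^bsub>M\<^esub> y \<in> H" using H.m_closed by auto
  show "x \<in> H \<Longrightarrow> q \<odot>\<^bsub>M\<^esub> x \<in> H" using submodule.smult_closed[OF assms(2)] by simp
qed

lemma submodule_finsum:
  assumes "rat_module M" "submodule H rat_ring M" "\<And>x. x \<in> F \<Longrightarrow> u x \<in> H"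
  shows "(\<Oplus>\<^bsub>M\<^esub>x\<in>F. u x) \<in> H"
proof -
  interpret M: module rat_ring M by fact
  note s = submodule_subset[OF assms(1,2)]
  show ?thesis
  proof (cases "finite F")
    case True
    then show ?thesis using assms(3)
    proof (induction F)
      case empty then show ?case using submodule_zero[OF assms(1,2)] by simp
    next
      case (insert x F)
      then show ?case using s submodule_add[OF assms(1,2)]
        by (subst M.finsum_insert) (auto simp: Pi_def)
    qed
  qed (simp add: M.finsum_infinite submodule_zero[OF assms(1,2)])
qed

lemma rat_span_superset: "S \<subseteq> rat_span M S"
  by (auto simp: rat_span_def)

lemma rat_span_least: "submodule H rat_ring M \<Longrightarrow> S \<subseteq> H \<Longrightarrow> rat_span M S \<subseteq> H"
  by (auto simp: rat_span_def)

lemma submodule_rat_span: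
  assumes "rat_module M" "S \<subseteq> carrier M"
  shows "submodule (rat_span M S) rat_ring M"
proof (rule rat_submodule_intro)
  interpret M: module rat_ring M by fact
  show "rat_span M S \<subseteq> carrier M"
    using rat_span_least[OF M.carrier_is_submodule assms(2)] .
qed (use assms in \<open>auto simp: rat_span_def submodule_zero submodule_add submodule_smult\<close>)

lemma abelian_subgroup_submodule:
  assumes "rat_module M" "submodule P rat_ring M"
  shows "abelian_subgroup P M"
  using assms by (intro abelian_subgroupI3 additive_subgroupI)
    (auto simp: rat_module_abelian_group submodule.axioms)

lemma mem_coset_iff:
  assumes "rat_module M" "submodule P rat_ring M" "x \<in> carrier M" "y \<in> carrier M"
  shows "x \<in> P +>\<^bsub>M\<^esub> y \<longleftrightarrow> x \<ominus>\<^bsub>M\<^esub> y \<in> P"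
  using abelian_subgroup.a_rcos_module[OF abelian_subgroup_submodule[OF assms(1,2)] assms(4,3)]
  by (simp add: a_minus_def)

lemma coset_eq_iff:
  assumes "rat_module M" "submodule P rat_ring M" "x \<in> carrier M" "y \<in> carrier M"
  shows "P +>\<^bsub>M\<^esub> x = P +>\<^bsub>M\<^esub> y \<longleftrightarrow> x \<ominus>\<^bsub>M\<^esub> y \<in> P"
proof -
  interpret P: abelian_subgroup P M using assms(1,2) by (rule abelian_subgroup_submodule)
  have "P +>\<^bsub>M\<^esub> x = P +>\<^bsub>M\<^esub> y \<longleftrightarrow> x \<in> P +>\<^bsub>M\<^esub> y"
    using P.a_rcos_self[OF assms(3)] P.a_repr_independence'[OF _ assms(4)] by blast
  then show ?thesis using mem_coset_iff[OF assms] by simp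
qed

lemma coset_map_coset:
  assumes "rat_hom M N f" "submodule P rat_ring M" "submodule Q rat_ring N"
    and "\<And>x. x \<in> P \<Longrightarrow> f x \<in> Q" "x \<in> carrier M"
  shows "coset_map N Q f (P +>\<^bsub>M\<^esub> x) = Q +>\<^bsub>N\<^esub> f x"
proof -
  note d = rat_hom_dom[OF assms(1)]
  interpret P: abelian_subgroup P M using d assms(2) by (rule abelian_subgroup_submodule)
  have "Q +>\<^bsub>N\<^esub> f y = Q +>\<^bsub>N\<^esub> f x" if y: "y \<in> P +>\<^bsub>M\<^esub> x" for y
  proof -
    have yM: "y \<in> carrier M" using P.a_elemrcos_carrier[OF assms(5) y] .
    then have "f (y \<ominus>\<^bsub>M\<^esub> x) \<in> Q" using y assms(4) mem_coset_iff[OF d assms(2) yM assms(5)] by blast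
    then show ?thesis
      by (simp add: coset_eq_iff rat_hom_cod[OF assms(1)] assms(3,5) rat_hom_closed[OF assms(1)] yM
          rat_hom_minus[OF assms(1)])
  qed
  then show ?thesis using P.a_rcos_self[OF assms(5)] unfolding coset_map_def by blast
qed

lemma quotient_module_simps:
  "carrier (quotient_module M P) = (\<lambda>x. P +>\<^bsub>M\<^esub> x) ` carrier M"
  "\<zero>\<^bsub>quotient_module M P\<^esub> = P"
  by (auto simp: quotient_module_def A_RCOSETS_def')

lemma quotient_module_add:
  assumes "rat_module M" "submodule P rat_ring M" "x \<in> carrier M" "y \<in> carrier M"
  shows "(P +>\<^bsub>M\<^esub> x) \<oplus>\<^bsub>quotient_module M P\<^esub> (P +>\<^bsub>M\<^esub> y) = P +>\<^bsub>M\<^esub> (x \<oplus>\<^bsub>M\<^esub> y)"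
  using abelian_subgroup.a_rcos_sum[OF abelian_subgroup_submodule] assms
  by (simp add: quotient_module_def)

lemma quotient_module_smult:
  assumes "rat_module M" "submodule P rat_ring M" "x \<in> carrier M"
  shows "q \<odot>\<^bsub>quotient_module M P\<^esub> (P +>\<^bsub>M\<^esub> x) = P +>\<^bsub>M\<^esub> (q \<odot>\<^bsub>M\<^esub> x)"
proof -
  have "coset_map M P ((\<odot>\<^bsub>M\<^esub>) q) (P +>\<^bsub>M\<^esub> x) = P +>\<^bsub>M\<^esub> (q \<odot>\<^bsub>M\<^esub> x)"
    using assms by (intro coset_map_coset rat_hom_smult_map rat_hom_id) (auto simp: submodule_smult)
  then show ?thesis by (simp add: quotient_module_def)
qed

lemma coset_zero: "rat_module M \<Longrightarrow> submodule P rat_ring M \<Longrightarrow> P +>\<^bsub>M\<^esub> \<zero>\<^bsub>M\<^esub> = P"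
  by (simp add: abelian_group.a_coset_add_zero rat_module_abelian_group submodule_subset)

lemma rat_module_quotient:
  assumes "rat_module M" "submodule P rat_ring M"
  shows "rat_module (quotient_module M P)"
proof -
  interpret M: module rat_ring M by fact
  have z: "\<zero>\<^bsub>quotient_module M P\<^esub> = P +>\<^bsub>M\<^esub> \<zero>\<^bsub>M\<^esub>"
    using coset_zero[OF assms] by (simp add: quotient_module_simps)
  show ?thesis
    by (rule rat_module_intro)
      (auto simp: z quotient_module_simps(1) quotient_module_add[OF assms]
        quotient_module_smult[OF assms] M.a_ac M.smult_r_distr
        M.smult_l_distr[simplified] M.smult_assoc1[simplified] M.smult_l_null[simplified]
        M.smult_one[simplified])
qed

lemma rat_hom_quotient:
  assumes "rat_module M" "submodule P rat_ring M"
  shows "rat_hom M (quotient_module M P) (\<lambda>x. P +>\<^bsub>M\<^esub> x)"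
  using assms rat_module_quotient[OF assms]
  by (intro rat_hom_intro) (simp_all add: quotient_module_simps quotient_module_add quotient_module_smult)

lemma rat_hom_coset_map:
  assumes "rat_hom M N f" "submodule P rat_ring M" "submodule Q rat_ring N"
    and "\<And>x. x \<in> P \<Longrightarrow> f x \<in> Q"
  shows "rat_hom (quotient_module M P) (quotient_module N Q) (coset_map N Q f)"
proof -
  interpret M: module rat_ring M using assms(1) by (rule rat_hom_dom)
  note d = rat_hom_dom[OF assms(1)] and c = rat_hom_cod[OF assms(1)]
  show ?thesis
    by (rule rat_hom_intro[OF rat_module_quotient[OF d assms(2)] rat_module_quotient[OF c assms(3)]])
      (auto simp: quotient_module_simps(1) coset_map_coset[OF assms] quotient_module_add[OF d assms(2)]
        quotient_module_smult[OF d assms(2)] quotient_module_add[OF c assms(3)]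
        quotient_module_smult[OF c assms(3)] rat_hom_closed[OF assms(1)] rat_hom_add[OF assms(1)]
        rat_hom_smult[OF assms(1)])
qed

section \<open>Finitely supported chains\<close>

lemma fin_supp_module_simps [simp]:
  "\<zero>\<^bsub>fin_supp_module I M\<^esub> = (\<lambda>_. \<zero>\<^bsub>M\<^esub>)"
  "c \<oplus>\<^bsub>fin_supp_module I M\<^esub> d = (\<lambda>x. c x \<oplus>\<^bsub>M\<^esub> d x)"
  "q \<odot>\<^bsub>fin_supp_module I M\<^esub> c = (\<lambda>x. q \<odot>\<^bsub>M\<^esub> c x)"
  by (simp_all add: fin_supp_module_def)

lemma fin_supp_carrier_iff:
  "c \<in> carrier (fin_supp_module I M) \<longleftrightarrow>
    (\<forall>x\<in>I. c x \<in> carrier M) \<and> (\<forall>x. x \<notin> I \<longrightarrow> c x = \<zero>\<^bsub>M\<^esub>) \<and> finite {x. c x \<noteq> \<zero>\<^bsub>M\<^esub>}"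
  by (simp add: fin_supp_module_def)

lemma fin_supp_closed:
  assumes "rat_module M" "c \<in> carrier (fin_supp_module I M)"
  shows "c x \<in> carrier M"
proof -
  interpret M: module rat_ring M by fact
  show ?thesis using assms(2) by (cases "x \<in> I") (auto simp: fin_supp_carrier_iff)
qed

lemma fin_supp_finite: "c \<in> carrier (fin_supp_module I M) \<Longrightarrow> finite {x. c x \<noteq> \<zero>\<^bsub>M\<^esub>}"
  by (simp add: fin_supp_carrier_iff)

lemma rat_module_fin_supp:
  assumes "rat_module M"
  shows "rat_module (fin_supp_module I M)"
proof -
  interpret M: module rat_ring M by fact
  note cl [simp] = fin_supp_closed[OF assms]
  show ?thesis
  proof (rule rat_module_intro)
    fix c d assume c: "c \<in> carrier (fin_supp_module I M)" and d: "d \<in> carrier (fin_supp_module I M)"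
    have "finite {x. c x \<oplus>\<^bsub>M\<^esub> d x \<noteq> \<zero>\<^bsub>M\<^esub>}"
      by (rule finite_subset[OF _ finite_UnI[OF fin_supp_finite[OF c] fin_supp_finite[OF d]]]) auto
    then show "c \<oplus>\<^bsub>fin_supp_module I M\<^esub> d \<in> carrier (fin_supp_module I M)"
      using c d by (auto simp: fin_supp_carrier_iff)
  next
    fix q c assume c: "c \<in> carrier (fin_supp_module I M)"
    have z: "q \<odot>\<^bsub>M\<^esub> \<zero>\<^bsub>M\<^esub> = \<zero>\<^bsub>M\<^esub>" by simp
    have "finite {x. q \<odot>\<^bsub>M\<^esub> c x \<noteq> \<zero>\<^bsub>M\<^esub>}"
      by (rule finite_subset[OF _ fin_supp_finite[OF c]]) (auto simp: z)
    then show "q \<odot>\<^bsub>fin_supp_module I M\<^esub> c \<in> carrier (fin_supp_module I M)"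
      using c by (auto simp: fin_supp_carrier_iff z)
  next
    show "\<zero>\<^bsub>fin_supp_module I M\<^esub> \<in> carrier (fin_supp_module I M)"
      by (simp add: fin_supp_carrier_iff)
  qed (auto simp: fun_eq_iff M.a_ac M.smult_r_distr
      M.smult_l_distr[simplified] M.smult_assoc1[simplified] M.smult_l_null[simplified]
      M.smult_one[simplified])
qed

definition fs_single :: "(rat, 'a, 'm) module_scheme \<Rightarrow> 'i \<Rightarrow> 'a \<Rightarrow> 'i \<Rightarrow> 'a"
  where "fs_single M i m = (\<lambda>x. if x = i then m else \<zero>\<^bsub>M\<^esub>)"

lemma fs_single_closed:
  assumes "rat_module M" "i \<in> I" "m \<in> carrier M"
  shows "fs_single M i m \<in> carrier (fin_supp_module I M)"
proof -
  interpret M: module rat_ring M by fact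
  show ?thesis using assms by (auto simp: fs_single_def fin_supp_carrier_iff)
qed

text \<open>Induction on the size of the support: each step clears one nonzero value.\<close>

lemma fin_supp_induct [consumes 2, case_names zero add]:
  assumes "rat_module M" "c \<in> carrier (fin_supp_module I M)"
    and "P (\<lambda>_. \<zero>\<^bsub>M\<^esub>)"
    and "\<And>c i m. c \<in> carrier (fin_supp_module I M) \<Longrightarrow> i \<in> I \<Longrightarrow> m \<in> carrier M \<Longrightarrow> P c \<Longrightarrow>
      P (\<lambda>x. c x \<oplus>\<^bsub>M\<^esub> fs_single M i m x)"
  shows "P c"
  using assms(2)
proof (induction "card {x. c x \<noteq> \<zero>\<^bsub>M\<^esub>}" arbitrary: c)
  case 0
  then have "c = (\<lambda>_. \<zero>\<^bsub>M\<^esub>)" by (auto simp: fin_supp_carrier_iff)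
  then show ?case using assms(3) by simp
next
  case (Suc n)
  interpret M: module rat_ring M by fact
  from Suc.hyps(2) have "{x. c x \<noteq> \<zero>\<^bsub>M\<^esub>} \<noteq> {}" by (metis card.empty nat.distinct(1))
  then obtain i where i: "c i \<noteq> \<zero>\<^bsub>M\<^esub>" by auto
  then have iI: "i \<in> I" using Suc.prems by (auto simp: fin_supp_carrier_iff)
  define d where "d = c(i := \<zero>\<^bsub>M\<^esub>)"
  have supp: "{x. d x \<noteq> \<zero>\<^bsub>M\<^esub>} = {x. c x \<noteq> \<zero>\<^bsub>M\<^esub>} - {i}" by (auto simp: d_def)
  have d: "d \<in> carrier (fin_supp_module I M)"
    using Suc.prems by (auto simp: fin_supp_carrier_iff supp) (auto simp: d_def)
  have "card {x. d x \<noteq> \<zero>\<^bsub>M\<^esub>} = n" using Suc.hyps(2) i fin_supp_finite[OF Suc.prems]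
    by (simp add: supp)
  with Suc.hyps(1) d have "P d" by metis
  moreover have "(\<lambda>x. d x \<oplus>\<^bsub>M\<^esub> fs_single M i (c i) x) = c"
    using fin_supp_closed[OF assms(1) Suc.prems] by (auto simp: d_def fs_single_def)
  ultimately show ?case using assms(4)[OF d iI fin_supp_closed[OF assms(1) Suc.prems]] by metis
qed

lemma fin_supp_hom_eqI:
  assumes f: "rat_hom (fin_supp_module I M) N f" and g: "rat_hom (fin_supp_module I M) N g"
    and M: "rat_module M"
    and eq: "\<And>i m. i \<in> I \<Longrightarrow> m \<in> carrier M \<Longrightarrow> f (fs_single M i m) = g (fs_single M i m)"
    and c: "c \<in> carrier (fin_supp_module I M)"
  shows "f c = g c"
  using M c
proof (induction rule: fin_supp_induct)
  case zero
  show ?case using rat_hom_zero[OF f] rat_hom_zero[OF g] by simp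
next
  case (add c i m)
  note s = fs_single_closed[OF M add(2,3)]
  show ?case using rat_hom_add[OF f add(1) s] rat_hom_add[OF g add(1) s] add(4) eq[OF add(2,3)] by simp
qed

text \<open>The linear map on chains that applies \<open>T x\<close> to the value at
  \<open>x\<close>. The first bar differential has this form, and so has each coordinate of the
  second.\<close>

definition supp_sum ::
    "(rat, 'a, 'm) module_scheme \<Rightarrow> (rat, 'b, 'n) module_scheme \<Rightarrow> ('i \<Rightarrow> 'a \<Rightarrow> 'b) \<Rightarrow> ('i \<Rightarrow> 'a) \<Rightarrow> 'b"
  where "supp_sum M N T c = (\<Oplus>\<^bsub>N\<^esub>x\<in>{x. c x \<noteq> \<zero>\<^bsub>M\<^esub>}. T x (c x))"

text \<open>Terms off the support vanish because \<open>T x\<close> is linear. Two chains and their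
  sum can then be summed over one index set, although the support of the sum may be smaller than the
  union of the supports.\<close>

lemma supp_sum_superset:
  assumes "rat_module M" "\<And>i. i \<in> I \<Longrightarrow> rat_hom M N (T i)" "c \<in> carrier (fin_supp_module I M)"
    and "rat_module N" "finite F" "{x. c x \<noteq> \<zero>\<^bsub>M\<^esub>} \<subseteq> F" "F \<subseteq> I"
  shows "supp_sum M N T c = (\<Oplus>\<^bsub>N\<^esub>x\<in>F. T x (c x))"
proof -
  interpret N: module rat_ring N by fact
  show ?thesis unfolding supp_sum_def
  proof (rule N.add.finprod_mono_neutral_cong_left)
    show "T i (c i) = \<zero>\<^bsub>N\<^esub>" if "i \<in> F - {x. c x \<noteq> \<zero>\<^bsub>M\<^esub>}" for i
      using that rat_hom_zero[OF assms(2)[of i]] assms(7) by auto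
    show "(\<lambda>x. T x (c x)) \<in> F \<rightarrow> carrier N"
      using assms(7) rat_hom_closed[OF assms(2) fin_supp_closed[OF assms(1,3)]] by auto
  qed (use assms in auto)
qed

lemma rat_hom_supp_sum:
  assumes M: "rat_module M" and N: "rat_module N" and T: "\<And>i. i \<in> I \<Longrightarrow> rat_hom M N (T i)"
  shows "rat_hom (fin_supp_module I M) N (supp_sum M N T)"
proof (rule rat_hom_intro)
  interpret M: module rat_ring M by fact
  interpret N: module rat_ring N by fact
  show F: "rat_module (fin_supp_module I M)" "rat_module N" using M N by (simp_all add: rat_module_fin_supp)
  interpret F: module rat_ring "fin_supp_module I M" by (rule F)
  have supp: "{x. c x \<noteq> \<zero>\<^bsub>M\<^esub>} \<subseteq> I" if "c \<in> carrier (fin_supp_module I M)" for c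
    using that by (auto simp: fin_supp_carrier_iff)
  have cl: "T i (c i) \<in> carrier N" if "i \<in> I" "c \<in> carrier (fin_supp_module I M)" for i c
    by (rule rat_hom_closed[OF T[OF that(1)] fin_supp_closed[OF M that(2)]])
  fix c assume c: "c \<in> carrier (fin_supp_module I M)"
  show "supp_sum M N T c \<in> carrier N" unfolding supp_sum_def
    using supp[OF c] cl[OF _ c] by (intro N.finsum_closed) auto
  {
    fix d assume d: "d \<in> carrier (fin_supp_module I M)"
    let ?F = "{x. c x \<noteq> \<zero>\<^bsub>M\<^esub>} \<union> {x. d x \<noteq> \<zero>\<^bsub>M\<^esub>}"
    note sup = supp_sum_superset[OF M T _ N, where F = ?F and I = I]
    have fin: "finite ?F" using c d by (simp add: fin_supp_finite)
    have FI: "?F \<subseteq> I" using supp[OF c] supp[OF d] by auto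
    have e: "c \<oplus>\<^bsub>fin_supp_module I M\<^esub> d \<in> carrier (fin_supp_module I M)" using c d by blast
    have "supp_sum M N T (c \<oplus>\<^bsub>fin_supp_module I M\<^esub> d) = (\<Oplus>\<^bsub>N\<^esub>x\<in>?F. T x (c x \<oplus>\<^bsub>M\<^esub> d x))"
      by (subst sup[OF _ e fin]) (use FI in auto)
    also have "\<dots> = (\<Oplus>\<^bsub>N\<^esub>x\<in>?F. T x (c x) \<oplus>\<^bsub>N\<^esub> T x (d x))"
      using FI cl[OF _ c] cl[OF _ d] rat_hom_add[OF T] fin_supp_closed[OF M c] fin_supp_closed[OF M d]
      by (intro N.finsum_cong') auto
    also have "\<dots> = (\<Oplus>\<^bsub>N\<^esub>x\<in>?F. T x (c x)) \<oplus>\<^bsub>N\<^esub> (\<Oplus>\<^bsub>N\<^esub>x\<in>?F. T x (d x))"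
      using FI cl[OF _ c] cl[OF _ d] by (intro N.finsum_addf) auto
    also have "\<dots> = supp_sum M N T c \<oplus>\<^bsub>N\<^esub> supp_sum M N T d"
      using sup[OF _ c fin] sup[OF _ d fin] FI by auto
    finally show "supp_sum M N T (c \<oplus>\<^bsub>fin_supp_module I M\<^esub> d) =
      supp_sum M N T c \<oplus>\<^bsub>N\<^esub> supp_sum M N T d" .
  }
  fix q
  let ?F = "{x. c x \<noteq> \<zero>\<^bsub>M\<^esub>}"
  have e: "q \<odot>\<^bsub>fin_supp_module I M\<^esub> c \<in> carrier (fin_supp_module I M)"
    using F.smult_closed[of q c] c by simp
  have q0: "q \<odot>\<^bsub>M\<^esub> \<zero>\<^bsub>M\<^esub> = \<zero>\<^bsub>M\<^esub>" by simp
  have "supp_sum M N T (q \<odot>\<^bsub>fin_supp_module I M\<^esub> c) = (\<Oplus>\<^bsub>N\<^esub>x\<in>?F. T x (q \<odot>\<^bsub>M\<^esub> c x))"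
    by (subst supp_sum_superset[OF M T e N fin_supp_finite[OF c]]) (use supp[OF c] in \<open>auto simp: q0\<close>)
  also have "\<dots> = (\<Oplus>\<^bsub>N\<^esub>x\<in>?F. q \<odot>\<^bsub>N\<^esub> T x (c x))"
    using supp[OF c] cl[OF _ c] rat_hom_smult[OF T] fin_supp_closed[OF M c]
    by (intro N.finsum_cong') auto
  also have "\<dots> = q \<odot>\<^bsub>N\<^esub> supp_sum M N T c" unfolding supp_sum_def
    using fin_supp_finite[OF c] cl[OF _ c] supp[OF c]
    by (intro N.finsum_smult_ldistr[symmetric]) auto
  finally show "supp_sum M N T (q \<odot>\<^bsub>fin_supp_module I M\<^esub> c) = q \<odot>\<^bsub>N\<^esub> supp_sum M N T c" .
qed

lemma supp_sum_single:
  assumes "rat_module M" "rat_hom M N (T i)" "m \<in> carrier M"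
  shows "supp_sum M N T (fs_single M i m) = T i m"
proof -
  interpret N: module rat_ring N using assms(2) by (rule rat_hom_cod)
  show ?thesis
  proof (cases "m = \<zero>\<^bsub>M\<^esub>")
    case True
    then show ?thesis using rat_hom_zero[OF assms(2)] by (simp add: supp_sum_def fs_single_def)
  next
    case False
    then have "{x. fs_single M i m x \<noteq> \<zero>\<^bsub>M\<^esub>} = {i}" by (auto simp: fs_single_def)
    then show ?thesis using rat_hom_closed[OF assms(2,3)]
      by (simp add: supp_sum_def N.finsum_insert) (simp add: fs_single_def)
  qed
qed

lemma fin_supp_map_closed:
  assumes "rat_hom M N f" "c \<in> carrier (fin_supp_module I M)"
  shows "(\<lambda>x. f (c x)) \<in> carrier (fin_supp_module I N)"
proof -
  have "finite {x. f (c x) \<noteq> \<zero>\<^bsub>N\<^esub>}"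
    by (rule finite_subset[OF _ fin_supp_finite[OF assms(2)]]) (auto simp: rat_hom_zero[OF assms(1)])
  then show ?thesis using assms
    by (auto simp: fin_supp_carrier_iff rat_hom_zero[OF assms(1)] rat_hom_closed[OF assms(1)])
qed

lemma rat_hom_fin_supp_map:
  assumes "rat_hom M N f"
  shows "rat_hom (fin_supp_module I M) (fin_supp_module I N) (\<lambda>c x. f (c x))"
proof (rule rat_hom_intro)
  note d = rat_hom_dom[OF assms]
  show "rat_module (fin_supp_module I M)" "rat_module (fin_supp_module I N)"
    using rat_hom_cod[OF assms] d by (simp_all add: rat_module_fin_supp)
  fix c assume c: "c \<in> carrier (fin_supp_module I M)"
  show "(\<lambda>x. f (c x)) \<in> carrier (fin_supp_module I N)" using assms c by (rule fin_supp_map_closed)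
  show "(\<lambda>x. f ((q \<odot>\<^bsub>fin_supp_module I M\<^esub> c) x)) = q \<odot>\<^bsub>fin_supp_module I N\<^esub> (\<lambda>x. f (c x))" for q
    by (simp add: rat_hom_smult[OF assms fin_supp_closed[OF d c]])
  fix e assume e: "e \<in> carrier (fin_supp_module I M)"
  show "(\<lambda>x. f ((c \<oplus>\<^bsub>fin_supp_module I M\<^esub> e) x)) =
      (\<lambda>x. f (c x)) \<oplus>\<^bsub>fin_supp_module I N\<^esub> (\<lambda>x. f (e x))"
    by (simp add: rat_hom_add[OF assms fin_supp_closed[OF d c] fin_supp_closed[OF d e]])
qed

lemma fs_single_map: "rat_hom M N f \<Longrightarrow> (\<lambda>x. f (fs_single M i m x)) = fs_single N i (f m)"
  by (auto simp: fs_single_def rat_hom_zero)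

lemma fin_supp_lift:
  assumes "rat_hom M N f" "c \<in> carrier (fin_supp_module I N)" "\<And>x. c x \<in> f ` carrier M"
  shows "\<exists>w\<in>carrier (fin_supp_module I M). (\<lambda>x. f (w x)) = c"
proof -
  interpret M: module rat_ring M using assms(1) by (rule rat_hom_dom)
  \<comment> \<open>Zero is lifted to zero, so that the support does not grow.\<close>
  define w where "w x = (if c x = \<zero>\<^bsub>N\<^esub> then \<zero>\<^bsub>M\<^esub> else SOME m. m \<in> carrier M \<and> f m = c x)" for x
  have "\<exists>m. m \<in> carrier M \<and> f m = c x" for x using assms(3)[of x] by auto
  then have "(SOME m. m \<in> carrier M \<and> f m = c x) \<in> carrier M \<and>
      f (SOME m. m \<in> carrier M \<and> f m = c x) = c x" for x
    by (rule someI_ex)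
  then have w: "w x \<in> carrier M \<and> f (w x) = c x" for x
    by (simp add: w_def rat_hom_zero[OF assms(1)])
  have "{x. w x \<noteq> \<zero>\<^bsub>M\<^esub>} \<subseteq> {x. c x \<noteq> \<zero>\<^bsub>N\<^esub>}" by (auto simp: w_def)
  then have "finite {x. w x \<noteq> \<zero>\<^bsub>M\<^esub>}" using fin_supp_finite[OF assms(2)] by (rule finite_subset)
  moreover have "w x = \<zero>\<^bsub>M\<^esub>" if "x \<notin> I" for x
    using that assms(2) by (auto simp: w_def fin_supp_carrier_iff)
  ultimately have "w \<in> carrier (fin_supp_module I M)" using w by (auto simp: fin_supp_carrier_iff)
  then show ?thesis using w by (intro bexI[of _ w]) auto
qed

section \<open>The bar complex\<close>

lemma submodule_rat_hom_image:
  assumes "rat_hom M N f" "submodule H rat_ring M"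
  shows "submodule (f ` H) rat_ring N"
proof -
  note d = rat_hom_dom[OF assms(1)] and c = rat_hom_cod[OF assms(1)]
  have H: "x \<in> carrier M" if "x \<in> H" for x using that submodule_subset[OF d assms(2)] by auto
  show ?thesis
  proof (rule rat_submodule_intro[OF c])
    show "f ` H \<subseteq> carrier N" using H rat_hom_closed[OF assms(1)] by auto
    show "\<zero>\<^bsub>N\<^esub> \<in> f ` H"
      using submodule_zero[OF d assms(2)] rat_hom_zero[OF assms(1)] by (metis imageI)
    show "x \<oplus>\<^bsub>N\<^esub> y \<in> f ` H" if "x \<in> f ` H" "y \<in> f ` H" for x y
      using that H by (auto simp flip: rat_hom_add[OF assms(1)] intro!: imageI submodule_add[OF d assms(2)])
    show "q \<odot>\<^bsub>N\<^esub> x \<in> f ` H" if "x \<in> f ` H" for q x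
      using that H by (auto simp flip: rat_hom_smult[OF assms(1)] intro!: imageI submodule_smult[OF d assms(2)])
  qed
qed

lemma submodule_rat_hom_vimage:
  assumes "rat_hom M N f" "submodule H rat_ring N"
  shows "submodule {x \<in> carrier M. f x \<in> H} rat_ring M"
proof -
  note d = rat_hom_dom[OF assms(1)] and c = rat_hom_cod[OF assms(1)]
  interpret M: module rat_ring M by (rule d)
  show ?thesis
    by (rule rat_submodule_intro[OF d])
      (auto simp: rat_hom_zero[OF assms(1)] submodule_zero[OF c assms(2)] rat_hom_add[OF assms(1)]
        submodule_add[OF c assms(2)] rat_hom_smult[OF assms(1)] submodule_smult[OF c assms(2)])
qed

lemma submodule_carrier: "rat_module M \<Longrightarrow> submodule (carrier M) rat_ring M"
  by (rule module.carrier_is_submodule)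

lemma fin_supp_uminus:
  assumes "rat_module M" "c \<in> carrier (fin_supp_module I M)"
  shows "\<ominus>\<^bsub>fin_supp_module I M\<^esub> c = (\<lambda>x. \<ominus>\<^bsub>M\<^esub> c x)"
  using assms by (simp add: rat_module_minus_eq rat_module_fin_supp fin_supp_closed)

lemma fin_supp_minus:
  assumes "rat_module M" "d \<in> carrier (fin_supp_module I M)"
  shows "c \<ominus>\<^bsub>fin_supp_module I M\<^esub> d = (\<lambda>x. c x \<ominus>\<^bsub>M\<^esub> d x)"
  using assms by (simp add: a_minus_def fin_supp_uminus)

definition group_module :: "('g, 'n) monoid_scheme \<Rightarrow> (rat, 'a, 'm) module_scheme \<Rightarrow> ('g \<Rightarrow> 'a \<Rightarrow> 'a) \<Rightarrow> bool"
  where "group_module G M \<rho> \<longleftrightarrow> group G \<and> rat_module M \<and> (\<forall>g\<in>carrier G. rat_hom M M (\<rho> g)) \<and>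
    (\<forall>g\<in>carrier G. \<forall>h\<in>carrier G. \<forall>m\<in>carrier M. \<rho> (g \<otimes>\<^bsub>G\<^esub> h) m = \<rho> g (\<rho> h m))"

lemma
  assumes "group_module G M \<rho>"
  shows group_module_group: "group G" and group_module_module: "rat_module M"
    and group_module_hom: "g \<in> carrier G \<Longrightarrow> rat_hom M M (\<rho> g)"
    and group_module_mult: "g \<in> carrier G \<Longrightarrow> h \<in> carrier G \<Longrightarrow> m \<in> carrier M \<Longrightarrow>
      \<rho> (g \<otimes>\<^bsub>G\<^esub> h) m = \<rho> g (\<rho> h m)"
    and group_module_hom_inv: "g \<in> carrier G \<Longrightarrow> rat_hom M M (\<rho> (inv\<^bsub>G\<^esub> g))"
  using assms by (auto simp: group_module_def)

lemma rat_hom_if: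
  assumes "rat_hom M N f"
  shows "rat_hom M N (\<lambda>m. if b then f m else \<zero>\<^bsub>N\<^esub>)"
  using assms rat_hom_zero_map[OF rat_hom_dom[OF assms] rat_hom_cod[OF assms]] by (cases b) simp_all

lemma bar_d1_eq: "bar_d1 G M \<rho> = supp_sum M M (\<lambda>g m. \<rho> (inv\<^bsub>G\<^esub> g) m \<ominus>\<^bsub>M\<^esub> m)"
  by (simp add: fun_eq_iff bar_d1_def supp_sum_def)

lemma rat_hom_bar_d1_summand:
  assumes "group_module G M \<rho>" "g \<in> carrier G"
  shows "rat_hom M M (\<lambda>m. \<rho> (inv\<^bsub>G\<^esub> g) m \<ominus>\<^bsub>M\<^esub> m)"
  by (intro rat_hom_minus_map rat_hom_id group_module_hom_inv[OF assms] group_module_module[OF assms(1)])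

lemma rat_hom_bar_d1:
  assumes "group_module G M \<rho>"
  shows "rat_hom (bar1 G M) M (bar_d1 G M \<rho>)"
  unfolding bar_d1_eq using group_module_module[OF assms] rat_hom_bar_d1_summand[OF assms]
  by (intro rat_hom_supp_sum) auto

lemma bar_d1_single:
  assumes "group_module G M \<rho>" "g \<in> carrier G" "m \<in> carrier M"
  shows "bar_d1 G M \<rho> (fs_single M g m) = \<rho> (inv\<^bsub>G\<^esub> g) m \<ominus>\<^bsub>M\<^esub> m"
  unfolding bar_d1_eq using assms group_module_module[OF assms(1)] rat_hom_bar_d1_summand[OF assms(1)]
  by (subst supp_sum_single) auto

text \<open>The contribution of \<open>m\<close> placed at the pair \<open>p\<close> to the
  coordinate \<open>x\<close> of the boundary.\<close>

definition bar_d2_summand where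
  "bar_d2_summand G M \<rho> x p m =
       (if snd p = x then \<rho> (inv\<^bsub>G\<^esub> (fst p)) m else \<zero>\<^bsub>M\<^esub>)
       \<ominus>\<^bsub>M\<^esub> (if fst p \<otimes>\<^bsub>G\<^esub> snd p = x then m else \<zero>\<^bsub>M\<^esub>)
       \<oplus>\<^bsub>M\<^esub> (if fst p = x then m else \<zero>\<^bsub>M\<^esub>)"

lemma bar_d2_eq: "bar_d2 G M \<rho> c x = supp_sum M M (bar_d2_summand G M \<rho> x) c"
  by (simp add: bar_d2_def supp_sum_def bar_d2_summand_def)

lemma rat_hom_bar_d2_summand:
  assumes "group_module G M \<rho>" "p \<in> carrier G \<times> carrier G"
  shows "rat_hom M M (bar_d2_summand G M \<rho> x p)"
proof -
  have "fst p \<in> carrier G" using assms(2) by auto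
  then show ?thesis unfolding bar_d2_summand_def
    by (intro rat_hom_add_map rat_hom_minus_map rat_hom_if rat_hom_id
        group_module_hom_inv[OF assms(1)] group_module_module[OF assms(1)])
qed

lemma bar_d2_single:
  assumes "group_module G M \<rho>" "g \<in> carrier G" "h \<in> carrier G" "m \<in> carrier M"
  shows "bar_d2 G M \<rho> (fs_single M (g, h) m) =
    (fs_single M h (\<rho> (inv\<^bsub>G\<^esub> g) m) \<ominus>\<^bsub>bar1 G M\<^esub> fs_single M (g \<otimes>\<^bsub>G\<^esub> h) m)
      \<oplus>\<^bsub>bar1 G M\<^esub> fs_single M g m"
proof
  fix x
  interpret G: group G using assms(1) by (rule group_module_group)
  have M: "rat_module M" using assms(1) by (rule group_module_module)
  have s: "fs_single M (g \<otimes>\<^bsub>G\<^esub> h) m \<in> carrier (bar1 G M)"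
    using assms M by (intro fs_single_closed) auto
  have "bar_d2 G M \<rho> (fs_single M (g, h) m) x = bar_d2_summand G M \<rho> x (g, h) m"
    unfolding bar_d2_eq using assms by (intro supp_sum_single rat_hom_bar_d2_summand M) auto
  then show "bar_d2 G M \<rho> (fs_single M (g, h) m) x =
    ((fs_single M h (\<rho> (inv\<^bsub>G\<^esub> g) m) \<ominus>\<^bsub>bar1 G M\<^esub> fs_single M (g \<otimes>\<^bsub>G\<^esub> h) m)
      \<oplus>\<^bsub>bar1 G M\<^esub> fs_single M g m) x"
    unfolding fin_supp_minus[OF M s] by (simp add: bar_d2_summand_def fs_single_def eq_commute[of x])
qed

lemma bar_d2_coord_hom:
  assumes "group_module G M \<rho>"
  shows "rat_hom (bar2 G M) M (\<lambda>c. bar_d2 G M \<rho> c x)"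
  unfolding bar_d2_eq using group_module_module[OF assms] rat_hom_bar_d2_summand[OF assms]
  by (intro rat_hom_supp_sum) auto

text \<open>The boundary is given coordinate by coordinate, so the finiteness of its support is not
  visible. It follows by additivity from chains supported at one pair, whose boundary lives on at
  most three group elements.\<close>

lemma bar_d2_closed:
  assumes "group_module G M \<rho>" "c \<in> carrier (bar2 G M)"
  shows "bar_d2 G M \<rho> c \<in> carrier (bar1 G M)"
  using group_module_module[OF assms(1)] assms(2)
proof (induction rule: fin_supp_induct)
  case zero
  have "bar_d2 G M \<rho> (\<lambda>_. \<zero>\<^bsub>M\<^esub>) = (\<lambda>_. \<zero>\<^bsub>M\<^esub>)"
    using rat_hom_zero[OF bar_d2_coord_hom[OF assms(1)]] by (auto simp: fun_eq_iff)
  moreover interpret M: module rat_ring "bar1 G M"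
    using rat_module_fin_supp group_module_module[OF assms(1)] by blast
  show ?case using M.zero_closed by (simp add: calculation)
next
  case (add c i m)
  obtain g h where i: "i = (g, h)" "g \<in> carrier G" "h \<in> carrier G" using add(2) by auto
  have M: "rat_module M" using assms(1) by (rule group_module_module)
  interpret G: group G using assms(1) by (rule group_module_group)
  interpret F: module rat_ring "bar1 G M" using M by (rule rat_module_fin_supp)
  have s: "bar_d2 G M \<rho> (fs_single M i m) \<in> carrier (bar1 G M)"
    unfolding i bar_d2_single[OF assms(1) i(2,3) add(3)]
    using i add(3) rat_hom_closed[OF group_module_hom_inv[OF assms(1) i(2)] add(3)]
    by (intro F.add.m_closed F.minus_closed fs_single_closed M) auto
  have e: "fs_single M i m \<in> carrier (bar2 G M)" using M add(2,3) by (rule fs_single_closed)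
  have "bar_d2 G M \<rho> (c \<oplus>\<^bsub>bar2 G M\<^esub> fs_single M i m) =
    bar_d2 G M \<rho> c \<oplus>\<^bsub>bar1 G M\<^esub> bar_d2 G M \<rho> (fs_single M i m)"
    using rat_hom_add[OF bar_d2_coord_hom[OF assms(1)] add(1) e] by (auto simp: fun_eq_iff)
  then show ?case using F.add.m_closed[OF add(4) s] by simp
qed

lemma rat_hom_bar_d2:
  assumes "group_module G M \<rho>"
  shows "rat_hom (bar2 G M) (bar1 G M) (bar_d2 G M \<rho>)"
proof (rule rat_hom_intro)
  show "rat_module (bar2 G M)" "rat_module (bar1 G M)"
    using assms by (auto intro: rat_module_fin_supp group_module_module)
qed (auto simp: bar_d2_closed[OF assms] fun_eq_iff
    rat_hom_add[OF bar_d2_coord_hom[OF assms], simplified]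
    rat_hom_smult[OF bar_d2_coord_hom[OF assms], simplified])

lemma bar_d1_d2:
  assumes "group_module G M \<rho>" "c \<in> carrier (bar2 G M)"
  shows "bar_d1 G M \<rho> (bar_d2 G M \<rho> c) = \<zero>\<^bsub>M\<^esub>"
proof (rule fin_supp_hom_eqI[OF _ _ _ _ assms(2)])
  show M: "rat_module M" using assms(1) by (rule group_module_module)
  show "rat_hom (bar2 G M) M (\<lambda>c. bar_d1 G M \<rho> (bar_d2 G M \<rho> c))"
    by (rule rat_hom_comp[OF rat_hom_bar_d2[OF assms(1)] rat_hom_bar_d1[OF assms(1)]])
  show "rat_hom (bar2 G M) M (\<lambda>_. \<zero>\<^bsub>M\<^esub>)" using M by (intro rat_hom_zero_map rat_module_fin_supp)
  fix i m assume i: "i \<in> carrier G \<times> carrier G" and m: "m \<in> carrier M"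
  obtain g h where gh: "i = (g, h)" "g \<in> carrier G" "h \<in> carrier G" using i by auto
  interpret G: group G using assms(1) by (rule group_module_group)
  interpret M: module rat_ring M by (rule M)
  interpret F: module rat_ring "bar1 G M" using M by (rule rat_module_fin_supp)
  note d1 = rat_hom_bar_d1[OF assms(1)]
  have gm: "\<rho> (inv\<^bsub>G\<^esub> g) m \<in> carrier M" "\<rho> (inv\<^bsub>G\<^esub> (g \<otimes>\<^bsub>G\<^esub> h)) m \<in> carrier M"
    using rat_hom_closed[OF group_module_hom_inv[OF assms(1)]] gh m by auto
  \<comment> \<open>Inverses turn the left action into a right action, so acting by \<open>g\<close>
    and then by \<open>h\<close> is acting by the product.\<close>
  have e: "\<rho> (inv\<^bsub>G\<^esub> h) (\<rho> (inv\<^bsub>G\<^esub> g) m) = \<rho> (inv\<^bsub>G\<^esub> (g \<otimes>\<^bsub>G\<^esub> h)) m"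
    using group_module_mult[OF assms(1), of "inv\<^bsub>G\<^esub> h" "inv\<^bsub>G\<^esub> g"] gh m by (simp add: G.inv_mult_group)
  have s: "fs_single M x y \<in> carrier (bar1 G M)" if "x \<in> carrier G" "y \<in> carrier M" for x y
    using M that by (rule fs_single_closed)
  have "bar_d1 G M \<rho> (bar_d2 G M \<rho> (fs_single M i m)) =
    (\<rho> (inv\<^bsub>G\<^esub> h) (\<rho> (inv\<^bsub>G\<^esub> g) m) \<ominus>\<^bsub>M\<^esub> \<rho> (inv\<^bsub>G\<^esub> g) m) \<ominus>\<^bsub>M\<^esub>
    (\<rho> (inv\<^bsub>G\<^esub> (g \<otimes>\<^bsub>G\<^esub> h)) m \<ominus>\<^bsub>M\<^esub> m) \<oplus>\<^bsub>M\<^esub> (\<rho> (inv\<^bsub>G\<^esub> g) m \<ominus>\<^bsub>M\<^esub> m)"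
    unfolding gh(1) bar_d2_single[OF assms(1) gh(2,3) m]
    using s gh gm m
    by (simp add: rat_hom_add[OF d1] rat_hom_minus[OF d1] bar_d1_single[OF assms(1)] del: fin_supp_module_simps)
  also have "\<dots> = \<zero>\<^bsub>M\<^esub>" unfolding e using gm m
    by (simp add: a_minus_def M.minus_add M.a_ac M.r_neg M.r_neg1 M.r_neg2)
  finally show "bar_d1 G M \<rho> (bar_d2 G M \<rho> (fs_single M i m)) = \<zero>\<^bsub>M\<^esub>" .
qed

definition equivariant where
  "equivariant G M \<rho> N \<sigma> f \<longleftrightarrow> rat_hom M N f \<and>
    (\<forall>g\<in>carrier G. \<forall>m\<in>carrier M. f (\<rho> g m) = \<sigma> g (f m))"

lemma
  assumes "equivariant G M \<rho> N \<sigma> f"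
  shows equivariant_hom: "rat_hom M N f"
    and equivariant_eq: "g \<in> carrier G \<Longrightarrow> m \<in> carrier M \<Longrightarrow> f (\<rho> g m) = \<sigma> g (f m)"
  using assms by (auto simp: equivariant_def)

lemma equivariant_bar_d1:
  assumes M: "group_module G M \<rho>" and N: "group_module G N \<sigma>" and f: "equivariant G M \<rho> N \<sigma> f"
    and c: "c \<in> carrier (bar1 G M)"
  shows "f (bar_d1 G M \<rho> c) = bar_d1 G N \<sigma> (\<lambda>x. f (c x))"
proof (rule fin_supp_hom_eqI[OF _ _ _ _ c])
  note fh = equivariant_hom[OF f]
  show "rat_module M" using M by (rule group_module_module)
  show "rat_hom (bar1 G M) N (\<lambda>c. f (bar_d1 G M \<rho> c))"
    by (rule rat_hom_comp[OF rat_hom_bar_d1[OF M] fh])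
  show "rat_hom (bar1 G M) N (\<lambda>c. bar_d1 G N \<sigma> (\<lambda>x. f (c x)))"
    by (rule rat_hom_comp[OF rat_hom_fin_supp_map[OF fh] rat_hom_bar_d1[OF N]])
  interpret G: group G using M by (rule group_module_group)
  fix g m assume g: "g \<in> carrier G" and m: "m \<in> carrier M"
  show "f (bar_d1 G M \<rho> (fs_single M g m)) = bar_d1 G N \<sigma> (\<lambda>x. f (fs_single M g m x))"
    using rat_hom_closed[OF group_module_hom_inv[OF M g] m] m g rat_hom_closed[OF fh m]
    by (simp add: fs_single_map[OF fh] bar_d1_single[OF M] bar_d1_single[OF N] rat_hom_minus[OF fh]
        equivariant_eq[OF f])
qed

lemma equivariant_bar_d2:
  assumes M: "group_module G M \<rho>" and N: "group_module G N \<sigma>" and f: "equivariant G M \<rho> N \<sigma> f"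
    and c: "c \<in> carrier (bar2 G M)"
  shows "(\<lambda>x. f (bar_d2 G M \<rho> c x)) = bar_d2 G N \<sigma> (\<lambda>x. f (c x))"
proof (rule fin_supp_hom_eqI[OF _ _ _ _ c])
  note fh = equivariant_hom[OF f]
  show M': "rat_module M" using M by (rule group_module_module)
  have N': "rat_module N" using N by (rule group_module_module)
  show "rat_hom (bar2 G M) (bar1 G N) (\<lambda>c x. f (bar_d2 G M \<rho> c x))"
    by (rule rat_hom_comp[OF rat_hom_bar_d2[OF M] rat_hom_fin_supp_map[OF fh]])
  show "rat_hom (bar2 G M) (bar1 G N) (\<lambda>c. bar_d2 G N \<sigma> (\<lambda>x. f (c x)))"
    by (rule rat_hom_comp[OF rat_hom_fin_supp_map[OF fh] rat_hom_bar_d2[OF N]])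
  interpret G: group G using M by (rule group_module_group)
  fix i m assume i: "i \<in> carrier G \<times> carrier G" and m: "m \<in> carrier M"
  obtain g h where gh: "i = (g, h)" "g \<in> carrier G" "h \<in> carrier G" using i by auto
  note fc = rat_hom_fin_supp_map[OF fh, of "carrier G"]
  have gm: "\<rho> (inv\<^bsub>G\<^esub> g) m \<in> carrier M"
    using rat_hom_closed[OF group_module_hom_inv[OF M]] gh m by auto
  interpret F: module rat_ring "bar1 G M" using M' by (rule rat_module_fin_supp)
  have s: "fs_single M x y \<in> carrier (bar1 G M)" if "x \<in> carrier G" "y \<in> carrier M" for x y
    using M' that by (rule fs_single_closed)
  have "(\<lambda>x. f (bar_d2 G M \<rho> (fs_single M i m) x)) = bar_d2 G N \<sigma> (fs_single N (g, h) (f m))"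
    unfolding gh(1) bar_d2_single[OF M gh(2,3) m] bar_d2_single[OF N gh(2,3) rat_hom_closed[OF fh m]]
    by (subst rat_hom_add[OF fc], use s gh m gm in simp, use s gh m in simp,
       subst rat_hom_minus[OF fc], use s gh m gm in simp, use s gh m in simp,
       use gh m in \<open>simp add: fs_single_map[OF fh] equivariant_eq[OF f] del: fin_supp_module_simps\<close>)
  then show "(\<lambda>x. f (bar_d2 G M \<rho> (fs_single M i m) x)) = bar_d2 G N \<sigma> (\<lambda>x. f (fs_single M i m x))"
    by (simp add: fs_single_map[OF fh] gh(1))
qed

section \<open>The connecting homomorphism\<close>

lemma abelian_group_minus_cancel_right:
  assumes "abelian_group M" "x \<in> carrier M" "y \<in> carrier M" "z \<in> carrier M"
  shows "(x \<oplus>\<^bsub>M\<^esub> z) \<ominus>\<^bsub>M\<^esub> (y \<oplus>\<^bsub>M\<^esub> z) = x \<ominus>\<^bsub>M\<^esub> y"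
proof -
  interpret abelian_group M by fact
  show ?thesis using assms(2-)
    by (simp add: a_minus_def minus_add a_comm[of "\<ominus>\<^bsub>M\<^esub> y" "\<ominus>\<^bsub>M\<^esub> z"] a_assoc r_neg2)
qed

lemma coinvariant_generator_closed:
  assumes "group_module G M \<rho>"
  shows "{\<rho> g m \<ominus>\<^bsub>M\<^esub> m | g m. g \<in> carrier G \<and> m \<in> carrier M} \<subseteq> carrier M"
proof -
  interpret M: module rat_ring M using assms by (rule group_module_module)
  show ?thesis using rat_hom_closed[OF group_module_hom[OF assms]] by auto
qed

lemma submodule_coinvariant_relations:
  assumes "group_module G M \<rho>"
  shows "submodule (coinvariant_relations G M \<rho>) rat_ring M"
  unfolding coinvariant_relations_def
  by (rule submodule_rat_span[OF group_module_module[OF assms] coinvariant_generator_closed[OF assms]])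

lemma coinvariant_relations_generator:
  "g \<in> carrier G \<Longrightarrow> m \<in> carrier M \<Longrightarrow> \<rho> g m \<ominus>\<^bsub>M\<^esub> m \<in> coinvariant_relations G M \<rho>"
  unfolding coinvariant_relations_def by (rule subsetD[OF rat_span_superset]) auto

lemma bar_d1_coinvariant_relations:
  assumes "group_module G M \<rho>" "c \<in> carrier (bar1 G M)"
  shows "bar_d1 G M \<rho> c \<in> coinvariant_relations G M \<rho>"
  unfolding bar_d1_def
proof (rule submodule_finsum[OF group_module_module[OF assms(1)] submodule_coinvariant_relations[OF assms(1)]])
  interpret G: group G using assms(1) by (rule group_module_group)
  fix g assume "g \<in> {g. c g \<noteq> \<zero>\<^bsub>M\<^esub>}"
  then have "g \<in> carrier G" using assms(2) by (auto simp: fin_supp_carrier_iff)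
  then show "\<rho> (inv\<^bsub>G\<^esub> g) (c g) \<ominus>\<^bsub>M\<^esub> c g \<in> coinvariant_relations G M \<rho>"
    using fin_supp_closed[OF group_module_module[OF assms(1)] assms(2)]
    by (intro coinvariant_relations_generator) auto
qed

lemma rat_hom_H0_class:
  assumes "group_module G M \<rho>"
  shows "rat_hom M (H0 G M \<rho>) (H0_class G M \<rho>)"
  unfolding H0_def H0_class_def[abs_def]
  by (rule rat_hom_quotient[OF group_module_module[OF assms] submodule_coinvariant_relations[OF assms]])

lemma H0_class_eq_iff:
  assumes "group_module G M \<rho>" "x \<in> carrier M" "y \<in> carrier M"
  shows "H0_class G M \<rho> x = H0_class G M \<rho> y \<longleftrightarrow> x \<ominus>\<^bsub>M\<^esub> y \<in> coinvariant_relations G M \<rho>"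
  unfolding H0_class_def
  by (rule coset_eq_iff[OF group_module_module[OF assms(1)] submodule_coinvariant_relations[OF assms(1)] assms(2,3)])

locale coefficient_sequence =
  fixes G :: "('g, 'n) monoid_scheme"
    and A :: "(rat, 'a, 'k) module_scheme" and \<alpha>
    and B :: "(rat, 'b, 'l) module_scheme" and \<beta>
    and C :: "(rat, 'c, 'm) module_scheme" and \<kappa>
    and i :: "'a \<Rightarrow> 'b" and p :: "'b \<Rightarrow> 'c"
  assumes A: "group_module G A \<alpha>" and B: "group_module G B \<beta>" and C: "group_module G C \<kappa>"
    and i: "equivariant G A \<alpha> B \<beta> i" and p: "equivariant G B \<beta> C \<kappa> p"
    and inj: "inj_on i (carrier A)" and surj: "p ` carrier B = carrier C"
    and exact: "x \<in> carrier B \<Longrightarrow> p x = \<zero>\<^bsub>C\<^esub> \<longleftrightarrow> x \<in> i ` carrier A"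
begin

lemmas A_module = group_module_module[OF A]
lemmas B_module = group_module_module[OF B]
lemmas C_module = group_module_module[OF C]
lemmas i_hom = equivariant_hom[OF i]
lemmas p_hom = equivariant_hom[OF p]

text \<open>Diagram chase: lift \<open>e\<close> to a 2-chain \<open>f\<close> over
  \<open>B\<close>. Then \<open>w - v - d f\<close> dies in \<open>C\<close>, so it comes from a
  1-chain \<open>t\<close> over \<open>A\<close>; since \<open>d d f = 0\<close> and
  \<open>i\<close> is injective, the boundary of \<open>t\<close> is \<open>a - b\<close>.
  Boundaries of 1-chains are coinvariant relations.\<close>

lemma H0_class_unique:
  assumes w: "w \<in> carrier (bar1 G B)" and v: "v \<in> carrier (bar1 G B)"
    and a: "a \<in> carrier A" and b: "b \<in> carrier A"
    and wa: "bar_d1 G B \<beta> w = i a" and vb: "bar_d1 G B \<beta> v = i b"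
    and e: "e \<in> carrier (bar2 G C)"
    and eq: "(\<lambda>x. p (w x)) \<ominus>\<^bsub>bar1 G C\<^esub> (\<lambda>x. p (v x)) = bar_d2 G C \<kappa> e"
  shows "H0_class G A \<alpha> a = H0_class G A \<alpha> b"
proof -
  interpret B: module rat_ring B by (rule B_module)
  interpret A: module rat_ring A by (rule A_module)
  interpret B1: module rat_ring "bar1 G B" by (rule rat_module_fin_supp[OF B_module])
  interpret C1: module rat_ring "bar1 G C" by (rule rat_module_fin_supp[OF C_module])
  have "e x \<in> p ` carrier B" for x using fin_supp_closed[OF C_module e] surj by simp
  then obtain f where f: "f \<in> carrier (bar2 G B)" "(\<lambda>x. p (f x)) = e"
    using fin_supp_lift[OF p_hom e] by blast
  define df where "df = bar_d2 G B \<beta> f"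
  have df: "df \<in> carrier (bar1 G B)" unfolding df_def using B f(1) by (rule bar_d2_closed)
  have pdf: "(\<lambda>x. p (df x)) = bar_d2 G C \<kappa> e"
    unfolding df_def using equivariant_bar_d2[OF B C p f(1)] f(2) by simp
  define u where "u = w \<ominus>\<^bsub>bar1 G B\<^esub> v \<ominus>\<^bsub>bar1 G B\<^esub> df"
  have u: "u \<in> carrier (bar1 G B)" unfolding u_def using w v df by simp
  note P = rat_hom_fin_supp_map[OF p_hom, of "carrier G"]
  have "(\<lambda>x. p (u x)) = bar_d2 G C \<kappa> e \<ominus>\<^bsub>bar1 G C\<^esub> bar_d2 G C \<kappa> e"
    unfolding u_def using w v df rat_hom_minus[OF P] eq pdf by simp
  also have "\<dots> = \<zero>\<^bsub>bar1 G C\<^esub>"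
    using C1.add.r_inv[OF bar_d2_closed[OF C e]] unfolding a_minus_def .
  finally have "p (u x) = \<zero>\<^bsub>C\<^esub>" for x by (auto simp: fun_eq_iff)
  then have "u x \<in> i ` carrier A" for x using exact fin_supp_closed[OF B_module u] by blast
  then obtain t where t: "t \<in> carrier (bar1 G A)" "(\<lambda>x. i (t x)) = u"
    using fin_supp_lift[OF i_hom u] by blast
  define d where "d = bar_d1 G A \<alpha> t"
  have d: "d \<in> coinvariant_relations G A \<alpha>"
    unfolding d_def by (rule bar_d1_coinvariant_relations[OF A t(1)])
  have dA: "d \<in> carrier A" unfolding d_def by (rule rat_hom_closed[OF rat_hom_bar_d1[OF A] t(1)])
  note d1 = rat_hom_bar_d1[OF B]
  have "i d = bar_d1 G B \<beta> u" unfolding d_def using equivariant_bar_d1[OF A B i t(1)] t(2) by simp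
  also have "\<dots> = i a \<ominus>\<^bsub>B\<^esub> i b \<ominus>\<^bsub>B\<^esub> bar_d1 G B \<beta> df"
    unfolding u_def using w v df by (simp add: rat_hom_minus[OF d1] wa vb)
  also have "bar_d1 G B \<beta> df = \<zero>\<^bsub>B\<^esub>" unfolding df_def using B f(1) by (rule bar_d1_d2)
  also have "i a \<ominus>\<^bsub>B\<^esub> i b \<ominus>\<^bsub>B\<^esub> \<zero>\<^bsub>B\<^esub> = i (a \<ominus>\<^bsub>A\<^esub> b)"
    unfolding rat_hom_minus[OF i_hom a b]
    using rat_hom_closed[OF i_hom a] rat_hom_closed[OF i_hom b] by (simp add: a_minus_def)
  finally have "d = a \<ominus>\<^bsub>A\<^esub> b" using inj dA a b by (auto dest: inj_onD)
  then show ?thesis using d a b by (simp add: H0_class_eq_iff[OF A])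
qed

lemma mem_H1_coset:
  "X \<in> carrier (H1 G C \<kappa>) \<longleftrightarrow>
    (\<exists>z\<in>bar_Z1 G C \<kappa>. X = {b \<oplus>\<^bsub>bar1 G C\<^esub> z | b. b \<in> bar_B1 G C \<kappa>})"
  by (auto simp: H1_def quotient_module_simps(1) a_r_coset_def' image_iff)

text \<open>Two chains that project into the same class differ in \<open>C\<close> by a boundary, so
  \<open>H0_class_unique\<close> leaves a single value for the definite description.\<close>

lemma connecting_hom_eq:
  assumes X: "X = {b \<oplus>\<^bsub>bar1 G C\<^esub> z | b. b \<in> bar_B1 G C \<kappa>}" and z: "z \<in> bar_Z1 G C \<kappa>"
    and w: "w \<in> carrier (bar1 G B)" and a: "a \<in> carrier A"
    and wX: "(\<lambda>x. p (w x)) \<in> X" and wa: "bar_d1 G B \<beta> w = i a"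
  shows "connecting_hom G A \<alpha> B \<beta> i p X = H0_class G A \<alpha> a"
  unfolding connecting_hom_def
proof (rule the_equality)
  show "\<exists>w\<in>carrier (bar1 G B). \<exists>a'\<in>carrier A. (\<lambda>g. p (w g)) \<in> X \<and> bar_d1 G B \<beta> w = i a' \<and>
    H0_class G A \<alpha> a = H0_class G A \<alpha> a'"
    using w a wX wa by blast
next
  fix Y assume "\<exists>w\<in>carrier (bar1 G B). \<exists>a'\<in>carrier A. (\<lambda>g. p (w g)) \<in> X \<and> bar_d1 G B \<beta> w = i a' \<and>
    Y = H0_class G A \<alpha> a'"
  then obtain v b where v: "v \<in> carrier (bar1 G B)" and b: "b \<in> carrier A"
    and vX: "(\<lambda>g. p (v g)) \<in> X" and vb: "bar_d1 G B \<beta> v = i b" and Y: "Y = H0_class G A \<alpha> b" by blast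
  interpret C1: module rat_ring "bar1 G C" by (rule rat_module_fin_supp[OF C_module])
  have zc: "z \<in> carrier (bar1 G C)" using z by (auto simp: bar_Z1_def)
  obtain e where e: "e \<in> carrier (bar2 G C)" "(\<lambda>x. p (w x)) = bar_d2 G C \<kappa> e \<oplus>\<^bsub>bar1 G C\<^esub> z"
    using wX unfolding X bar_B1_def by blast
  obtain f where f: "f \<in> carrier (bar2 G C)" "(\<lambda>x. p (v x)) = bar_d2 G C \<kappa> f \<oplus>\<^bsub>bar1 G C\<^esub> z"
    using vX unfolding X bar_B1_def by blast
  interpret C2: module rat_ring "bar2 G C" by (rule rat_module_fin_supp[OF C_module])
  have c: "bar_d2 G C \<kappa> e \<in> carrier (bar1 G C)" "bar_d2 G C \<kappa> f \<in> carrier (bar1 G C)"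
    using e f bar_d2_closed[OF C] by auto
  have "(\<lambda>x. p (w x)) \<ominus>\<^bsub>bar1 G C\<^esub> (\<lambda>x. p (v x)) = bar_d2 G C \<kappa> e \<ominus>\<^bsub>bar1 G C\<^esub> bar_d2 G C \<kappa> f"
    unfolding e(2) f(2) using c zc
    by (rule abelian_group_minus_cancel_right[OF C1.abelian_group_axioms])
  also have "\<dots> = bar_d2 G C \<kappa> (e \<ominus>\<^bsub>bar2 G C\<^esub> f)"
    using e f by (simp add: rat_hom_minus[OF rat_hom_bar_d2[OF C]])
  finally show "Y = H0_class G A \<alpha> a" unfolding Y
    using H0_class_unique[OF w v a b wa vb C2.minus_closed[OF e(1) f(1)]] by simp
qed

text \<open>This removes \<open>H1\<close> from the problem. A chain over \<open>B\<close> whose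
  boundary comes from \<open>A\<close> projects to a cycle over \<open>C\<close>, and every cycle
  over \<open>C\<close> lifts to such a chain.\<close>

theorem connecting_hom_image:
  "connecting_hom G A \<alpha> B \<beta> i p ` carrier (H1 G C \<kappa>) =
    H0_class G A \<alpha> ` {a \<in> carrier A. i a \<in> bar_d1 G B \<beta> ` carrier (bar1 G B)}"
proof (intro equalityI subsetI)
  interpret C1: module rat_ring "bar1 G C" by (rule rat_module_fin_supp[OF C_module])
  have B0: "\<zero>\<^bsub>bar1 G C\<^esub> \<in> bar_B1 G C \<kappa>" unfolding bar_B1_def
    using rat_hom_zero[OF rat_hom_bar_d2[OF C]]
      submodule_zero[OF rat_module_fin_supp[OF C_module] submodule_carrier[OF rat_module_fin_supp[OF C_module]]]
    by (metis imageI)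
  have own: "z \<in> {b \<oplus>\<^bsub>bar1 G C\<^esub> z | b. b \<in> bar_B1 G C \<kappa>}" if "z \<in> carrier (bar1 G C)" for z
    using B0 C1.l_zero[OF that] by (metis (mono_tags, lifting) mem_Collect_eq)
  {
    fix Y assume "Y \<in> connecting_hom G A \<alpha> B \<beta> i p ` carrier (H1 G C \<kappa>)"
    then obtain X where X: "X \<in> carrier (H1 G C \<kappa>)" "Y = connecting_hom G A \<alpha> B \<beta> i p X" by blast
    then obtain z where z: "z \<in> bar_Z1 G C \<kappa>" "X = {b \<oplus>\<^bsub>bar1 G C\<^esub> z | b. b \<in> bar_B1 G C \<kappa>}"
      unfolding mem_H1_coset by blast
    have zc: "z \<in> carrier (bar1 G C)" and dz: "bar_d1 G C \<kappa> z = \<zero>\<^bsub>C\<^esub>"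
      using z(1) by (auto simp: bar_Z1_def)
    have "z x \<in> p ` carrier B" for x using fin_supp_closed[OF C_module zc] surj by simp
    then obtain w where w: "w \<in> carrier (bar1 G B)" "(\<lambda>x. p (w x)) = z"
      using fin_supp_lift[OF p_hom zc] by blast
    have "p (bar_d1 G B \<beta> w) = \<zero>\<^bsub>C\<^esub>"
      using equivariant_bar_d1[OF B C p w(1)] w(2) dz by simp
    then obtain a where a: "a \<in> carrier A" "bar_d1 G B \<beta> w = i a"
      using exact rat_hom_closed[OF rat_hom_bar_d1[OF B] w(1)] by blast
    have "Y = H0_class G A \<alpha> a"
      unfolding X(2) using connecting_hom_eq[OF z(2,1) w(1) a(1) _ a(2)] own[OF zc] w(2) z(2) by simp
    then show "Y \<in> H0_class G A \<alpha> ` {a \<in> carrier A. i a \<in> bar_d1 G B \<beta> ` carrier (bar1 G B)}"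
      using a w(1) by (metis (mono_tags, lifting) image_eqI mem_Collect_eq)
  next
    fix Y assume "Y \<in> H0_class G A \<alpha> ` {a \<in> carrier A. i a \<in> bar_d1 G B \<beta> ` carrier (bar1 G B)}"
    then obtain a w where a: "a \<in> carrier A" and Y: "Y = H0_class G A \<alpha> a"
      and w: "w \<in> carrier (bar1 G B)" "bar_d1 G B \<beta> w = i a" by auto
    define z where "z = (\<lambda>x. p (w x))"
    have zc: "z \<in> carrier (bar1 G C)" unfolding z_def using p_hom w(1) by (rule fin_supp_map_closed)
    have "bar_d1 G C \<kappa> z = p (i a)"
      unfolding z_def using equivariant_bar_d1[OF B C p w(1)] w(2) by simp
    also have "\<dots> = \<zero>\<^bsub>C\<^esub>" using exact rat_hom_closed[OF i_hom a] a by blast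
    finally have z: "z \<in> bar_Z1 G C \<kappa>" using zc unfolding bar_Z1_def by blast
    define X where "X = {b \<oplus>\<^bsub>bar1 G C\<^esub> z | b. b \<in> bar_B1 G C \<kappa>}"
    have "Y = connecting_hom G A \<alpha> B \<beta> i p X"
      unfolding Y using connecting_hom_eq[OF X_def z w(1) a _ w(2)] own[OF zc]
      by (simp add: z_def X_def)
    moreover have "X \<in> carrier (H1 G C \<kappa>)" unfolding mem_H1_coset X_def using z by blast
    ultimately show "Y \<in> connecting_hom G A \<alpha> B \<beta> i p ` carrier (H1 G C \<kappa>)" by blast
  }
qed

lemma submodule_connecting_hom_image:
  "submodule (connecting_hom G A \<alpha> B \<beta> i p ` carrier (H1 G C \<kappa>)) rat_ring (H0 G A \<alpha>)"
  unfolding connecting_hom_image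
  by (intro submodule_rat_hom_image[OF rat_hom_H0_class[OF A]] submodule_rat_hom_vimage[OF i_hom]
      submodule_rat_hom_image[OF rat_hom_bar_d1[OF B]] submodule_carrier rat_module_fin_supp B_module)

end

section \<open>The Steinberg module\<close>

abbreviation scl :: "rat \<Rightarrow> ('a \<Rightarrow>\<^sub>0 rat) \<Rightarrow> 'a \<Rightarrow>\<^sub>0 rat"
  where "scl q \<equiv> Poly_Mapping.map ((*) q)"

lemma lookup_scl [simp]: "Poly_Mapping.lookup (scl q c) x = q * Poly_Mapping.lookup c x"
  by (simp add: Poly_Mapping.map.rep_eq when_def)

lemma scl_simps [simp]:
  "scl 0 c = 0" "scl 1 c = c" "scl q (c + d) = scl q c + scl q d" "scl q (c - d) = scl q c - scl q d"
  "scl (p + q) c = scl p c + scl q c" "scl (p * q) c = scl p (scl q c)" "scl (- 1) c = - c"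
  "scl q (- c) = - scl q c" "scl q 0 = 0"
  by (rule poly_mapping_eqI, simp add: lookup_add lookup_minus algebra_simps)+

lemma scl_single: "scl q (Poly_Mapping.single x r) = Poly_Mapping.single x (q * r)"
  by (rule poly_mapping_eqI) (simp add: lookup_single when_def)

lemma lookup_lin_ext:
  assumes "finite S" "Poly_Mapping.keys c \<subseteq> S"
  shows "Poly_Mapping.lookup (lin_ext F c) y = (\<Sum>x\<in>S. Poly_Mapping.lookup c x * Poly_Mapping.lookup (F x) y)"
  unfolding lin_ext_def lookup_sum lookup_scl
  by (rule sum.mono_neutral_left[OF assms]) (auto simp: in_keys_iff)

lemma lin_ext_add: "lin_ext F (c + d) = lin_ext F c + lin_ext F d"
proof (rule poly_mapping_eqI)
  fix y
  let ?S = "Poly_Mapping.keys c \<union> Poly_Mapping.keys d"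
  have "Poly_Mapping.keys (c + d) \<subseteq> ?S" by (rule keys_add)
  then show "Poly_Mapping.lookup (lin_ext F (c + d)) y = Poly_Mapping.lookup (lin_ext F c + lin_ext F d) y"
    by (simp add: lookup_add lookup_lin_ext[of ?S] sum.distrib algebra_simps)
qed

lemma lin_ext_scl: "lin_ext F (scl q c) = scl q (lin_ext F c)"
proof (rule poly_mapping_eqI)
  fix y
  have "Poly_Mapping.keys (scl q c) \<subseteq> Poly_Mapping.keys c" by (auto simp: in_keys_iff)
  then show "Poly_Mapping.lookup (lin_ext F (scl q c)) y = Poly_Mapping.lookup (scl q (lin_ext F c)) y"
    by (simp add: lookup_lin_ext[of "Poly_Mapping.keys c"] sum_distrib_left mult.assoc)
qed

lemma lin_ext_zero [simp]: "lin_ext F 0 = 0"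
  by (simp add: lin_ext_def)

lemma lin_ext_uminus: "lin_ext F (- c) = - lin_ext F c"
  using lin_ext_scl[of F "-1" c] by simp

lemma lin_ext_minus: "lin_ext F (c - d) = lin_ext F c - lin_ext F d"
  using lin_ext_add[of F c "- d"] by (simp add: lin_ext_uminus)

lemma lin_ext_sum: "lin_ext F (\<Sum>x\<in>S. f x) = (\<Sum>x\<in>S. lin_ext F (f x))"
  by (induction S rule: infinite_finite_induct) (simp_all add: lin_ext_add)

lemma lin_ext_single: "lin_ext F (Poly_Mapping.single x q) = scl q (F x)"
  by (cases "q = 0") (simp_all add: lin_ext_def)

lemma lin_ext_cong: "(\<And>x. x \<in> Poly_Mapping.keys c \<Longrightarrow> F x = G x) \<Longrightarrow> lin_ext F c = lin_ext G c"
  by (simp add: lin_ext_def)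

lemma lin_ext_lin_ext: "lin_ext F (lin_ext G c) = lin_ext (\<lambda>x. lin_ext F (G x)) c"
  unfolding lin_ext_def[of G] lin_ext_def[of "\<lambda>x. lin_ext F (G x)"]
  by (simp add: lin_ext_sum lin_ext_scl)

lemma lin_ext_singles: "lin_ext (\<lambda>x. Poly_Mapping.single x 1) c = c"
  by (rule poly_mapping_eqI)
    (auto simp: lookup_lin_ext[OF finite_keys order_refl] lookup_single when_def
      if_distrib[of "(*) _"] in_keys_iff cong: if_cong)

lemma lin_ext_minus_fun: "lin_ext (\<lambda>x. F x - G x) c = lin_ext F c - lin_ext G c"
  by (simp add: lin_ext_def sum_subtractf)

lemma lin_ext_closed:
  assumes "0 \<in> Z" "\<And>x y. x \<in> Z \<Longrightarrow> y \<in> Z \<Longrightarrow> x + y \<in> Z" "\<And>q x. x \<in> Z \<Longrightarrow> scl q x \<in> Z"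
    and "\<And>x. x \<in> Poly_Mapping.keys c \<Longrightarrow> F x \<in> Z"
  shows "lin_ext F c \<in> Z"
proof -
  have "(\<Sum>x\<in>S. scl (f x) (F x)) \<in> Z" if "S \<subseteq> Poly_Mapping.keys c" for S f
    using finite_subset[OF that finite_keys] that
    by (induction S rule: finite_induct) (auto intro!: assms)
  then show ?thesis by (simp add: lin_ext_def)
qed

definition push :: "('a \<Rightarrow> 'b) \<Rightarrow> ('a list \<Rightarrow>\<^sub>0 rat) \<Rightarrow> 'b list \<Rightarrow>\<^sub>0 rat"
  where "push F = lin_ext (\<lambda>xs. Poly_Mapping.single (map F xs) 1)"

lemma
  shows push_add: "push F (c + d) = push F c + push F d"
    and push_minus: "push F (c - d) = push F c - push F d"
    and push_uminus: "push F (- c) = - push F c"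
    and push_scl: "push F (scl q c) = scl q (push F c)"
    and push_zero [simp]: "push F 0 = 0"
    and push_single: "push F (Poly_Mapping.single xs q) = Poly_Mapping.single (map F xs) q"
  by (simp_all add: push_def lin_ext_add lin_ext_minus lin_ext_uminus lin_ext_scl lin_ext_single
      scl_single)

lemma push_lin_ext: "push F (lin_ext K c) = lin_ext (\<lambda>x. push F (K x)) c"
  by (simp add: push_def lin_ext_lin_ext)

lemma lin_ext_push: "lin_ext K (push F c) = lin_ext (\<lambda>xs. K (map F xs)) c"
  by (simp add: push_def lin_ext_lin_ext lin_ext_single)

lemma push_push: "push G (push F c) = push (\<lambda>x. G (F x)) c"
  by (simp add: push_def lin_ext_lin_ext lin_ext_single comp_def)

lemma push_cong:
  "(\<And>xs x. xs \<in> Poly_Mapping.keys c \<Longrightarrow> x \<in> set xs \<Longrightarrow> F x = G x) \<Longrightarrow> push F c = push G c"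
  unfolding push_def by (rule lin_ext_cong) (metis map_eq_conv)

lemma push_id: "push (\<lambda>x. x) c = c"
  by (simp add: push_def lin_ext_singles)

lemma keys_push: "Poly_Mapping.keys (push F c) \<subseteq> map F ` Poly_Mapping.keys c"
proof
  fix ys assume "ys \<in> Poly_Mapping.keys (push F c)"
  then have "(\<Sum>xs\<in>Poly_Mapping.keys c. Poly_Mapping.lookup c xs *
      Poly_Mapping.lookup (Poly_Mapping.single (map F xs) 1) ys) \<noteq> 0"
    by (simp add: in_keys_iff push_def lookup_lin_ext[OF finite_keys order_refl])
  then obtain xs where "xs \<in> Poly_Mapping.keys c" "Poly_Mapping.lookup (Poly_Mapping.single (map F xs) (1::rat)) ys \<noteq> 0"
    using sum.neutral by (metis (no_types, lifting) mult_zero_right)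
  then show "ys \<in> map F ` Poly_Mapping.keys c" by (auto simp: lookup_single when_def split: if_splits)
qed

lemma boundary_single:
  "simplicial_boundary (Poly_Mapping.single xs q) =
    scl q (\<Sum>j<length xs. Poly_Mapping.single (take j xs @ drop (Suc j) xs) ((- 1) ^ j))"
  by (simp add: simplicial_boundary_def lin_ext_single)

text \<open>Omitting an entry of a list commutes with \<open>map\<close>, so \<open>F\<close> may be
  any map of vertices. That images of flags are flags matters only for membership in the chain
  groups.\<close>

lemma boundary_push: "simplicial_boundary (push F c) = push F (simplicial_boundary c)"
  unfolding simplicial_boundary_def lin_ext_push push_lin_ext
  unfolding push_def lin_ext_sum lin_ext_single by (simp add: take_map drop_map scl_single)

lemma
  shows boundary_add: "simplicial_boundary (c + d) = simplicial_boundary c + simplicial_boundary d"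
    and boundary_minus: "simplicial_boundary (c - d) = simplicial_boundary c - simplicial_boundary d"
    and boundary_scl: "simplicial_boundary (scl q c) = scl q (simplicial_boundary c)"
    and boundary_zero [simp]: "simplicial_boundary 0 = 0"
  by (simp_all add: simplicial_boundary_def lin_ext_add lin_ext_minus lin_ext_scl)

section \<open>Flags and cycles of the Tits building\<close>

definition proper_subspace :: "('k::field ^ 3) set \<Rightarrow> bool"
  where "proper_subspace V \<longleftrightarrow> vec.subspace V \<and> V \<noteq> {0} \<and> V \<noteq> UNIV"

lemma proper_subspace_dim:
  fixes V :: "('k::field ^ 3) set"
  assumes "proper_subspace V"
  shows "vec.dim V = 1 \<or> vec.dim V = 2"
proof -
  have V: "vec.span V = V" using assms by (simp add: proper_subspace_def vec.span_eq_iff)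
  have "vec.dim V \<noteq> 0"
    using assms vec.subspace_0[of V] by (auto simp: proper_subspace_def)
  moreover have "vec.dim V \<noteq> 3"
    using vec.dim_eq_full[of V] V assms by (auto simp: proper_subspace_def vec.dimension_def card_cart_basis)
  moreover have "vec.dim V \<le> 3" using vec.dim_subset_UNIV[of V] by (simp add: vec.dimension_def card_cart_basis)
  ultimately show ?thesis by linarith
qed

lemma subspace_psubset_dim:
  fixes V W :: "('k::field ^ 3) set"
  assumes "vec.subspace V" "vec.subspace W" "V \<subset> W"
  shows "vec.dim V < vec.dim W"
  using assms by (intro vec.dim_psubset) (simp add: vec.span_eq_iff[THEN iffD2])

lemma tits_flags_2_iff:
  "xs \<in> tits_flags 2 \<longleftrightarrow> (\<exists>V W. xs = [V, W] \<and> proper_subspace V \<and> proper_subspace W \<and> V \<subset> W)"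
  by (auto simp: tits_flags_def proper_subspace_def length_Suc_conv numeral_2_eq_2)

lemma tits_flag_dims:
  assumes "[V, W] \<in> tits_flags 2"
  shows "vec.dim V = 1" "vec.dim W = 2"
proof -
  have p: "proper_subspace V" "proper_subspace W" "V \<subset> W" using assms by (auto simp: tits_flags_2_iff)
  then have "vec.dim V < vec.dim W" by (intro subspace_psubset_dim) (auto simp: proper_subspace_def)
  then show "vec.dim V = 1" "vec.dim W = 2" using proper_subspace_dim[OF p(1)] proper_subspace_dim[OF p(2)] by auto
qed

text \<open>Dimensions increase strictly along a flag, and only 1 and 2 occur. So the building has
  no 2-simplices and its first homology is the space of cycles itself.\<close>

lemma tits_flags_3: "tits_flags 3 = ({} :: ('k::field ^ 3) set list set)"
proof -
  have False if xs: "xs \<in> tits_flags 3" for xs :: "('k ^ 3) set list"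
  proof -
    obtain U V W where "xs = [U, V, W]" using xs
      by (auto simp: tits_flags_def length_Suc_conv numeral_3_eq_3)
    then have "[U, V] \<in> tits_flags 2" "[V, W] \<in> tits_flags 2"
      using xs by (auto simp: tits_flags_def)
    then show False using tits_flag_dims[of U V] tits_flag_dims[of V W] by simp
  qed
  then show ?thesis by blast
qed

lemma tits_boundaries1_eq: "tits_boundaries1 = {0 :: ('k::field ^ 3) set list \<Rightarrow>\<^sub>0 rat}"
proof -
  have "carrier (tits_chains 3) = {0 :: ('k ^ 3) set list \<Rightarrow>\<^sub>0 rat}"
    by (auto simp: tits_chains_def tits_flags_3)
  then show ?thesis by (simp add: tits_boundaries1_def)
qed

lemma tits_cycles1_simps:
  "c \<oplus>\<^bsub>tits_cycles1\<^esub> d = c + d" "\<zero>\<^bsub>tits_cycles1\<^esub> = 0" "q \<odot>\<^bsub>tits_cycles1\<^esub> c = scl q c"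
  "c \<in> carrier tits_cycles1 \<longleftrightarrow> Poly_Mapping.keys c \<subseteq> tits_flags 2 \<and> simplicial_boundary c = 0"
  by (auto simp: tits_cycles1_def tits_chains_def)

lemma rat_module_tits_cycles1: "rat_module tits_cycles1"
proof (rule rat_module_intro)
  fix c d :: "('k::field ^ 3) set list \<Rightarrow>\<^sub>0 rat"
  assume "c \<in> carrier tits_cycles1" "d \<in> carrier tits_cycles1"
  then show "c \<oplus>\<^bsub>tits_cycles1\<^esub> d \<in> carrier tits_cycles1"
    using keys_add[of c d] by (auto simp: tits_cycles1_simps boundary_add)
next
  fix q and c :: "('k::field ^ 3) set list \<Rightarrow>\<^sub>0 rat"
  assume "c \<in> carrier tits_cycles1"
  then show "q \<odot>\<^bsub>tits_cycles1\<^esub> c \<in> carrier tits_cycles1"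
    by (auto simp: tits_cycles1_simps boundary_scl in_keys_iff subset_iff)
qed (auto simp: tits_cycles1_simps algebra_simps)

lemma tits_cycles1_closed:
  shows "c \<in> carrier tits_cycles1 \<Longrightarrow> d \<in> carrier tits_cycles1 \<Longrightarrow> c + d \<in> carrier tits_cycles1"
    and "c \<in> carrier tits_cycles1 \<Longrightarrow> d \<in> carrier tits_cycles1 \<Longrightarrow> c - d \<in> carrier tits_cycles1"
    and "c \<in> carrier tits_cycles1 \<Longrightarrow> scl q c \<in> carrier tits_cycles1"
    and "0 \<in> carrier tits_cycles1"
proof -
  note s = submodule_carrier[OF rat_module_tits_cycles1]
  note t = submodule_add[OF rat_module_tits_cycles1 s] submodule_smult[OF rat_module_tits_cycles1 s]
  show a: "c \<in> carrier tits_cycles1 \<Longrightarrow> d \<in> carrier tits_cycles1 \<Longrightarrow> c + d \<in> carrier tits_cycles1" for d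
    using t(1) by (simp add: tits_cycles1_simps(1))
  show m: "c \<in> carrier tits_cycles1 \<Longrightarrow> scl q c \<in> carrier tits_cycles1" for q c
    using t(2) by (simp add: tits_cycles1_simps(3))
  show "c \<in> carrier tits_cycles1 \<Longrightarrow> d \<in> carrier tits_cycles1 \<Longrightarrow> c - d \<in> carrier tits_cycles1"
    using a[of "- d"] m[of d "-1"] by simp
  show "0 \<in> carrier tits_cycles1" by (simp add: tits_cycles1_simps)
qed

lemma submodule_tits_boundaries1: "submodule tits_boundaries1 rat_ring tits_cycles1"
  by (rule rat_submodule_intro[OF rat_module_tits_cycles1])
    (auto simp: tits_boundaries1_eq tits_cycles1_simps)

lemma rat_module_steinberg: "rat_module steinberg"
  unfolding steinberg_def by (rule rat_module_quotient[OF rat_module_tits_cycles1 submodule_tits_boundaries1])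

text \<open>There are no boundaries, so the elements of the Steinberg module are the singletons of cycles.\<close>

lemma tits_coset: "tits_boundaries1 +>\<^bsub>tits_cycles1\<^esub> c = {c}"
  by (simp add: a_r_coset_def' tits_boundaries1_eq tits_cycles1_simps)

lemma steinberg_simps:
  "carrier steinberg = (\<lambda>c. {c}) ` carrier tits_cycles1"
  "\<zero>\<^bsub>steinberg\<^esub> = {0}"
  "{c} \<oplus>\<^bsub>steinberg\<^esub> {d} = {c + d}"
  "q \<odot>\<^bsub>steinberg\<^esub> {c} = {scl q c}"
  by (simp_all add: steinberg_def quotient_module_simps tits_coset tits_boundaries1_eq)
    (simp_all add: quotient_module_def coset_map_def set_add_def' tits_cycles1_simps
      a_r_coset_def')

lemma steinberg_minus:
  assumes "d \<in> carrier tits_cycles1"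
  shows "{c} \<ominus>\<^bsub>steinberg\<^esub> {d} = {c - d}"
  using assms by (simp add: a_minus_def rat_module_minus_eq[OF rat_module_steinberg] steinberg_simps)

lemma steinberg_map_singleton: "steinberg_map F {c} = {push F c}"
  by (simp add: steinberg_map_def coset_map_def tits_coset push_def)

definition flag_map :: "(('k::field ^ 3) set \<Rightarrow> ('l::field ^ 3) set) \<Rightarrow> bool"
  where "flag_map F \<longleftrightarrow> (\<forall>V. proper_subspace V \<longrightarrow> proper_subspace (F V)) \<and>
    (\<forall>V W. proper_subspace V \<longrightarrow> proper_subspace W \<longrightarrow> V \<subset> W \<longrightarrow> F V \<subset> F W)"

lemma push_tits_cycles1:
  assumes "flag_map F" "c \<in> carrier tits_cycles1"
  shows "push F c \<in> carrier tits_cycles1"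
proof -
  have "map F xs \<in> tits_flags 2" if flag: "xs \<in> tits_flags 2" for xs
  proof -
    obtain V W where xs: "xs = [V, W]" "proper_subspace V" "proper_subspace W" "V \<subset> W"
      using flag unfolding tits_flags_2_iff by blast
    then have "proper_subspace (F V)" "proper_subspace (F W)" "F V \<subset> F W"
      using assms(1) unfolding flag_map_def by blast+
    then show ?thesis unfolding tits_flags_2_iff xs(1) by simp
  qed
  then have "Poly_Mapping.keys (push F c) \<subseteq> tits_flags 2"
    using keys_push[of F c] assms(2) unfolding tits_cycles1_simps by blast
  then show ?thesis using assms(2) by (simp add: tits_cycles1_simps boundary_push)
qed

lemma rat_hom_steinberg_map:
  assumes "flag_map F"
  shows "rat_hom steinberg steinberg (steinberg_map F)"
proof (rule rat_hom_intro[OF rat_module_steinberg rat_module_steinberg])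
qed (auto simp: steinberg_simps steinberg_map_singleton push_add push_scl push_tits_cycles1[OF assms])

section \<open>Integral matrices of determinant 1 and their action on cycles\<close>

definition adj3 :: "'a::comm_ring_1 ^ 3 ^ 3 \<Rightarrow> 'a ^ 3 ^ 3"
  where "adj3 A = vector
    [vector [A$2$2 * A$3$3 - A$2$3 * A$3$2, A$1$3 * A$3$2 - A$1$2 * A$3$3, A$1$2 * A$2$3 - A$1$3 * A$2$2],
     vector [A$2$3 * A$3$1 - A$2$1 * A$3$3, A$1$1 * A$3$3 - A$1$3 * A$3$1, A$1$3 * A$2$1 - A$1$1 * A$2$3],
     vector [A$2$1 * A$3$2 - A$2$2 * A$3$1, A$1$2 * A$3$1 - A$1$1 * A$3$2, A$1$1 * A$2$2 - A$1$2 * A$2$1]]"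

lemma adj3_mult_det:
  fixes A :: "'a::comm_ring_1 ^ 3 ^ 3"
  shows "adj3 A ** A = mat (det A)" "A ** adj3 A = mat (det A)"
  by (simp_all add: vec_eq_iff forall_3 matrix_matrix_mult_def sum_3 mat_def adj3_def det_3 algebra_simps)

text \<open>The adjugate is an inverse with entries in the same ring; one integral matrix thus
  inverts \<open>g\<close> over the integers and, through \<open>of_int\<close>, over every
  field.\<close>

lemma adj3_mult:
  fixes A :: "'a::comm_ring_1 ^ 3 ^ 3"
  assumes "det A = 1"
  shows "adj3 A ** A = mat 1" "A ** adj3 A = mat 1"
  using adj3_mult_det[of A] assms by simp_all

lemma SL3Z_simps [simp]:
  "carrier SL3Z = {g. det g = 1}" "g \<otimes>\<^bsub>SL3Z\<^esub> h = g ** h" "\<one>\<^bsub>SL3Z\<^esub> = mat 1"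
  by (simp_all add: SL3Z_def)

lemma group_SL3Z: "group SL3Z"
proof (rule groupI)
  fix g assume "g \<in> carrier SL3Z"
  then have g: "det g = 1" by simp
  have "det (adj3 g) = 1" using arg_cong[OF adj3_mult(1)[OF g], of det] g by (simp add: det_mul)
  then show "\<exists>h\<in>carrier SL3Z. h \<otimes>\<^bsub>SL3Z\<^esub> g = \<one>\<^bsub>SL3Z\<^esub>"
    using adj3_mult[OF g] by (intro bexI[of _ "adj3 g"]) auto
qed (auto simp: det_mul matrix_mul_assoc)

abbreviation mat_of_int :: "int ^ 3 ^ 3 \<Rightarrow> 'k::field_char_0 ^ 3 ^ 3"
  where "mat_of_int \<equiv> map_matrix of_int"

lemma map_matrix_of_int_mult:
  "map_matrix of_int (A ** B :: int ^ 'n ^ 'm) = (map_matrix of_int A ** map_matrix of_int B :: 'k::ring_1 ^ 'n ^ 'm)"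
  by (simp add: vec_eq_iff matrix_matrix_mult_def)

lemma map_matrix_of_int_1 [simp]: "map_matrix of_int (mat 1 :: int ^ 'n ^ 'n) = (mat 1 :: 'k::ring_1 ^ 'n ^ 'n)"
  by (simp add: vec_eq_iff mat_def)

lemma det_mat_of_int: "det (mat_of_int A :: 'k::field_char_0 ^ 3 ^ 3) = of_int (det A)"
  by (simp add: det_3)

lemma SL3Z_inverse:
  assumes "det g = 1"
  shows "mat_of_int (adj3 g) *v (mat_of_int g *v v) = (v :: 'k::field_char_0 ^ 3)"
    and "mat_of_int g *v (mat_of_int (adj3 g) *v v) = (v :: 'k::field_char_0 ^ 3)"
  by (simp_all add: matrix_vector_mul_assoc map_matrix_of_int_mult[symmetric] adj3_mult[OF assms])

lemma SL3Z_bij: "det g = 1 \<Longrightarrow> bij ((*v) (mat_of_int g :: 'k::field_char_0 ^ 3 ^ 3))"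
  by (rule o_bij[of "(*v) (mat_of_int (adj3 g))"]) (simp_all add: fun_eq_iff SL3Z_inverse)

lemma matrix_image_span:
  "(*v) A ` vec.span S = vec.span ((*v) A ` S)" for A :: "'k::field ^ 'n ^ 'm"
  by (rule vec.span_image[symmetric])

lemma flag_map_matrix:
  assumes "det g = 1"
  shows "flag_map ((`) ((*v) (mat_of_int g :: 'k::field_char_0 ^ 3 ^ 3)))"
proof -
  let ?f = "(*v) (mat_of_int g :: 'k ^ 3 ^ 3)"
  have b: "bij ?f" by (rule SL3Z_bij[OF assms])
  have "proper_subspace (?f ` V)" if "proper_subspace V" for V
  proof -
    have "?f ` V \<noteq> ?f ` {0}" "?f ` V \<noteq> ?f ` UNIV"
      unfolding inj_image_eq_iff[OF bij_is_inj[OF b]] using that by (simp_all add: proper_subspace_def)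
    moreover have "vec.subspace (?f ` V)"
      using that matrix_image_span[of _ V] by (metis proper_subspace_def vec.span_eq_iff)
    ultimately show ?thesis using bij_is_surj[OF b] by (simp add: proper_subspace_def)
  qed
  moreover have "?f ` V \<subset> ?f ` W" if "V \<subset> W" for V W
    using that bij_is_inj[OF b] by (simp add: inj_image_subset_iff inj_image_eq_iff psubset_eq)
  ultimately show ?thesis by (simp add: flag_map_def)
qed

abbreviation SL3_push :: "int ^ 3 ^ 3 \<Rightarrow> (('k::field_char_0 ^ 3) set list \<Rightarrow>\<^sub>0 rat) \<Rightarrow> ('k ^ 3) set list \<Rightarrow>\<^sub>0 rat"
  where "SL3_push g \<equiv> push ((`) ((*v) (mat_of_int g)))"

lemma int_action_singleton: "int_action g {c} = {SL3_push g c}"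
  by (simp add: int_action_def steinberg_action_def steinberg_map_singleton)

lemma SL3_push_mult: "SL3_push (g ** h) c = SL3_push g (SL3_push h c)"
  by (simp add: push_push map_matrix_of_int_mult image_image matrix_vector_mul_assoc)

lemma group_module_steinberg:
  assumes "subgroup \<Gamma> SL3Z"
  shows "group_module (SL3Z_subgroup \<Gamma>) (steinberg :: (rat, 'k::field_char_0 steinberg) module) int_action"
  unfolding group_module_def
proof (intro conjI ballI)
  show "group (SL3Z_subgroup \<Gamma>)" using subgroup.subgroup_is_group[OF assms group_SL3Z] .
  have \<Gamma>: "det g = 1" if "g \<in> \<Gamma>" for g using subgroup.subset[OF assms] that by auto
  show "rat_hom steinberg steinberg (int_action g :: 'k steinberg \<Rightarrow> _)"
    if "g \<in> carrier (SL3Z_subgroup \<Gamma>)" for g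
    unfolding int_action_def[abs_def] steinberg_action_def using that
    by (simp add: rat_hom_steinberg_map flag_map_matrix \<Gamma>)
qed (auto simp: steinberg_simps rat_module_steinberg int_action_singleton SL3_push_mult SL3Z_def)

section \<open>The projective plane and quadratic fields\<close>

definition dot :: "'a::comm_ring_1 ^ 3 \<Rightarrow> 'a ^ 3 \<Rightarrow> 'a"
  where "dot u v = u$1 * v$1 + u$2 * v$2 + u$3 * v$3"

definition cross :: "'a::comm_ring_1 ^ 3 \<Rightarrow> 'a ^ 3 \<Rightarrow> 'a ^ 3"
  where "cross u v = vector [u$2 * v$3 - u$3 * v$2, u$3 * v$1 - u$1 * v$3, u$1 * v$2 - u$2 * v$1]"

definition plane :: "'a::comm_ring_1 ^ 3 \<Rightarrow> ('a ^ 3) set"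
  where "plane \<phi> = {v. dot \<phi> v = 0}"

lemma vec3_eq_iff: "u = v \<longleftrightarrow> u$1 = v$1 \<and> u$2 = v$2 \<and> u$3 = v$3" for u v :: "'a ^ 3"
  by (simp add: vec_eq_iff forall_3)

lemma mem_plane [simp]: "v \<in> plane \<phi> \<longleftrightarrow> dot \<phi> v = 0"
  by (simp add: plane_def)

lemma dot_cross [simp]: "dot (cross u v) u = 0" "dot (cross u v) v = 0"
  by (simp_all add: dot_def cross_def algebra_simps)

lemma cross_eq_0D:
  fixes u v :: "'k::field ^ 3"
  assumes "cross u v = 0" "u \<noteq> 0"
  shows "\<exists>c. v = c *s u"
proof -
  have e: "u$2 * v$3 = u$3 * v$2" "u$3 * v$1 = u$1 * v$3" "u$1 * v$2 = u$2 * v$1"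
    using assms(1) by (simp_all add: vec3_eq_iff cross_def)
  consider "u$1 \<noteq> 0" | "u$2 \<noteq> 0" | "u$3 \<noteq> 0" using assms(2) by (auto simp: vec3_eq_iff)
  then show ?thesis
  proof cases
    case 1
    then show ?thesis using e by (intro exI[of _ "v$1 / u$1"]) (simp add: vec3_eq_iff field_simps)
  next
    case 2
    then show ?thesis using e by (intro exI[of _ "v$2 / u$2"]) (simp add: vec3_eq_iff field_simps)
  next
    case 3
    then show ?thesis using e by (intro exI[of _ "v$3 / u$3"]) (simp add: vec3_eq_iff field_simps)
  qed
qed

lemma subspace_plane: "vec.subspace (plane \<phi>)" for \<phi> :: "'k::field ^ 3"
proof -
  have "dot \<phi> (u + v) = dot \<phi> u + dot \<phi> v" "dot \<phi> (c *s u) = c * dot \<phi> u" "dot \<phi> 0 = 0" for u v c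
    by (simp_all add: dot_def algebra_simps)
  then show ?thesis by (simp add: vec.subspace_def)
qed

lemma plane_not_UNIV:
  fixes \<phi> :: "'k::field ^ 3"
  assumes "\<phi> \<noteq> 0"
  shows "plane \<phi> \<noteq> UNIV"
proof
  assume "plane \<phi> = UNIV"
  then have "axis i 1 \<in> plane \<phi>" for i by simp
  from this[of 1] this[of 2] this[of 3] show False using assms
    by (simp add: dot_def axis_def vec3_eq_iff)
qed

lemma dim_subspace_le:
  fixes V :: "('k::field ^ 3) set"
  assumes "vec.subspace V" "V \<noteq> UNIV"
  shows "vec.dim V \<le> 2"
proof (cases "V = {0}")
  case False
  then show ?thesis using proper_subspace_dim[of V] assms by (auto simp: proper_subspace_def)
qed simp

lemma span_pair: "vec.span {u, v} = {a *s u + b *s v | a b. True}" for u v :: "'k::field ^ 3"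
proof -
  have "(\<exists>k. x - k *s u \<in> vec.span {v}) \<longleftrightarrow> (\<exists>a b. x = a *s u + b *s v)" for x
    by (simp add: vec.span_singleton image_iff) (metis add_diff_cancel_left' add.commute diff_add_cancel)
  then show ?thesis by (auto simp: vec.span_insert)
qed

lemma dim_span_pair:
  fixes u v :: "'k::field ^ 3"
  assumes "u \<noteq> 0" "v \<notin> vec.span {u}"
  shows "vec.dim (vec.span {u, v}) = 2"
  using assms by (simp add: vec.dim_insert insert_commute[of u v])

lemma span_pair_unique:
  fixes u v :: "'k::field ^ 3"
  assumes "u \<noteq> 0" "v \<notin> vec.span {u}" "vec.subspace W" "W \<noteq> UNIV" "u \<in> W" "v \<in> W"
  shows "W = vec.span {u, v}"
proof -
  have "vec.span {u, v} \<subseteq> W" using assms by (intro vec.span_minimal) auto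
  then show ?thesis
    using vec.subspace_dim_equal[of "vec.span {u, v}" W] dim_span_pair[OF assms(1,2)]
      dim_subspace_le[OF assms(3,4)] assms(3) by simp
qed

lemma span_single_unique:
  fixes u :: "'k::field ^ 3"
  assumes "u \<noteq> 0" "vec.subspace V" "vec.dim V = 1" "u \<in> V"
  shows "V = vec.span {u}"
proof -
  have "vec.span {u} \<subseteq> V" using assms by (intro vec.span_minimal) auto
  then show ?thesis using vec.subspace_dim_equal[of "vec.span {u}" V] assms by simp
qed

lemma cross_not_in_span:
  fixes u v :: "'k::field ^ 3"
  assumes "cross u v \<noteq> 0"
  shows "u \<noteq> 0" "v \<notin> vec.span {u}"
  using assms by (auto simp: vec.span_singleton cross_def vec3_eq_iff algebra_simps)

lemma span_pair_eq_plane: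
  fixes u v :: "'k::field ^ 3"
  assumes "cross u v \<noteq> 0"
  shows "vec.span {u, v} = plane (cross u v)"
  using span_pair_unique[OF cross_not_in_span[OF assms] subspace_plane plane_not_UNIV[OF assms]] by simp

lemma tits_flag_cases:
  assumes "[V, W] \<in> tits_flags 2"
  obtains b \<phi> :: "'k::field ^ 3" where "b \<noteq> 0" "V = vec.span {b}" "\<phi> \<noteq> 0" "W = plane \<phi>"
proof -
  have p: "proper_subspace V" "proper_subspace W" "V \<subset> W" using assms by (auto simp: tits_flags_2_iff)
  then have s: "vec.subspace V" "vec.subspace W" "W \<noteq> UNIV" "V \<noteq> {0}" by (auto simp: proper_subspace_def)
  obtain b where b: "b \<in> V" "b \<noteq> 0" using s vec.subspace_0 by blast
  have V: "V = vec.span {b}" using span_single_unique[OF b(2) s(1) tits_flag_dims(1)[OF assms] b(1)] .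
  obtain c where c: "c \<in> W" "c \<notin> V" using p(3) by blast
  have W: "W = vec.span {b, c}" using span_pair_unique[OF b(2) _ s(2,3)] b c p(3) V by blast
  have n: "cross b c \<noteq> 0" using cross_eq_0D[of b c] b c V by (auto simp: vec.span_singleton)
  show ?thesis by (rule that[OF b(2) V n W[unfolded span_pair_eq_plane[OF n]]])
qed

lemma span_scale:
  fixes u :: "'k::field ^ 3"
  assumes "c \<noteq> 0"
  shows "vec.span {c *s u} = vec.span {u}"
  using vec.span_image_scale[of "{u}" "\<lambda>_. c"] assms by simp

section \<open>Quadratic fields in rational coordinates\<close>

lemma
  assumes "field_hom f"
  shows field_hom_1: "f 1 = 1" and field_hom_add: "f (x + y) = f x + f y"
    and field_hom_mult: "f (x * y) = f x * f y" and field_hom_0: "f 0 = 0"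
    and field_hom_minus: "f (x - y) = f x - f y"
proof -
  show "f 1 = 1" "f (x * y) = f x * f y" and a: "f (x + y) = f x + f y" for x y
    using assms by (auto simp: field_hom_def)
  show "f 0 = 0" using a[of 0 0] by (metis add.right_neutral add_left_cancel)
  show "f (x - y) = f x - f y" using a[of "x - y" y] by simp
qed

lemma field_hom_of_rat:
  fixes f :: "'a::field_char_0 \<Rightarrow> 'b::field_char_0"
  assumes "field_hom f"
  shows "f (of_rat q) = of_rat q"
proof -
  have nat: "f (of_nat n) = of_nat n" for n
    by (induction n) (simp_all add: field_hom_0[OF assms] field_hom_add[OF assms] field_hom_1[OF assms])
  have int: "f (of_int z) = of_int z" for z
    by (cases z rule: int_diff_cases) (simp add: field_hom_minus[OF assms] nat)
  obtain a b where q: "q = of_int a / of_int b" "b \<noteq> 0"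
    by (cases q) (metis Fract_of_int_quotient less_numeral_extra(3))
  have "of_int b * f (of_rat q) = f (of_int b * of_rat q)" by (simp add: field_hom_mult[OF assms] int)
  also have "\<dots> = of_int a" using q by (simp add: of_rat_divide int)
  finally have "f (of_rat q) = of_int a / of_int b" using q(2) by (simp add: eq_divide_eq mult.commute)
  then show ?thesis using q(1) by (simp add: of_rat_divide)
qed

text \<open>\<open>re\<close> and \<open>im\<close> are the coordinates over the basis
  \<open>1\<close>, \<open>s\<close> of the field. A generator with rational square is used so that
  conjugation is \<open>s\<close> to \<open>- s\<close> and products have simple
  coordinates.\<close>

locale quadratic =
  fixes s :: "'e::field_char_0" and re im :: "'e \<Rightarrow> rat"
  assumes irrational: "s \<notin> \<rat>" and square: "s * s \<in> \<rat>"
    and decomp: "x = of_rat (re x) + of_rat (im x) * s"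
begin

lemma decomp_unique:
  assumes "of_rat p + of_rat q * s = of_rat p' + of_rat q' * s"
  shows "p = p' \<and> q = q'"
proof -
  have e: "of_rat (q - q') * s = of_rat (p' - p)" using assms by (simp add: of_rat_diff algebra_simps)
  have "q = q'"
  proof (rule ccontr)
    assume "q \<noteq> q'"
    then have "s = of_rat ((p' - p) / (q - q'))" using e by (simp add: of_rat_divide field_simps)
    then show False using irrational by (metis Rats_of_rat)
  qed
  then show ?thesis using e by simp
qed

lemma re_im_eqI: "x = of_rat p + of_rat q * s \<Longrightarrow> re x = p \<and> im x = q"
  using decomp_unique decomp by metis

lemma
  shows re_add [simp]: "re (x + y) = re x + re y" and im_add [simp]: "im (x + y) = im x + im y"
    and re_mult_rat [simp]: "re (of_rat q * x) = q * re x" and im_mult_rat [simp]: "im (of_rat q * x) = q * im x"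
    and re_rat [simp]: "re (of_rat q) = q" and im_rat [simp]: "im (of_rat q) = 0"
proof -
  have "x + y = of_rat (re x + re y) + of_rat (im x + im y) * s"
    using decomp[of x] decomp[of y] by (simp add: of_rat_add algebra_simps)
  from re_im_eqI[OF this] show "re (x + y) = re x + re y" "im (x + y) = im x + im y" by auto
  have "of_rat q * x = of_rat (q * re x) + of_rat (q * im x) * s"
    using arg_cong[OF decomp[of x], of "\<lambda>y. of_rat q * y"] by (simp add: of_rat_mult algebra_simps)
  from re_im_eqI[OF this] show "re (of_rat q * x) = q * re x" "im (of_rat q * x) = q * im x" by auto
  show "re (of_rat q) = q" "im (of_rat q) = 0" using re_im_eqI[of "of_rat q" q 0] by auto
qed

lemma re_mult_rat' [simp]: "re (x * of_rat q) = re x * q" "im (x * of_rat q) = im x * q"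
  using re_mult_rat[of q x] im_mult_rat[of q x] by (simp_all add: mult.commute)

lemma re_0 [simp]: "re 0 = 0" and im_0 [simp]: "im 0 = 0"
  using re_rat[of 0] im_rat[of 0] by simp_all

lemma re_im_zero_iff: "x = 0 \<longleftrightarrow> re x = 0 \<and> im x = 0"
  using decomp[of x] by auto

definition conj where "conj x = of_rat (re x) - of_rat (im x) * s"

lemma conj_s: "conj s = - s"
  using re_im_eqI[of s 0 1] by (simp add: conj_def)

lemma conj_rat [simp]: "conj (of_rat q) = of_rat q"
  by (simp add: conj_def)

lemma
  shows re_mult: "re (x * y) = re x * re y + im x * im y * re (s * s)"
    and im_mult: "im (x * y) = re x * im y + im x * re y"
proof -
  have d: "s * s = of_rat (re (s * s))" using square by (auto elim: Rats_cases)
  have "x * y = (of_rat (re x) + of_rat (im x) * s) * (of_rat (re y) + of_rat (im y) * s)"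
    using decomp[of x] decomp[of y] by simp
  also have "\<dots> = of_rat (re x) * of_rat (re y) + of_rat (im x) * of_rat (im y) * (s * s) +
      (of_rat (re x) * of_rat (im y) + of_rat (im x) * of_rat (re y)) * s"
    by (simp add: algebra_simps)
  also have "\<dots> = of_rat (re x * re y + im x * im y * re (s * s)) + of_rat (re x * im y + im x * re y) * s"
    by (subst d) (simp only: of_rat_add of_rat_mult)
  finally show "re (x * y) = re x * re y + im x * im y * re (s * s)" "im (x * y) = re x * im y + im x * re y"
    using re_im_eqI by blast+
qed

lemma field_hom_conj: "field_hom conj"
proof -
  have mult: "conj (x * y) = conj x * conj y" for x y
  proof -
    have d: "of_rat (re (s * s)) = s * s" using square by (auto elim: Rats_cases)
    have "conj (x * y) = of_rat (re x) * of_rat (re y) + of_rat (im x) * of_rat (im y) * (s * s) -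
        (of_rat (re x) * of_rat (im y) + of_rat (im x) * of_rat (re y)) * s"
      by (simp only: conj_def re_mult[of x y] im_mult[of x y] of_rat_add of_rat_mult d)
    also have "\<dots> = conj x * conj y" by (simp add: conj_def algebra_simps)
    finally show ?thesis .
  qed
  have "conj 1 = 1" using conj_rat[of 1] by simp
  then show ?thesis using mult by (simp add: field_hom_def) (simp add: conj_def of_rat_add algebra_simps)
qed

text \<open>An automorphism fixes the rationals and sends \<open>s\<close> to a square root of
  \<open>s * s\<close>, hence to \<open>s\<close> or \<open>- s\<close>; the first choice gives the
  identity.\<close>

lemma galois_conj_eq: "galois_conj = conj"
  unfolding galois_conj_def
proof (rule the_equality)
  have "s \<noteq> 0" using irrational by auto
  then have "conj s \<noteq> s" by (simp add: conj_s)
  moreover have "conj (conj x) = x" for x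
  proof -
    have "re (conj x) = re x \<and> im (conj x) = - im x"
      by (rule re_im_eqI) (simp add: conj_def of_rat_minus)
    then show ?thesis using decomp[of x] by (simp add: conj_def[of "conj x"] of_rat_minus)
  qed
  ultimately show "field_hom conj \<and> bij conj \<and> conj \<noteq> id"
    using field_hom_conj by (auto intro!: o_bij[of conj])
next
  fix \<sigma> :: "'e \<Rightarrow> 'e" assume \<sigma>: "field_hom \<sigma> \<and> bij \<sigma> \<and> \<sigma> \<noteq> id"
  then have h: "field_hom \<sigma>" by simp
  have e: "\<sigma> x = of_rat (re x) + of_rat (im x) * \<sigma> s" for x
    using arg_cong[OF decomp[of x], of \<sigma>]
    by (simp add: field_hom_add[OF h] field_hom_mult[OF h] field_hom_of_rat[OF h])
  obtain d where d: "s * s = of_rat d" using square by (auto elim: Rats_cases)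
  have "\<sigma> s * \<sigma> s = s * s" using field_hom_mult[OF h, of s s] field_hom_of_rat[OF h, of d] d by simp
  then have "\<sigma> s = s \<or> \<sigma> s = - s" by (simp add: square_eq_iff)
  moreover have "\<sigma> s \<noteq> s"
  proof
    assume "\<sigma> s = s"
    then have "\<sigma> x = x" for x using e[of x] decomp[of x] by simp
    then show False using \<sigma> by auto
  qed
  ultimately have "\<sigma> s = - s" by blast
  then have "\<sigma> x = conj x" for x using e[of x] by (simp add: conj_def)
  then show "\<sigma> = conj" by blast
qed

end

lemma real_quadratic_field_quadratic:
  assumes "real_quadratic_field TYPE('e::field_char_0)"
  obtains s :: "'e::field_char_0" and re im where "quadratic s re im"
proof -
  interpret Q: vector_space "\<lambda>(q::rat) (x::'e). of_rat q * x"
    by unfold_locales (simp_all add: of_rat_add of_rat_mult algebra_simps)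
  have dim: "Q.dim (UNIV :: 'e set) = 2" using assms by (simp add: real_quadratic_field_def)
  have "Q.independent {1}" by (simp add: Q.dependent_single)
  then obtain T where T: "{1} \<subseteq> T" "Q.independent T" "UNIV \<subseteq> Q.span T"
    using Q.maximal_independent_subset_extend[OF subset_UNIV] by metis
  have card: "card T = 2" using Q.basis_card_eq_dim[OF subset_UNIV T(3,2)] dim by simp
  have "UNIV = Q.span T" using T(3) by auto
  moreover obtain t where t: "T = {1, t}" using T(1) card by (auto simp: card_2_iff)
  ultimately have span: "\<exists>p q. x = of_rat p + of_rat q * t" for x :: 'e
  proof -
    have "x \<in> Q.span {1, t}" using \<open>UNIV = Q.span T\<close> t by auto
    then obtain p where "x - of_rat p * 1 \<in> Q.span {t}" unfolding Q.span_insert by blast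
    then obtain q where "x - of_rat p = of_rat q * t" unfolding Q.span_singleton by auto
    then show ?thesis by (metis add.commute diff_add_cancel)
  qed
  obtain p q where pq: "t * t = of_rat p + of_rat q * t" using span by blast
  \<comment> \<open>Completing the square in \<open>t * t = p + q t\<close>, so that
    \<open>s * s = p + q * q / 4\<close>.\<close>
  define s where "s = t - of_rat (q / 2)"
  have "t \<notin> \<rat>"
  proof
    assume "t \<in> \<rat>"
    then obtain r where r: "t = of_rat r" by (auto elim: Rats_cases)
    have "\<exists>q. x = of_rat q" for x :: 'e
    proof -
      obtain a b where "x = of_rat a + of_rat b * t" using span by blast
      then have "x = of_rat (a + b * r)" by (simp add: r of_rat_add of_rat_mult)
      then show ?thesis by blast
    qed
    then have "UNIV \<subseteq> Q.span {1}" by (auto simp: Q.span_singleton)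
    then show False using Q.dim_le_card[of UNIV "{1}"] dim by simp
  qed
  then have irr: "s \<notin> \<rat>" unfolding s_def by (metis Rats_add Rats_of_rat diff_add_cancel)
  have "s * s = of_rat (p + q * q / 4)"
    using pq by (simp add: s_def algebra_simps of_rat_add of_rat_mult of_rat_divide)
  then have sq: "s * s \<in> \<rat>" by simp
  have "\<exists>r. x = of_rat (fst r) + of_rat (snd r) * s" for x :: 'e
  proof -
    obtain a b where "x = of_rat a + of_rat b * t" using span by blast
    then have "x = of_rat (a + b * q / 2) + of_rat b * s"
      by (simp add: s_def algebra_simps of_rat_add of_rat_mult of_rat_divide)
    then show ?thesis by (metis fst_conv snd_conv)
  qed
  then obtain r where "\<And>x. x = of_rat (fst (r x)) + of_rat (snd (r x)) * s" by metis
  then show ?thesis using that[of s "\<lambda>x. fst (r x)" "\<lambda>x. snd (r x)"] irr sq by (simp add: quadratic_def)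
qed

section \<open>Rational subspaces\<close>

text \<open>Omitting the point of a flag leaves its plane with sign +1, omitting the plane leaves
  the point with sign -1.\<close>

lemma boundary_flag_coeff:
  assumes "Poly_Mapping.keys c \<subseteq> tits_flags 2"
  shows "Poly_Mapping.lookup (simplicial_boundary c) [U] =
    (\<Sum>xs\<in>Poly_Mapping.keys c. Poly_Mapping.lookup c xs * ((1 when xs ! 1 = U) - (1 when xs ! 0 = U)))"
  unfolding simplicial_boundary_def lookup_lin_ext[OF finite_keys order_refl]
proof (rule sum.cong)
  fix xs assume "xs \<in> Poly_Mapping.keys c"
  then obtain A B where "xs = [A, B]" using subsetD[OF assms] unfolding tits_flags_2_iff by blast
  then show "Poly_Mapping.lookup c xs * Poly_Mapping.lookup (\<Sum>j<length xs.
      Poly_Mapping.single (take j xs @ drop (Suc j) xs) ((- 1) ^ j)) [U] =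
    Poly_Mapping.lookup c xs * ((1 when xs ! 1 = U) - (1 when xs ! 0 = U))"
    by (simp add: lookup_add lookup_single when_def)
qed simp

text \<open>A cycle has no free vertex.\<close>

lemma tits_cycle_other_plane:
  assumes c: "c \<in> carrier tits_cycles1" and VW: "[V, W] \<in> Poly_Mapping.keys c"
  shows "\<exists>W'. W' \<noteq> W \<and> [V, W'] \<in> Poly_Mapping.keys c"
proof (rule ccontr)
  assume no: "\<not> ?thesis"
  have k: "Poly_Mapping.keys c \<subseteq> tits_flags 2" using c by (simp add: tits_cycles1_simps)
  have "Poly_Mapping.lookup c xs * ((1 when xs ! 1 = V) - (1 when xs ! 0 = V)) =
      (if xs = [V, W] then - Poly_Mapping.lookup c xs else 0)" if xs: "xs \<in> Poly_Mapping.keys c" for xs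
  proof -
    obtain A B where AB: "xs = [A, B]" using subsetD[OF k xs] unfolding tits_flags_2_iff by blast
    have "vec.dim B = 2" "vec.dim V = 1" using tits_flag_dims k xs VW AB by blast+
    then have "B \<noteq> V" by auto
    then show ?thesis using no xs AB by (auto simp: when_def)
  qed
  then have "Poly_Mapping.lookup (simplicial_boundary c) [V] = - Poly_Mapping.lookup c [V, W]"
    using VW by (simp add: boundary_flag_coeff[OF k] sum.delta)
  then show False using c VW by (simp add: tits_cycles1_simps in_keys_iff)
qed

lemma tits_cycle_other_point:
  assumes c: "c \<in> carrier tits_cycles1" and VW: "[V, W] \<in> Poly_Mapping.keys c"
  shows "\<exists>V'. V' \<noteq> V \<and> [V', W] \<in> Poly_Mapping.keys c"
proof (rule ccontr)
  assume no: "\<not> ?thesis"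
  have k: "Poly_Mapping.keys c \<subseteq> tits_flags 2" using c by (simp add: tits_cycles1_simps)
  have "Poly_Mapping.lookup c xs * ((1 when xs ! 1 = W) - (1 when xs ! 0 = W)) =
      (if xs = [V, W] then Poly_Mapping.lookup c xs else 0)" if xs: "xs \<in> Poly_Mapping.keys c" for xs
  proof -
    obtain A B where AB: "xs = [A, B]" using subsetD[OF k xs] unfolding tits_flags_2_iff by blast
    have "vec.dim A = 1" "vec.dim W = 2" using tits_flag_dims k xs VW AB by blast+
    then have "A \<noteq> W" by auto
    then show ?thesis using no xs AB by (auto simp: when_def)
  qed
  then have "Poly_Mapping.lookup (simplicial_boundary c) [W] = Poly_Mapping.lookup c [V, W]"
    using VW by (simp add: boundary_flag_coeff[OF k] sum.delta)
  then show False using c VW by (simp add: tits_cycles1_simps in_keys_iff)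
qed

section \<open>Extension and restriction of scalars for subspaces\<close>

abbreviation emb :: "rat ^ 3 \<Rightarrow> 'e::field_char_0 ^ 3"
  where "emb \<equiv> vec_map of_rat"

definition ext :: "(rat ^ 3) set \<Rightarrow> ('e::field_char_0 ^ 3) set"
  where "ext V = vec.span (emb ` V)"

definition res :: "('e::field_char_0 ^ 3) set \<Rightarrow> (rat ^ 3) set"
  where "res U = {q. emb q \<in> U}"

definition rational :: "('e::field_char_0 ^ 3) set \<Rightarrow> bool"
  where "rational U \<longleftrightarrow> (\<exists>V. vec.subspace V \<and> U = ext V)"

lemma vec_map_nth [simp]: "vec_map f v $ i = f (v $ i)"
  by (simp add: vec_map_def)

lemma emb_simps [simp]:
  "emb (u + v) = emb u + emb v" "emb (c *s u) = of_rat c *s emb u" "emb 0 = 0"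
  "emb u = emb v \<longleftrightarrow> u = v"
  by (auto simp: vec_eq_iff of_rat_add of_rat_mult)

lemma emb_eq_0_iff [simp]: "emb u = 0 \<longleftrightarrow> u = 0"
  using emb_simps(4)[of u 0] by simp

lemma emb_mat_of_int: "emb (mat_of_int g *v v) = mat_of_int g *v emb v"
  by (simp add: vec_eq_iff matrix_vector_mult_def of_rat_sum of_rat_mult)

lemma ext_span: "ext (vec.span S) = vec.span (emb ` S)"
proof
  have "emb x \<in> vec.span (emb ` S)" if "x \<in> vec.span S" for x
    using that
  proof (induction rule: vec.span_induct)
    case base
    show ?case by (auto simp: vec.subspace_def vec.span_zero intro: vec.span_add vec.span_scale)
  next
    case (step x) then show ?case by (simp add: vec.span_base)
  qed
  then show "ext (vec.span S) \<subseteq> vec.span (emb ` S)"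
    unfolding ext_def by (intro vec.span_minimal) auto
  show "vec.span (emb ` S) \<subseteq> ext (vec.span S)"
    unfolding ext_def by (intro vec.span_mono image_mono vec.span_superset)
qed

lemma rational_span: "rational (vec.span (emb ` S))"
  unfolding rational_def by (rule exI[of _ "vec.span S"]) (simp add: ext_span)

lemma ext_image: "ext ((*v) (mat_of_int g) ` V) = (*v) (mat_of_int g) ` ext V"
  by (simp add: ext_def matrix_image_span image_image emb_mat_of_int)

lemma subspace_ext: "vec.subspace (ext V)"
  by (simp add: ext_def)

lemma steinberg_incl_singleton: "steinberg_incl {c} = {push ext c}"
  by (simp add: steinberg_incl_def steinberg_map_singleton ext_def[abs_def])

context quadratic
begin

abbreviation Re where "Re \<equiv> vec_map re"
abbreviation Im where "Im \<equiv> vec_map im"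

lemma vec_decomp: "v = emb (Re v) + s *s emb (Im v)"
  using decomp by (simp add: vec_eq_iff mult.commute)

lemma Re_emb [simp]: "Re (emb q) = q" and Im_emb [simp]: "Im (emb q) = 0"
  by (simp_all add: vec_eq_iff)

text \<open>As a rational space, \<open>ext V\<close> is \<open>V + s V\<close>. The right-hand
  condition is stable under multiplication by \<open>c\<close>, since \<open>Re\<close> and
  \<open>Im\<close> of the product are rational combinations of those of \<open>v\<close>.\<close>

lemma ext_iff:
  assumes "vec.subspace V"
  shows "v \<in> ext V \<longleftrightarrow> Re v \<in> V \<and> Im v \<in> V"
proof
  have smult: "Re (c *s v) = re c *s Re v + (im c * re (s * s)) *s Im v"
    "Im (c *s v) = re c *s Im v + im c *s Re v" for c v
    by (simp_all add: vec_eq_iff re_mult[of _ "_ $ _"] im_mult[of _ "_ $ _"])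
  have add: "Re (u + v) = Re u + Re v" "Im (u + v) = Im u + Im v" for u v
    by (simp_all add: vec_eq_iff)
  have "vec.subspace {v. Re v \<in> V \<and> Im v \<in> V}"
    using assms by (auto simp: vec.subspace_def smult add vec_eq_iff[of "vec_map _ 0"])
      (auto simp: vec_map_def zero_vec_def)
  moreover have "emb ` V \<subseteq> {v. Re v \<in> V \<and> Im v \<in> V}" using assms vec.subspace_0 by auto
  ultimately have "ext V \<subseteq> {v. Re v \<in> V \<and> Im v \<in> V}" unfolding ext_def by (rule vec.span_minimal[rotated])
  then show "v \<in> ext V \<Longrightarrow> Re v \<in> V \<and> Im v \<in> V" by auto
  assume "Re v \<in> V \<and> Im v \<in> V"
  then have "emb (Re v) + s *s emb (Im v) \<in> ext V" unfolding ext_def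
    by (intro vec.span_add vec.span_scale vec.span_base) auto
  then show "v \<in> ext V" using vec_decomp[of v] by simp
qed

lemma res_ext: "vec.subspace V \<Longrightarrow> res (ext V :: ('e ^ 3) set) = V"
  by (auto simp: res_def ext_iff vec.subspace_0)

lemma ext_inject: "vec.subspace V \<Longrightarrow> vec.subspace W \<Longrightarrow> (ext V :: ('e ^ 3) set) = ext W \<longleftrightarrow> V = W"
  using res_ext by metis

lemma ext_0: "ext {0} = ({0} :: ('e ^ 3) set)" and ext_UNIV: "ext UNIV = (UNIV :: ('e ^ 3) set)"
  by (auto simp: ext_def[of "{0}"] ext_iff)

lemma proper_subspace_ext_iff:
  assumes "vec.subspace V"
  shows "proper_subspace (ext V :: ('e ^ 3) set) \<longleftrightarrow> proper_subspace V"
  using assms ext_inject[OF assms vec.subspace_single_0] ext_inject[OF assms vec.subspace_UNIV]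
  by (simp add: proper_subspace_def subspace_ext ext_0 ext_UNIV)

lemma ext_psubset_iff:
  assumes "vec.subspace V" "vec.subspace W"
  shows "(ext V :: ('e ^ 3) set) \<subset> ext W \<longleftrightarrow> V \<subset> W"
proof -
  have "(ext V :: ('e ^ 3) set) \<subseteq> ext W \<longleftrightarrow> V \<subseteq> W"
  proof
    assume "(ext V :: ('e ^ 3) set) \<subseteq> ext W"
    then have "res (ext V :: ('e ^ 3) set) \<subseteq> res (ext W :: ('e ^ 3) set)" by (auto simp: res_def)
    then show "V \<subseteq> W" using assms by (simp add: res_ext)
  qed (auto simp: ext_iff assms)
  then show ?thesis using ext_inject[OF assms] by (auto simp: psubset_eq)
qed

lemma flag_map_ext: "flag_map (ext :: _ \<Rightarrow> ('e ^ 3) set)"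
  unfolding flag_map_def
  using proper_subspace_ext_iff ext_psubset_iff by (auto simp: proper_subspace_def[of "_ :: (rat ^ 3) set"])

lemma push_res_ext:
  assumes "c \<in> carrier tits_cycles1"
  shows "push res (push (ext :: _ \<Rightarrow> ('e ^ 3) set) c) = c"
proof -
  have "push res (push (ext :: _ \<Rightarrow> ('e ^ 3) set) c) = push (\<lambda>V. V) c"
    unfolding push_push
  proof (rule push_cong)
    fix xs V assume "xs \<in> Poly_Mapping.keys c" "V \<in> set xs"
    then have "vec.subspace V" using assms by (auto simp: tits_cycles1_simps tits_flags_def)
    then show "res (ext V :: ('e ^ 3) set) = V" by (rule res_ext)
  qed
  then show ?thesis by (simp add: push_id)
qed

text \<open>On rational subspaces \<open>res\<close> inverts \<open>ext\<close> and preserves strict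
  inclusion, so such a cycle descends flag by flag.\<close>

lemma rational_cycle:
  fixes c :: "('e ^ 3) set list \<Rightarrow>\<^sub>0 rat"
  assumes c: "c \<in> carrier tits_cycles1"
    and rat: "\<And>xs U. xs \<in> Poly_Mapping.keys c \<Longrightarrow> U \<in> set xs \<Longrightarrow> rational U"
  shows "push res c \<in> carrier tits_cycles1" "push ext (push res c) = c"
proof -
  have k: "Poly_Mapping.keys c \<subseteq> tits_flags 2" using c by (simp add: tits_cycles1_simps)
  have "map res xs \<in> tits_flags 2" if xs: "xs \<in> Poly_Mapping.keys c" for xs
  proof -
    obtain V W where VW: "xs = [V, W]" "proper_subspace V" "proper_subspace W" "V \<subset> W"
      using subsetD[OF k xs] unfolding tits_flags_2_iff by blast
    have "rational V" "rational W" using rat[OF xs] VW(1) by simp_all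
    then obtain V0 W0 where "vec.subspace V0" "V = ext V0" "vec.subspace W0" "W = ext W0"
      unfolding rational_def by blast
    then show ?thesis using VW
      by (auto simp: tits_flags_2_iff res_ext proper_subspace_ext_iff ext_psubset_iff)
  qed
  then have "Poly_Mapping.keys (push res c) \<subseteq> tits_flags 2" using keys_push[of res c] by blast
  then show "push res c \<in> carrier tits_cycles1" using c by (simp add: tits_cycles1_simps boundary_push)
  have "push ext (push res c) = push (\<lambda>V. V) c" unfolding push_push
  proof (rule push_cong)
    fix xs U assume "xs \<in> Poly_Mapping.keys c" "U \<in> set xs"
    then show "ext (res U) = U" using rat res_ext by (metis rational_def)
  qed
  then show "push ext (push res c) = c" by (simp add: push_id)
qed

text \<open>Were \<open>Re b\<close> and \<open>Im b\<close> dependent, \<open>b\<close> would be a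
  multiple over the field of a rational vector. The cross product is thus a nonzero rational
  covector that cuts out the span of \<open>b\<close> and its conjugate; the same fact is applied
  later to a nonrational covector.\<close>

lemma cross_Re_Im:
  assumes "b \<noteq> 0" "\<not> rational (vec.span {b})"
  shows "cross (Re b) (Im b) \<noteq> 0"
proof
  assume e: "cross (Re b) (Im b) = 0"
  have "\<exists>c q. c \<noteq> 0 \<and> b = c *s emb q"
  proof (cases "Re b = 0")
    case True
    have "s \<noteq> 0" using irrational by auto
    then show ?thesis using vec_decomp[of b] True by (intro exI[of _ s] exI[of _ "Im b"]) simp
  next
    case False
    then obtain c where c: "Im b = c *s Re b" using cross_eq_0D[OF e] by blast
    have b: "b = (1 + s * of_rat c) *s emb (Re b)"
      using vec_decomp[of b] unfolding c by (simp add: vec_eq_iff algebra_simps)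
    then have "1 + s * of_rat c \<noteq> 0" using assms(1) by (metis vec.scale_zero_left)
    then show ?thesis using b by blast
  qed
  then obtain c q where "c \<noteq> 0" "b = c *s emb q" by blast
  then have "vec.span {b} = vec.span (emb ` {q})" by (simp add: span_scale)
  then have "rational (vec.span {b})" by (simp only: rational_span)
  then show False using assms(2) by simp
qed

lemma rational_plane: "rational (plane (emb \<phi>) :: ('e ^ 3) set)"
proof -
  have "dot (emb \<phi>) v = 0 \<longleftrightarrow> dot \<phi> (Re v) = 0 \<and> dot \<phi> (Im v) = 0" for v
    unfolding re_im_zero_iff[of "dot (emb \<phi>) v"] by (simp add: dot_def)
  then have "plane (emb \<phi>) = (ext (plane \<phi>) :: ('e ^ 3) set)"
    by (auto simp: ext_iff[OF subspace_plane])
  then show ?thesis unfolding rational_def using subspace_plane by blast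
qed

text \<open>A subspace defined over the rationals contains with \<open>b\<close> also
  \<open>Re b\<close> and \<open>Im b\<close>, which are independent.\<close>

lemma rational_plane_unique:
  assumes "b \<noteq> 0" "\<not> rational (vec.span {b})" "rational W" "W \<noteq> UNIV" "b \<in> W"
  shows "W = ext (vec.span {Re b, Im b})"
proof -
  obtain W0 where W0: "vec.subspace W0" "W = ext W0" using assms(3) by (auto simp: rational_def)
  have "W0 \<noteq> UNIV" using assms(4) W0 ext_UNIV by auto
  then have "W0 = vec.span {Re b, Im b}"
    using assms(5) W0 cross_not_in_span[OF cross_Re_Im[OF assms(1,2)]]
    by (intro span_pair_unique) (auto simp: ext_iff)
  then show ?thesis using W0 by simp
qed

lemma rational_point:
  fixes V :: "('e ^ 3) set"
  assumes "rational V" "vec.dim V = 1"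
  obtains q where "q \<noteq> 0" "V = vec.span {emb q}"
proof -
  obtain V0 where V0: "vec.subspace V0" "V = ext V0" using assms(1) by (auto simp: rational_def)
  have "V0 \<noteq> {0}"
  proof
    assume "V0 = {0}"
    then have "V = {0}" using V0(2) ext_0 by simp
    then show False using assms(2) by simp
  qed
  then obtain q where q: "q \<in> V0" "q \<noteq> 0" using V0(1) vec.subspace_0 by blast
  have "V = vec.span {emb q}"
    using q(2) assms(2) q(1) vec.subspace_0[OF V0(1)] unfolding V0(2)
    by (intro span_single_unique) (simp_all add: subspace_ext ext_iff[OF V0(1)])
  then show ?thesis using that q by blast
qed

text \<open>Two different rational points would span \<open>W\<close> and make it rational.\<close>

lemma rational_point_unique:
  fixes V V' W :: "('e ^ 3) set"
  assumes "vec.subspace W" "W \<noteq> UNIV" "\<not> rational W"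
    and "rational V" "vec.dim V = 1" "V \<subseteq> W" "rational V'" "vec.dim V' = 1" "V' \<subseteq> W"
  shows "V = V'"
proof (rule ccontr)
  assume ne: "V \<noteq> V'"
  obtain q where q: "q \<noteq> 0" "V = vec.span {emb q}" using rational_point[OF assms(4,5)] .
  obtain q' where q': "q' \<noteq> 0" "V' = vec.span {emb q'}" using rational_point[OF assms(7,8)] .
  have "emb q' \<notin> (vec.span {emb q} :: ('e ^ 3) set)"
  proof
    assume "emb q' \<in> (vec.span {emb q} :: ('e ^ 3) set)"
    then have "V = vec.span {emb q'}"
      using q'(1) q(2) assms(5) by (intro span_single_unique) simp_all
    then show False using ne q'(2) by simp
  qed
  then have "W = vec.span {emb q, emb q'}"
    using assms(1,2,6,9) q q' vec.span_base[of "emb q" "{emb q}"] vec.span_base[of "emb q'" "{emb q'}"]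
    by (intro span_pair_unique) auto
  also have "\<dots> = vec.span (emb ` {q, q'})" by simp
  finally have "rational W" by (simp only: rational_span)
  then show False using assms(3) by simp
qed

text \<open>Since a cycle has no free vertex, every member of a flag in the support lies in a second
  such flag. Under the hypothesis a nonrational point can only be joined to its one rational plane,
  and a nonrational plane only to its one rational point, so neither occurs.\<close>

lemma half_rational_cycle:
  fixes c :: "('e ^ 3) set list \<Rightarrow>\<^sub>0 rat"
  assumes c: "c \<in> carrier tits_cycles1"
    and half: "\<And>V W. [V, W] \<in> Poly_Mapping.keys c \<Longrightarrow> rational V \<or> rational W"
    and xs: "xs \<in> Poly_Mapping.keys c" "U \<in> set xs"
  shows "rational U"
proof -
  have k: "Poly_Mapping.keys c \<subseteq> tits_flags 2" using c by (simp add: tits_cycles1_simps)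
  obtain V W where VW: "xs = [V, W]" using subsetD[OF k xs(1)] unfolding tits_flags_2_iff by blast
  have key: "[V, W] \<in> Poly_Mapping.keys c" using xs VW by simp
  have flag: "proper_subspace A \<and> proper_subspace B \<and> A \<subset> B" if "[A, B] \<in> Poly_Mapping.keys c" for A B
    using subsetD[OF k that] unfolding tits_flags_2_iff by auto
  have "rational V"
  proof (rule ccontr)
    assume nr: "\<not> rational V"
    obtain b where b: "b \<noteq> 0" "V = vec.span {b}" by (rule tits_flag_cases[OF subsetD[OF k key]])
    have "B = ext (vec.span {Re b, Im b})" if B: "[V, B] \<in> Poly_Mapping.keys c" for B
    proof (rule rational_plane_unique[OF b(1) nr[unfolded b(2)]])
      show "rational B" using half[OF B] nr by simp
      show "B \<noteq> UNIV" using flag[OF B] by (simp add: proper_subspace_def)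
      show "b \<in> B" using flag[OF B] vec.span_base[of b "{b}"] b(2) by auto
    qed
    then show False using tits_cycle_other_plane[OF c key] key by metis
  qed
  moreover have "rational W"
  proof (rule ccontr)
    assume nr: "\<not> rational W"
    have "A = V" if A: "[A, W] \<in> Poly_Mapping.keys c" for A
    proof (rule rational_point_unique[OF _ _ nr])
      show "rational A" "rational V" using half[OF A] half[OF key] nr by auto
      show "vec.dim A = 1" "vec.dim V = 1"
        using tits_flag_dims(1)[OF subsetD[OF k A]] tits_flag_dims(1)[OF subsetD[OF k key]] .
    qed (use flag[OF A] flag[OF key] in \<open>auto simp: proper_subspace_def\<close>)
    then show False using tits_cycle_other_point[OF c key] by blast
  qed
  ultimately show ?thesis using xs VW by auto
qed

end

section \<open>Modular symbols\<close>

definition triple :: "'a::comm_ring_1 ^ 3 \<Rightarrow> 'a ^ 3 \<Rightarrow> 'a ^ 3 \<Rightarrow> 'a"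
  where "triple u v w = dot (cross u v) w"

lemma triple_rotate: "triple u v w = triple v w u"
  by (simp add: triple_def dot_def cross_def algebra_simps)

lemma triple_eq_det: "triple u v w = det (vector [u, v, w])"
  by (simp add: triple_def dot_def cross_def det_3 algebra_simps)

lemma triple_matrix:
  fixes A :: "'a::comm_ring_1 ^ 3 ^ 3"
  shows "triple (A *v u) (A *v v) (A *v w) = det A * triple u v w"
proof -
  have "(vector [A *v u, A *v v, A *v w] :: 'a ^ 3 ^ 3) = vector [u, v, w] ** transpose A"
    unfolding vec_eq_iff forall_3
    by (simp add: matrix_matrix_mult_def matrix_vector_mult_def transpose_def sum_3 algebra_simps)
  then show ?thesis by (simp add: triple_eq_det det_mul mult.commute)
qed

lemma triple_nonzero:
  fixes u v w :: "'k::field ^ 3"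
  assumes "triple u v w \<noteq> 0"
  shows "cross u v \<noteq> 0" "cross v w \<noteq> 0" "cross w u \<noteq> 0"
proof -
  have "dot 0 x = 0" for x :: "'k ^ 3" by (simp add: dot_def)
  then show "cross u v \<noteq> 0" "cross v w \<noteq> 0" "cross w u \<noteq> 0"
    using assms triple_rotate[of u v w] triple_rotate[of v w u] unfolding triple_def by metis+
qed

lemma is_basis3_iff: "is_basis3 u v w \<longleftrightarrow> triple u v w \<noteq> 0" for u v w :: "'k::field ^ 3"
proof
  assume b: "is_basis3 u v w"
  then have ind: "vec.independent {u, v, w}" and sp: "vec.span {u, v, w} = UNIV" and card: "card {u, v, w} = 3"
    by (auto simp: is_basis3_def)
  have ne: "u \<noteq> v" using card by (auto simp: card_insert_if split: if_splits)
  have u0: "u \<noteq> 0" using ind vec.dependent_zero by blast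
  have c: "cross u v \<noteq> 0"
  proof
    assume "cross u v = 0"
    then obtain c where c: "v = c *s u" using cross_eq_0D u0 by blast
    have "u \<in> vec.span ({u, v, w} - {v})" using ne by (intro vec.span_base) simp
    then have "v \<in> vec.span ({u, v, w} - {v})"
      using vec.span_scale[of u "{u, v, w} - {v}" c] by (simp only: flip: c)
    then show False using ind unfolding vec.dependent_def by blast
  qed
  show "triple u v w \<noteq> 0"
  proof
    assume "triple u v w = 0"
    then have "vec.span {u, v, w} \<subseteq> plane (cross u v)"
      by (intro vec.span_minimal subspace_plane) (simp add: triple_def)
    then show False using sp plane_not_UNIV[OF c] by blast
  qed
next
  assume t: "triple u v w \<noteq> 0"
  note c = triple_nonzero(1)[OF t]
  have w: "w \<notin> vec.span {u, v}" using t span_pair_eq_plane[OF c] by (simp add: triple_def)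
  note u = cross_not_in_span[OF c]
  have "vec.independent {v, u}" using u vec.independent_empty by (intro vec.independent_insertI) simp_all
  then have ind: "vec.independent {w, u, v}" using vec.independent_insertI[OF w] by (simp add: insert_commute)
  have "u \<noteq> v" using u(2) by (auto simp: vec.span_base)
  moreover have "u \<noteq> w" "v \<noteq> w" using w by (auto simp: vec.span_base)
  ultimately have card: "card {w, u, v} = 3" by simp
  have "vec.dim {w, u, v} = 3" using vec.dim_eq_card_independent[OF ind] card by simp
  then have "vec.span {w, u, v} = UNIV"
    using vec.dim_eq_full[of "{w, u, v}"] by (simp add: vec.dimension_def card_cart_basis)
  then show "is_basis3 u v w" using ind card by (simp add: is_basis3_def insert_commute)
qed

lemma span_pair_scale:
  fixes u v :: "'k::field ^ 3"
  assumes "c \<noteq> 0" "d \<noteq> 0"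
  shows "vec.span {c *s u, d *s v} = vec.span {u, v}"
proof (cases "u = v")
  case True
  have "vec.span {c *s v, d *s v} = vec.span {v}"
  proof
    show "vec.span {c *s v, d *s v} \<subseteq> vec.span {v}"
      by (intro vec.span_minimal) (auto intro: vec.span_scale vec.span_base)
    have "vec.span {c *s v} \<subseteq> vec.span {c *s v, d *s v}" by (intro vec.span_mono) auto
    then show "vec.span {v} \<subseteq> vec.span {c *s v, d *s v}" using span_scale[OF assms(1)] by simp
  qed
  then show ?thesis using True by simp
next
  case False
  then show ?thesis
    using vec.span_image_scale[of "{u, v}" "\<lambda>x. if x = u then c else d"] assms by simp
qed

lemma hexagon_scale:
  fixes u v w :: "'k::field ^ 3"
  assumes "a \<noteq> 0" "b \<noteq> 0" "c \<noteq> 0"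
  shows "hexagon (a *s u) (b *s v) (c *s w) = hexagon u v w"
  by (simp add: hexagon_def span_scale span_pair_scale assms)

lemma boundary_flag:
  "simplicial_boundary (Poly_Mapping.single [V, W] 1) = Poly_Mapping.single [W] 1 - Poly_Mapping.single [V] 1"
  by (simp add: boundary_single single_uminus)

lemma flag_in_tits_flags:
  fixes u v :: "'k::field ^ 3"
  assumes "cross u v \<noteq> 0"
  shows "[vec.span {u}, vec.span {u, v}] \<in> tits_flags 2"
proof -
  note c = cross_not_in_span[OF assms]
  have d: "vec.dim (vec.span {u}) = 1" using c by simp
  have "vec.span {u} \<noteq> UNIV" using c(2) by blast
  moreover have "vec.span {u} \<noteq> {0}" using d by (metis vec.dim_span vec.span_base singletonD singletonI c(1))
  moreover have "vec.span {u, v} \<noteq> {0}" using vec.span_base[of u "{u, v}"] c(1) by auto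
  moreover have "vec.span {u, v} \<noteq> UNIV" using span_pair_eq_plane[OF assms] plane_not_UNIV[OF assms] by simp
  moreover have "vec.span {u} \<subset> vec.span {u, v}"
    using vec.span_mono[of "{u}" "{u, v}"] vec.span_base[of v "{u, v}"] c(2) by auto
  ultimately show ?thesis by (simp add: tits_flags_2_iff proper_subspace_def)
qed

lemma cross_swap: "cross u v = 0 \<longleftrightarrow> cross v u = 0"
  by (auto simp: cross_def vec3_eq_iff algebra_simps)

lemma hexagon_cycle:
  fixes u v w :: "'k::field ^ 3"
  assumes "triple u v w \<noteq> 0"
  shows "hexagon u v w \<in> carrier tits_cycles1"
proof -
  have b: "simplicial_boundary (hexagon u v w) = 0"
    by (simp add: hexagon_def boundary_add boundary_minus boundary_flag insert_commute)
  have f: "Poly_Mapping.keys (Poly_Mapping.single [vec.span {x}, vec.span {x, y}] (1::rat)) \<subseteq> tits_flags 2"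
    if "cross x y \<noteq> 0" for x y :: "'k ^ 3"
    using flag_in_tits_flags[OF that] by simp
  have kd: "Poly_Mapping.keys (p - q) \<subseteq> S" if "Poly_Mapping.keys p \<subseteq> S" "Poly_Mapping.keys q \<subseteq> S"
    for p q :: "('k ^ 3) set list \<Rightarrow>\<^sub>0 rat" and S
    using that by (auto simp: in_keys_iff lookup_minus subset_iff) metis
  have ka: "Poly_Mapping.keys (p + q) \<subseteq> S" if "Poly_Mapping.keys p \<subseteq> S" "Poly_Mapping.keys q \<subseteq> S"
    for p q :: "('k ^ 3) set list \<Rightarrow>\<^sub>0 rat" and S
    using that keys_add[of p q] by blast
  note t = triple_nonzero[OF assms]
  have t': "cross v u \<noteq> 0" "cross w v \<noteq> 0" "cross u w \<noteq> 0"
    using t by (simp_all add: cross_swap[of v u] cross_swap[of w v] cross_swap[of u w])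
  have "Poly_Mapping.keys (hexagon u v w) \<subseteq> tits_flags 2"
    unfolding hexagon_def Let_def using t t' by (intro ka kd f)
  then show ?thesis using b by (simp add: tits_cycles1_simps)
qed

lemma push_hexagon_matrix:
  "push ((`) ((*v) A)) (hexagon u v w) = hexagon (A *v u) (A *v v) (A *v w)"
  by (simp add: hexagon_def push_add push_minus push_single matrix_image_span)

lemma push_hexagon_ext: "push ext (hexagon u v w) = hexagon (emb u) (emb v) (emb w)"
  by (simp add: hexagon_def push_add push_minus push_single ext_span)

text \<open>Scaling reduces this to \<open>hexagon u u w\<close>, where the six terms cancel in
  pairs. The formula for the hexagon thereby agrees with the convention that a degenerate symbol is
  zero.\<close>

lemma hexagon_degenerate:
  fixes u w :: "'k::field ^ 3"
  assumes "c \<noteq> 0"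
  shows "hexagon u (c *s u) w = 0"
proof -
  have "hexagon u (c *s u) w = hexagon (1 *s u) (c *s u) (1 *s w)" by simp
  also have "\<dots> = hexagon u u w" using assms by (intro hexagon_scale) auto
  also have "\<dots> = 0" by (simp add: hexagon_def)
  finally show ?thesis .
qed

text \<open>Cutting the hexagon of \<open>v\<close>, \<open>f\<close>, \<open>w\<close> along a line through \<open>v\<close>, \<open>f\<close>, \<open>f'\<close>.\<close>

lemma hexagon_diff:
  fixes v f f' w :: "'k::field ^ 3"
  assumes "vec.subspace P" "P \<noteq> UNIV" "v \<in> P" "f \<in> P" "f' \<in> P"
    and "cross v f \<noteq> 0" "cross v f' \<noteq> 0"
  shows "hexagon v f' w - hexagon v f w = hexagon f f' w"
proof (cases "cross f f' = 0")
  case True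
  have f0: "f \<noteq> 0" "f' \<noteq> 0" using assms(6,7) by (auto simp: cross_def vec3_eq_iff)
  then obtain c where c: "f' = c *s f" using cross_eq_0D[OF True] by blast
  then have c0: "c \<noteq> 0" using f0 by auto
  have "hexagon v f' w = hexagon (1 *s v) (c *s f) (1 *s w)" by (simp add: c)
  also have "\<dots> = hexagon v f w" using c0 by (intro hexagon_scale) auto
  finally show ?thesis using hexagon_degenerate[OF c0, of f w] c by simp
next
  case False
  have P: "vec.span {x, y} = P" "vec.span {y, x} = P" if "cross x y \<noteq> 0" "x \<in> P" "y \<in> P" for x y
    using span_pair_unique[OF cross_not_in_span[OF that(1)] assms(1,2) that(2,3)]
    by (simp_all add: insert_commute)
  show ?thesis using P[OF assms(6,3,4)] P[OF assms(7,3,5)] P[OF False assms(4,5)]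
    by (simp add: hexagon_def Let_def)
qed

section \<open>Symbols of integral vectors\<close>

abbreviation iemb :: "int ^ 3 \<Rightarrow> 'k::ring_1 ^ 3"
  where "iemb \<equiv> vec_map of_int"

lemma emb_iemb [simp]: "emb (iemb a) = iemb a"
  by (simp add: vec_eq_iff)

lemma iemb_mult: "iemb (g *v v) = mat_of_int g *v iemb v"
  by (simp add: vec_eq_iff matrix_vector_mult_def)

abbreviation e1 :: "'a::comm_ring_1 ^ 3" where "e1 \<equiv> vector [1, 0, 0]"

lemma iemb_e1 [simp]: "iemb e1 = e1" and emb_e1 [simp]: "emb e1 = e1"
  by (simp_all add: vec3_eq_iff)

lemma matrix_vector_mult_nth:
  "(A *v v) $ i = A$i$1 * v$1 + A$i$2 * v$2 + A$i$3 * v$3" for A :: "'a::comm_ring_1 ^ 3 ^ 3"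
  by (simp add: matrix_vector_mult_def sum_3)

text \<open>The case distinction in \<open>modular_symbol\<close> disappears here: the three vectors
  can be dependent only if \<open>M\<close> maps \<open>e1\<close> to a multiple of itself, and then
  the hexagon is zero as well.\<close>

lemma modular_symbol_hexagon:
  assumes d: "det d = 1" and a: "a $ 3 \<noteq> 0" and M: "M $ 3 $ 1 = 0" "det M = 1"
  defines "h \<equiv> hexagon (iemb (d *v e1)) (iemb (d *v (M *v e1))) (iemb (d *v a))"
  shows "modular_symbol (iemb (d *v e1)) (iemb (d *v (M *v e1))) (iemb (d *v a)) = {h :: ('k::field_char_0 ^ 3) set list \<Rightarrow>\<^sub>0 rat}"
    and "h \<in> carrier tits_cycles1"
proof -
  define t where "t = triple (iemb (d *v e1)) (iemb (d *v (M *v e1))) (iemb (d *v a) :: 'k ^ 3)"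
  \<comment> \<open>As \<open>det d = 1\<close>, this is the triple product of \<open>e1\<close>,
    \<open>M e1\<close> and \<open>a\<close>, and \<open>M e1\<close> has third coordinate
    0.\<close>
  have "t = of_int (M$2$1 * a$3)"
    unfolding t_def iemb_mult[of d] triple_matrix det_mat_of_int
    using d M by (simp add: triple_def dot_def cross_def matrix_vector_mult_nth)
  then have t0: "t = 0 \<longleftrightarrow> M$2$1 = 0" using a by simp
  have "modular_symbol (iemb (d *v e1)) (iemb (d *v (M *v e1))) (iemb (d *v a)) = {h} \<and> h \<in> carrier tits_cycles1"
  proof (cases "t = 0")
    case False
    then show ?thesis unfolding h_def t_def
      by (auto simp: modular_symbol_def is_basis3_iff tits_coset hexagon_cycle)
  next
    case True
    have e: "M *v e1 = M$1$1 *s e1" using True t0 M by (simp add: vec3_eq_iff matrix_vector_mult_nth)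
    have "M$1$1 \<noteq> 0" using M True t0 by (auto simp: det_3)
    moreover have "(iemb (d *v (M *v e1)) :: 'k ^ 3) = of_int (M$1$1) *s iemb (d *v e1)"
      unfolding e by (simp add: vec_eq_iff matrix_vector_mult_nth algebra_simps)
    ultimately have "h = 0" unfolding h_def by (simp add: hexagon_degenerate)
    then show ?thesis using True unfolding t_def
      by (simp add: modular_symbol_def is_basis3_iff steinberg_simps tits_cycles1_simps)
  qed
  then show "modular_symbol (iemb (d *v e1)) (iemb (d *v (M *v e1))) (iemb (d *v a)) = {h}"
    and "h \<in> carrier tits_cycles1" by auto
qed

context quadratic
begin

text \<open>The 2 by 2 minor is formed from the rational coordinates of the first two entries of
  \<open>b\<close>. It is nonzero exactly when \<open>b\<close> and its conjugate span the plane of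
  the first two coordinates; \<open>a\<close> lies off this plane.\<close>

definition standard :: "int ^ 3 \<Rightarrow> 'e ^ 3 \<Rightarrow> bool"
  where "standard a b \<longleftrightarrow> a $ 3 \<noteq> 0 \<and> b $ 3 = 0 \<and> re (b$1) * im (b$2) - re (b$2) * im (b$1) \<noteq> 0"

lemma standard_independent:
  assumes "standard a b" "of_rat p * b$1 + of_rat q * b$2 = 0"
  shows "p = 0 \<and> q = 0"
proof -
  let ?D = "re (b$1) * im (b$2) - re (b$2) * im (b$1)"
  have D: "?D \<noteq> 0" using assms(1) by (simp add: standard_def)
  have e: "p * re (b$1) + q * re (b$2) = 0" "p * im (b$1) + q * im (b$2) = 0"
    using arg_cong[OF assms(2), of re] arg_cong[OF assms(2), of im] by simp_all
  \<comment> \<open>Cramer's rule for the two rational equations \<open>e\<close>, here for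
    \<open>p\<close> and below for \<open>q\<close>.\<close>
  have "p * ?D = (p * re (b$1) + q * re (b$2)) * im (b$2) - (p * im (b$1) + q * im (b$2)) * re (b$2)"
    by (simp add: algebra_simps)
  moreover have "q * ?D = (p * im (b$1) + q * im (b$2)) * re (b$1) - (p * re (b$1) + q * re (b$2)) * im (b$1)"
    by (simp add: algebra_simps)
  ultimately show ?thesis using D unfolding e by simp
qed

lemma standard_independent_int:
  assumes "standard a b" "of_int p * b$1 + of_int q * b$2 = 0"
  shows "p = 0 \<and> q = 0"
  using standard_independent[of a b "of_int p" "of_int q"] assms by simp

text \<open>The third coordinate of \<open>M b\<close> is zero and is an integral combination of the
  first two entries of \<open>b\<close>, which are independent over the rationals.\<close>

lemma standard_eigenvector:
  assumes "standard a b" "mat_of_int M *v b = c *s b"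
  shows "M $ 3 $ 1 = 0" "M $ 3 $ 2 = 0"
proof -
  have "(mat_of_int M *v b) $ 3 = (c *s b) $ 3" using assms(2) by simp
  then have "of_int (M$3$1) * b$1 + of_int (M$3$2) * b$2 = 0"
    using assms(1) by (simp add: matrix_vector_mult_nth standard_def)
  then show "M $ 3 $ 1 = 0" "M $ 3 $ 2 = 0" using standard_independent_int[OF assms(1)] by blast+
qed

lemma eigenvalue_nonzero:
  assumes "det M = 1" "mat_of_int M *v b = c *s b" "(b :: 'k::field_char_0 ^ 3) \<noteq> 0"
  shows "c \<noteq> 0"
proof
  assume "c = 0"
  then have "b = 0" using SL3Z_inverse(1)[OF assms(1), of b] assms(2) by simp
  then show False using assms(3) by simp
qed

lemma standard_nonzero: "standard a b \<Longrightarrow> b \<noteq> 0" "standard a b \<Longrightarrow> (iemb a :: 'k::field_char_0 ^ 3) \<noteq> 0"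
  by (auto simp: standard_def vec3_eq_iff)

text \<open>The symbol [b, f, a] with \<open>f = e1\<close>, moved by \<open>d\<close>. The vector
  \<open>e1\<close> serves as \<open>f\<close> because in standard position it lies in the plane of
  \<open>b\<close> and its conjugate.\<close>

definition base_hexagon :: "int ^ 3 ^ 3 \<Rightarrow> int ^ 3 \<Rightarrow> 'e ^ 3 \<Rightarrow> ('e ^ 3) set list \<Rightarrow>\<^sub>0 rat"
  where "base_hexagon d a b = hexagon (mat_of_int d *v b) (mat_of_int d *v e1) (mat_of_int d *v iemb a)"

lemma base_hexagon_cycle:
  assumes "standard a b" "det d = 1"
  shows "base_hexagon d a b \<in> carrier tits_cycles1"
proof -
  have "b$2 \<noteq> 0" using standard_independent_int[OF assms(1), of 0 1] by auto
  then have "triple b e1 (iemb a) \<noteq> 0"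
    using assms(1) by (simp add: triple_def dot_def cross_def standard_def)
  then show ?thesis unfolding base_hexagon_def
    using assms(2) by (intro hexagon_cycle) (simp add: triple_matrix det_mat_of_int)
qed

text \<open>\<open>M\<close> multiplies \<open>b\<close> and \<open>a\<close> by nonzero scalars,
  which the hexagon does not see, and replaces \<open>e1\<close> by \<open>M e1\<close>. The vectors
  \<open>b\<close>, \<open>e1\<close>, \<open>M e1\<close> lie in one plane, so the difference of
  the two hexagons is a hexagon without \<open>b\<close>, which is rational.\<close>

lemma base_hexagon_action:
  assumes st: "standard a b" and d: "det d = 1" and M: "det M = 1"
    and b: "mat_of_int M *v b = c *s b" and a: "mat_of_int M *v (iemb a :: 'e ^ 3) = c' *s iemb a"
    and g: "g ** d = d ** M"
  shows "SL3_push g (base_hexagon d a b) - base_hexagon d a b =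
    push ext (hexagon (iemb (d *v e1)) (iemb (g *v (d *v e1))) (iemb (d *v a)))"
proof -
  let ?M = "mat_of_int M :: 'e ^ 3 ^ 3" and ?d = "mat_of_int d :: 'e ^ 3 ^ 3"
  let ?a = "iemb a :: 'e ^ 3"
  have c: "c \<noteq> 0" "c' \<noteq> 0"
    using eigenvalue_nonzero[OF M b] eigenvalue_nonzero[OF M a] standard_nonzero[OF st] by auto
  have M31: "M $ 3 $ 1 = 0" using standard_eigenvector[OF st b] by simp
  have gd: "mat_of_int g *v (?d *v v) = ?d *v (?M *v v)" for v
    using g by (simp add: matrix_vector_mul_assoc flip: map_matrix_of_int_mult)
  have e: "hexagon b (?M *v e1) ?a - hexagon b e1 ?a = hexagon e1 (?M *v e1) ?a"
  proof (rule hexagon_diff)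
    show "vec.subspace (plane (vector [0, 0, 1]) :: ('e ^ 3) set)" by (rule subspace_plane)
    show "plane (vector [0, 0, 1]) \<noteq> (UNIV :: ('e ^ 3) set)"
      by (rule plane_not_UNIV) (simp add: vec3_eq_iff)
    show "cross b e1 \<noteq> 0"
      using standard_independent_int[OF st, of 0 1] by (auto simp: cross_def vec3_eq_iff)
    \<comment> \<open>\<open>M e1\<close> is a nonzero integral vector of the coordinate plane, so
      it is not proportional to \<open>b\<close>.\<close>
    have "M$1$1 \<noteq> 0 \<or> M$2$1 \<noteq> 0" using M M31 by (auto simp: det_3)
    then show "cross b (?M *v e1) \<noteq> 0"
      using standard_independent_int[OF st, of "M$2$1" "- (M$1$1)"]
      by (auto simp: cross_def vec3_eq_iff matrix_vector_mult_nth algebra_simps)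
  qed (use st M31 in \<open>simp_all add: dot_def standard_def matrix_vector_mult_nth\<close>)
  have "SL3_push g (base_hexagon d a b) = SL3_push d (hexagon (?M *v b) (?M *v e1) (?M *v ?a))"
    by (simp add: base_hexagon_def push_hexagon_matrix gd)
  also have "hexagon (?M *v b) (?M *v e1) (?M *v ?a) = hexagon (c *s b) (1 *s (?M *v e1)) (c' *s ?a)"
    by (simp add: a b)
  also have "\<dots> = hexagon b (?M *v e1) ?a" using c by (intro hexagon_scale) auto
  finally have "SL3_push g (base_hexagon d a b) - base_hexagon d a b =
      SL3_push d (hexagon b (?M *v e1) ?a - hexagon b e1 ?a)"
    by (simp add: base_hexagon_def push_hexagon_matrix push_minus)
  also have "\<dots> = push ext (hexagon (iemb (d *v e1)) (iemb (g *v (d *v e1))) (iemb (d *v a)))"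
    unfolding e by (simp add: push_hexagon_matrix push_hexagon_ext iemb_mult emb_mat_of_int gd)
  finally show ?thesis .
qed

end

section \<open>Standard position\<close>

text \<open>The primitive vector \<open>(y', - x')\<close> orthogonal to \<open>(x, y)\<close> is
  the first column; Bezout coefficients complete it to determinant 1.\<close>

lemma int_pair_unimodular:
  fixes x y :: int
  obtains p q r s where "p * s - q * r = 1" "x * p + y * r = 0"
proof (cases "x = 0 \<and> y = 0")
  case True
  then show ?thesis using that[of 1 1 0 0] by simp
next
  case False
  obtain q s where qs: "q * x + s * y = gcd x y" using bezout_int by blast
  obtain x' y' where xy: "x = x' * gcd x y" "y = y' * gcd x y" by (metis dvdE gcd_dvd1 gcd_dvd2 mult.commute)
  have g: "gcd x y \<noteq> 0" using False by simp
  have "(q * x' + s * y') * gcd x y = 1 * gcd x y" using qs xy by (metis distrib_right mult.assoc mult_1)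
  then have "q * x' + s * y' = 1" using g by (metis mult_right_cancel)
  moreover have "x * y' + y * (- x') = 0" using xy by (metis add.right_inverse mult.assoc mult.commute mult_minus_right)
  ultimately show ?thesis using that[of y' s q "- x'"] by (simp add: algebra_simps)
qed

lemma int_covector_unimodular:
  fixes \<psi> :: "int ^ 3"
  obtains d :: "int ^ 3 ^ 3" and k where "det d = 1" "transpose d *v \<psi> = vector [0, 0, k]"
proof -
  obtain p q r s where 1: "p * s - q * r = 1" "\<psi>$1 * p + \<psi>$2 * r = 0"
    by (rule int_pair_unimodular)
  define g where "g = \<psi>$1 * q + \<psi>$2 * s"
  obtain p' q' r' s' where 2: "p' * s' - q' * r' = 1" "g * p' + \<psi>$3 * r' = 0"
    by (rule int_pair_unimodular)
  \<comment> \<open>A product of two block matrices: the one on coordinates 1 and 2 clears the first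
    entry of \<psi> and turns the second into \<open>g\<close>, the one on coordinates 2 and 3
    clears \<open>g\<close>.\<close>
  define d :: "int ^ 3 ^ 3" where "d = vector [vector [p, q * p', q * q'], vector [r, s * p', s * q'], vector [0, r', s']]"
  have "det d = (p * s - q * r) * (p' * s' - q' * r')" by (simp add: d_def det_3 algebra_simps)
  then have "det d = 1" using 1 2 by simp
  moreover have "transpose d *v \<psi> = vector [0, 0, g * q' + \<psi>$3 * s']"
    using 1 2 by (simp add: vec3_eq_iff matrix_vector_mult_nth transpose_def d_def g_def algebra_simps)
  ultimately show ?thesis using that by blast
qed

lemma dot_transpose: "dot (transpose A *v u) v = dot u (A *v v)" for A :: "'a::comm_ring_1 ^ 3 ^ 3"
  by (simp add: dot_def matrix_vector_mult_nth transpose_def algebra_simps)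

lemma transpose_mat_of_int: "transpose (mat_of_int A) = mat_of_int (transpose A)"
  by (simp add: vec_eq_iff transpose_def)

lemma rat_vec_scale_int:
  fixes q :: "rat ^ 3"
  assumes "q \<noteq> 0"
  obtains z :: "int ^ 3" and m :: rat where "m \<noteq> 0" "iemb z = m *s q" "z \<noteq> 0"
proof -
  define n where "n i = fst (quotient_of (q $ i))" for i
  define e where "e i = snd (quotient_of (q $ i))" for i
  have e: "e i \<noteq> 0" for i unfolding e_def by (metis quotient_of_denom_pos' less_irrefl)
  have q: "q $ i = of_int (n i) / of_int (e i)" for i
    unfolding n_def e_def by (rule quotient_of_div) simp
  define z :: "int ^ 3" where "z = vector [n 1 * e 2 * e 3, n 2 * e 1 * e 3, n 3 * e 1 * e 2]"
  have "iemb z = (of_int (e 1 * e 2 * e 3) :: rat) *s q"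
    using e by (simp add: vec3_eq_iff z_def q field_simps)
  moreover have m: "(of_int (e 1 * e 2 * e 3) :: rat) \<noteq> 0" using e by simp
  ultimately have z: "z \<noteq> 0" using assms by (auto simp: vec3_eq_iff)
  show ?thesis by (rule that[OF m _ z]) fact
qed

definition flag_of :: "int ^ 3 ^ 3 \<Rightarrow> int ^ 3 \<Rightarrow> 'e::field_char_0 ^ 3 \<Rightarrow> ('e ^ 3) set list"
  where "flag_of d a b = [vec.span {mat_of_int d *v b}, vec.span {mat_of_int d *v b, mat_of_int d *v iemb a}]"

lemma rational_image_iff:
  assumes "det g = 1"
  shows "rational ((*v) (mat_of_int g) ` U) \<longleftrightarrow> rational (U :: ('e::field_char_0 ^ 3) set)"
proof -
  have *: "rational ((*v) (mat_of_int g) ` U)" if "rational U" for g and U :: "('e ^ 3) set"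
  proof -
    obtain V where V: "vec.subspace V" "U = ext V" using \<open>rational U\<close> by (auto simp: rational_def)
    have "vec.subspace ((*v) (mat_of_int g) ` V)"
      using V(1) matrix_image_span[of _ V] by (metis vec.span_eq_iff)
    then show ?thesis unfolding rational_def V(2) using ext_image[of g V] by blast
  qed
  have "(*v) (mat_of_int (adj3 g)) ` (*v) (mat_of_int g) ` U = U"
    by (simp add: image_image SL3Z_inverse[OF assms])
  then show ?thesis using *[of U g] *[of "(*v) (mat_of_int g) ` U" "adj3 g"] by auto
qed

lemma rational_iemb: "rational (vec.span {iemb a} :: ('e::field_char_0 ^ 3) set)"
  using rational_span[of "{iemb a}", where 'a = 'e] by simp

context quadratic
begin

text \<open>Write \<open>W\<close> as the kernel of \<phi>. The common zero of
  \<open>Re \<phi>\<close> and \<open>Im \<phi>\<close>, their cross product, is the rational point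
  \<open>a0\<close> of \<open>W\<close>; dually the cross product of \<open>Re b0\<close> and
  \<open>Im b0\<close> is the covector \<psi> of the rational plane through \<open>b0\<close>. The
  matrix \<open>d\<close> moves the plane of the first two coordinates to the kernel of
  \<psi>.\<close>

lemma nonrational_flag_standard:
  assumes n: "[V, W] \<in> tits_flags 2" "\<not> rational V" "\<not> rational (W :: ('e ^ 3) set)"
  obtains d a b where "det d = 1" "standard a b" "[V, W] = flag_of d a b"
proof -
  obtain b0 \<phi> where b0: "b0 \<noteq> 0" "V = vec.span {b0}" and \<phi>: "\<phi> \<noteq> 0" "W = plane \<phi>"
    by (rule tits_flag_cases[OF n(1)])
  have W: "vec.subspace W" "W \<noteq> UNIV" "b0 \<in> W"
    using n(1) b0(2) vec.span_base[of b0 "{b0}"] by (auto simp: tits_flags_2_iff proper_subspace_def)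
  have "\<not> rational (vec.span {\<phi>})"
  proof
    assume "rational (vec.span {\<phi>})"
    then obtain q where q: "q \<noteq> 0" "vec.span {\<phi>} = vec.span {emb q}"
      by (rule rational_point) (use \<phi>(1) in simp)
    then have "\<phi> \<in> vec.span {emb q}" using vec.span_base[of \<phi> "{\<phi>}"] by simp
    then obtain c where c: "\<phi> = c *s emb q" by (auto simp: vec.span_singleton)
    then have c0: "c \<noteq> 0" using \<phi>(1) by auto
    have "dot \<phi> v = c * dot (emb q) v" for v by (simp add: c dot_def algebra_simps)
    then have "W = plane (emb q)" unfolding \<phi>(2) using c0 by (auto simp: plane_def)
    then show False using rational_plane n(3) by simp
  qed
  then have "cross (Re \<phi>) (Im \<phi>) \<noteq> 0" using cross_Re_Im[OF \<phi>(1)] by simp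
  then obtain a0 :: "int ^ 3" and m where a0: "iemb a0 = m *s cross (Re \<phi>) (Im \<phi>)" "a0 \<noteq> 0"
    by (rule rat_vec_scale_int)
  have smult: "dot u (c *s v) = c * dot u v" "dot (c *s u) v = c * dot u v" for u v :: "rat ^ 3" and c
    by (simp_all add: dot_def algebra_simps)
  have dot_emb: "dot (emb q) v = 0 \<longleftrightarrow> dot q (Re v) = 0 \<and> dot q (Im v) = 0" "dot v (emb q) = 0 \<longleftrightarrow> dot q (Re v) = 0 \<and> dot q (Im v) = 0" for q v
    unfolding re_im_zero_iff[of "dot _ _"] by (simp_all add: dot_def mult.commute)
  have "dot \<phi> (emb (iemb a0)) = 0" unfolding dot_emb a0(1) smult by simp
  then have a0W: "iemb a0 \<in> W" unfolding \<phi>(2) by simp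
  obtain \<psi> :: "int ^ 3" and m' where \<psi>: "iemb \<psi> = m' *s cross (Re b0) (Im b0)" "\<psi> \<noteq> 0"
    using cross_Re_Im[OF b0(1)] n(2) b0(2) rat_vec_scale_int by metis
  have "dot (emb (iemb \<psi>)) b0 = 0" unfolding dot_emb \<psi>(1) smult by simp
  then have \<psi>b0: "dot (iemb \<psi>) b0 = 0" by simp
  obtain d k where d: "det d = 1" "transpose d *v \<psi> = vector [0, 0, k]" by (rule int_covector_unimodular)
  have key: "dot (iemb \<psi>) (mat_of_int d *v v) = of_int k * v $ 3" for v :: "'k::field_char_0 ^ 3"
  proof -
    have "dot (iemb \<psi>) (mat_of_int d *v v) = dot (iemb (transpose d *v \<psi>)) v"
      by (simp only: iemb_mult transpose_mat_of_int[symmetric] dot_transpose)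
    then show ?thesis unfolding d(2) by (simp add: dot_def)
  qed
  have "k \<noteq> 0"
  proof
    assume "k = 0"
    then have "dot (iemb \<psi>) v = 0" for v :: "rat ^ 3"
      using key[of "mat_of_int (adj3 d) *v v"] SL3Z_inverse(2)[OF d(1), of v] by simp
    then have "plane (iemb \<psi>) = (UNIV :: (rat ^ 3) set)" by auto
    then show False using plane_not_UNIV[of "iemb \<psi> :: rat ^ 3"] \<psi>(2) by (simp add: vec3_eq_iff)
  qed
  define b where "b = mat_of_int (adj3 d) *v b0"
  define a where "a = adj3 d *v a0"
  have db: "mat_of_int d *v b = b0" unfolding b_def by (rule SL3Z_inverse(2)[OF d(1)])
  have da: "mat_of_int d *v iemb a = (iemb a0 :: 'e ^ 3)" unfolding a_def iemb_mult by (rule SL3Z_inverse(2)[OF d(1)])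
  have b3: "b $ 3 = 0" using key[of b] \<psi>b0 \<open>k \<noteq> 0\<close> db by simp
  have ne: "iemb a0 \<noteq> (0 :: 'e ^ 3)" using a0(2) by (simp add: vec3_eq_iff)
  have nin: "iemb a0 \<notin> vec.span {b0}"
  proof
    assume "iemb a0 \<in> vec.span {b0}"
    then have "vec.span {b0} = vec.span {iemb a0}" using ne b0(1) by (intro span_single_unique) simp_all
    then show False using n(2) b0(2) by (simp add: rational_iemb)
  qed
  have W_eq: "W = vec.span {b0, iemb a0}" using span_pair_unique[OF b0(1) nin W(1,2,3) a0W] .
  \<comment> \<open>Otherwise \<open>W\<close> would be the kernel of \<psi>, which is
    rational.\<close>
  have a3: "a $ 3 \<noteq> 0"
  proof
    assume "a $ 3 = 0"
    then have "dot (iemb \<psi>) (iemb a0 :: 'e ^ 3) = 0" using key[of "iemb a :: 'e ^ 3"] da by simp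
    moreover have "iemb \<psi> \<noteq> (0 :: 'e ^ 3)" using \<psi>(2) by (simp add: vec3_eq_iff)
    ultimately have "plane (iemb \<psi>) = vec.span {b0, iemb a0}"
      using b0(1) nin \<psi>b0 by (intro span_pair_unique subspace_plane plane_not_UNIV) simp_all
    moreover have "rational (plane (emb (iemb \<psi>)) :: ('e ^ 3) set)" by (rule rational_plane)
    ultimately show False using W_eq n(3) by simp
  qed
  have "\<not> rational (vec.span {b})"
  proof
    assume "rational (vec.span {b})"
    then have "rational ((*v) (mat_of_int d) ` vec.span {b})" using rational_image_iff[OF d(1)] by blast
    then show False using n(2) b0(2) by (simp add: matrix_image_span db)
  qed
  moreover have "b \<noteq> 0" using db b0(1) by auto
  ultimately have "cross (Re b) (Im b) \<noteq> 0" by (simp add: cross_Re_Im)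
  then have "standard a b" using b3 a3 by (auto simp: standard_def cross_def vec3_eq_iff algebra_simps)
  then show ?thesis using that[OF d(1)] by (simp add: flag_of_def db da b0(2) W_eq)
qed

text \<open>Comparing third coordinates shows that \<beta> is rational, so \<open>\<alpha> b\<close>
  is a rational vector. With \<alpha> nonzero, \<open>b\<close> would be a multiple of a rational
  vector and its minor would vanish.\<close>

lemma standard_combination_rational:
  assumes st: "standard a b" and e: "iemb x = \<alpha> *s b + \<beta> *s (iemb a :: 'e ^ 3)"
  shows "\<alpha> = 0"
proof (rule ccontr)
  assume \<alpha>: "\<alpha> \<noteq> 0"
  have "(iemb x :: 'e ^ 3) $ 3 = (\<alpha> *s b + \<beta> *s iemb a) $ 3" using e by simp
  then have "\<beta> = of_rat (of_int (x$3) / of_int (a$3))"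
    using st by (simp add: standard_def of_rat_divide field_simps)
  then obtain q where q: "\<beta> = of_rat q" by blast
  define r where "r i = of_int (x$i) - q * of_int (a$i)" for i
  have b: "b $ i = inverse \<alpha> * of_rat (r i)" for i
  proof -
    have "(iemb x :: 'e ^ 3) $ i = (\<alpha> *s b + \<beta> *s iemb a) $ i" using e by simp
    then have "\<alpha> * b $ i = of_rat (r i)" by (simp add: q r_def of_rat_diff of_rat_mult algebra_simps)
    then show ?thesis using \<alpha> by (simp add: field_simps)
  qed
  have "re (b $ 1) * im (b $ 2) - re (b $ 2) * im (b $ 1) = 0" unfolding b by simp
  then show False using st by (simp add: standard_def)
qed

text \<open>The point of the flag is fixed, which gives the eigenvector \<open>b\<close>. Moreover
  \<open>M a\<close> is an integral vector in the span of \<open>b\<close> and \<open>a\<close>,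
  where the multiples of \<open>a\<close> are the only rational vectors.\<close>

lemma flag_stabilizer_eigen:
  assumes st: "standard a b" and d: "det d = 1" and g: "det g = 1"
    and stab: "map ((`) ((*v) (mat_of_int g))) (flag_of d a b) = flag_of d a b"
  defines "M \<equiv> adj3 d ** g ** d"
  shows "det M = 1" "g ** d = d ** M"
    "\<exists>c. mat_of_int M *v b = c *s b" "\<exists>c. mat_of_int M *v (iemb a :: 'e ^ 3) = c *s iemb a"
proof -
  let ?d = "mat_of_int d :: 'e ^ 3 ^ 3" and ?g = "mat_of_int g :: 'e ^ 3 ^ 3"
  have "det (adj3 d) * det d = 1" using adj3_mult(1)[OF d] by (metis det_I det_mul)
  then show "det M = 1" using d g by (simp add: M_def det_mul)
  show "g ** d = d ** M" by (simp add: M_def matrix_mul_assoc adj3_mult(2)[OF d])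
  have M: "mat_of_int M *v v = mat_of_int (adj3 d) *v (?g *v (?d *v v))" for v :: "'e ^ 3"
    by (simp add: M_def matrix_vector_mul_assoc map_matrix_of_int_mult matrix_mul_assoc)
  have 1: "vec.span {?g *v (?d *v b)} = vec.span {?d *v b}"
    and 2: "vec.span {?g *v (?d *v b), ?g *v (?d *v iemb a)} = vec.span {?d *v b, ?d *v iemb a}"
    using stab by (simp_all add: flag_of_def matrix_image_span)
  have "?g *v (?d *v b) \<in> vec.span {?d *v b}" using 1 vec.span_base by blast
  then obtain c where "?g *v (?d *v b) = c *s (?d *v b)" by (auto simp: vec.span_singleton)
  then have "mat_of_int M *v b = c *s b" unfolding M by (simp add: vec.scale SL3Z_inverse[OF d])
  then show "\<exists>c. mat_of_int M *v b = c *s b" by blast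
  have "?g *v (?d *v iemb a) \<in> vec.span {?d *v b, ?d *v iemb a}" using 2 vec.span_base by blast
  then obtain \<alpha> \<beta> where "?g *v (?d *v iemb a) = \<alpha> *s (?d *v b) + \<beta> *s (?d *v iemb a)"
    unfolding span_pair by blast
  then have e: "mat_of_int M *v iemb a = \<alpha> *s b + \<beta> *s iemb a"
    unfolding M by (simp add: vec.scale vec.add SL3Z_inverse[OF d])
  have "iemb (M *v a) = \<alpha> *s b + \<beta> *s iemb a" unfolding iemb_mult by (rule e)
  then have "\<alpha> = 0" by (rule standard_combination_rational[OF st])
  then show "\<exists>c. mat_of_int M *v (iemb a :: 'e ^ 3) = c *s iemb a" using e by auto
qed

lemma conj_minor:
  "b$1 * conj (b$2) - b$2 * conj (b$1) = - (of_rat (2 * (re (b$1) * im (b$2) - re (b$2) * im (b$1))) * s)"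
proof -
  have "(x + y * s) * (x' - y' * s) - (x' + y' * s) * (x - y * s) = - (2 * (x * y' - x' * y) * s)"
    for x y x' y' by (simp add: algebra_simps)
  from this[of "of_rat (re (b$1))" "of_rat (im (b$1))" "of_rat (re (b$2))" "of_rat (im (b$2))"]
  show ?thesis using decomp[of "b$1"] decomp[of "b$2"]
    by (simp add: conj_def of_rat_mult of_rat_diff)
qed

text \<open>Passing from rational coordinates to the pair \<open>b\<close>, conjugate of
  \<open>b\<close> multiplies the minor by \<open>- 2 s\<close>, see \<open>conj_minor\<close>. So
  an eigenbasis as in the theorem is \<open>standard\<close> as soon as
  \<open>b $ 3 = 0\<close>.\<close>

lemma standard_iff: "standard a b \<longleftrightarrow> b $ 3 = 0 \<and> triple b (vec_map conj b) (iemb a) \<noteq> 0"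
proof (cases "b $ 3 = 0")
  case True
  then have "triple b (vec_map conj b) (iemb a) = (b$1 * conj (b$2) - b$2 * conj (b$1)) * of_int (a $ 3)"
    by (simp add: triple_def dot_def cross_def field_hom_0[OF field_hom_conj])
  moreover have "s \<noteq> 0" using irrational by auto
  ultimately show ?thesis using True by (auto simp: standard_def conj_minor)
qed (simp add: standard_def)

lemma conj_matrix:
  "mat_of_int M *v b = c *s b \<Longrightarrow> mat_of_int M *v vec_map conj b = conj c *s vec_map conj b"
proof -
  assume e: "mat_of_int M *v b = c *s b"
  have int: "conj (of_int z) = of_int z" for z using conj_rat[of "of_int z"] by simp
  have "(mat_of_int M *v vec_map conj b) $ i = conj ((mat_of_int M *v b) $ i)" for i
    by (simp add: matrix_vector_mult_nth field_hom_add[OF field_hom_conj] field_hom_mult[OF field_hom_conj] int)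
  then show ?thesis unfolding e by (simp add: vec_eq_iff field_hom_mult[OF field_hom_conj])
qed

text \<open>The third row of \<open>M\<close> is zero except for its last entry, so
  \<open>det M = 1\<close> makes this entry the sign \<open>det h\<close>. The first two coordinates
  of \<open>M b = c b\<close> show that the quotient of the first two entries of \<open>b\<close>
  witnesses that \<open>h\<close> is unital.\<close>

lemma standard_block_matrix:
  assumes st: "standard a b" and M: "det M = 1" and b: "mat_of_int M *v b = c *s b"
    and a: "mat_of_int M *v (iemb a :: 'e ^ 3) = c' *s iemb a"
  obtains h u where "unital TYPE('e) h" "M = block_matrix h u"
    "eigenbasis (mat_of_int (block_matrix h u)) b (vec_map galois_conj b) (iemb a)"
proof -
  define h :: "int ^ 2 ^ 2" where "h = vector [vector [M$1$1, M$1$2], vector [M$2$1, M$2$2]]"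
  define u :: "int ^ 2" where "u = vector [M$1$3, M$2$3]"
  note M3 = standard_eigenvector[OF st b]
  have det: "det h * M$3$3 = 1" using M M3 by (simp add: h_def det_2 det_3 algebra_simps)
  then have h1: "M$3$3 = det h" "det h * det h = 1" by (auto simp: zmult_eq_1_iff)
  have Mb: "M = block_matrix h u"
    using M3 h1 by (simp add: vec3_eq_iff block_matrix_def h_def u_def)
  define D where "D = det h"
  have D: "D * (M$1$1 * M$2$2 - M$1$2 * M$2$1) = 1"
    using h1(2) by (simp add: D_def h_def det_2)
  \<comment> \<open>\<open>det h\<close> times the adjugate, an inverse of \<open>h\<close> because
    \<open>det h\<close> squares to 1.\<close>
  define h' :: "int ^ 2 ^ 2" where "h' = vector [vector [D * M$2$2, - (D * M$1$2)], vector [- (D * M$2$1), D * M$1$1]]"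
  have "h ** h' = mat 1" "h' ** h = mat 1"
    using D by (simp_all add: vec_eq_iff forall_2 matrix_matrix_mult_def sum_2 mat_def h_def h'_def algebra_simps)
  then have inv: "invertible h" unfolding invertible_def by blast
  have b2: "b$2 \<noteq> 0" using standard_independent_int[OF st, of 0 1] by auto
  have irr: "b$1 / b$2 \<notin> \<rat>"
  proof
    assume "b$1 / b$2 \<in> \<rat>"
    then obtain q where "b$1 / b$2 = of_rat q" by (auto elim: Rats_cases)
    then have "of_rat 1 * b$1 + of_rat (- q) * b$2 = 0" using b2 by (simp add: field_simps of_rat_minus)
    then show False using standard_independent[OF st, of 1 "- q"] by simp
  qed
  have c: "c \<noteq> 0" using eigenvalue_nonzero[OF M b] standard_nonzero[OF st] by auto
  have "(mat_of_int M *v b) $ 1 = c * b$1" "(mat_of_int M *v b) $ 2 = c * b$2" using b by simp_all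
  then have "map_matrix of_int h *v vector [b$1 / b$2, 1] = c *s (vector [b$1 / b$2, 1] :: 'e ^ 2)"
    using b2 st by (simp add: vec_eq_iff forall_2 matrix_vector_mult_def sum_2 sum_3 h_def standard_def field_simps)
  then have "unital TYPE('e) h" unfolding unital_def using inv irr c by blast
  moreover have "eigenbasis (mat_of_int (block_matrix h u)) b (vec_map galois_conj b) (iemb a)"
    unfolding eigenbasis_def is_basis3_iff galois_conj_eq Mb[symmetric]
    using st[unfolded standard_iff] conj_matrix[OF b] a b by auto
  ultimately show ?thesis using that Mb by blast
qed

end

section \<open>Retraction onto the rational cycles\<close>

lemma SL3Z_inv: "det g = 1 \<Longrightarrow> inv\<^bsub>SL3Z\<^esub> g = adj3 g"
proof -
  assume g: "det g = 1"
  interpret group SL3Z by (rule group_SL3Z)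
  have "det (adj3 g) * det g = 1" using adj3_mult(1)[OF g] by (metis det_I det_mul)
  then show ?thesis using g adj3_mult[OF g] by (intro inv_equality) auto
qed

lemma subgroup_SL3Z:
  assumes "subgroup \<Gamma> SL3Z"
  shows "g \<in> \<Gamma> \<Longrightarrow> det g = 1" "g \<in> \<Gamma> \<Longrightarrow> h \<in> \<Gamma> \<Longrightarrow> g ** h \<in> \<Gamma>" "g \<in> \<Gamma> \<Longrightarrow> adj3 g \<in> \<Gamma>"
proof -
  interpret group SL3Z by (rule group_SL3Z)
  show d: "det g = 1" if "g \<in> \<Gamma>" for g using subgroup.subset[OF assms] that by auto
  show "g \<in> \<Gamma> \<Longrightarrow> h \<in> \<Gamma> \<Longrightarrow> g ** h \<in> \<Gamma>" using subgroup.m_closed[OF assms] by simp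
  show "adj3 g \<in> \<Gamma>" if "g \<in> \<Gamma>" using subgroup.m_inv_closed[OF assms that] SL3Z_inv[OF d[OF that]] by simp
qed

abbreviation act_flag :: "int ^ 3 ^ 3 \<Rightarrow> ('k::field_char_0 ^ 3) set list \<Rightarrow> ('k ^ 3) set list"
  where "act_flag g \<equiv> map ((`) ((*v) (mat_of_int g)))"

lemma act_flag_mult: "act_flag (g ** h) xs = act_flag g (act_flag h xs)"
  by (simp add: map_matrix_of_int_mult image_image matrix_vector_mul_assoc)

lemma image_mat_1: "(`) ((*v) (mat 1 :: 'k::field ^ 'n ^ 'n)) = (\<lambda>U. U)"
  by (auto simp: fun_eq_iff image_iff)

lemma act_flag_inverse:
  assumes "det g = 1"
  shows "act_flag (adj3 g) (act_flag g xs) = xs" "act_flag g (act_flag (adj3 g) xs) = xs"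
  by (simp_all add: act_flag_mult[symmetric] adj3_mult[OF assms] image_mat_1 del: map_map)

lemma SL3_push_inverse:
  assumes "det g = 1"
  shows "SL3_push (adj3 g) (SL3_push g c) = c" "SL3_push g (SL3_push (adj3 g) c) = c"
  by (simp_all add: SL3_push_mult[symmetric] adj3_mult[OF assms] image_mat_1 push_id)

lemma act_flag_of: "act_flag g (flag_of d a b) = flag_of (g ** d) a b"
  by (simp add: flag_of_def matrix_image_span map_matrix_of_int_mult matrix_vector_mul_assoc)

lemma SL3_push_cycle: "det g = 1 \<Longrightarrow> c \<in> carrier tits_cycles1 \<Longrightarrow> SL3_push g c \<in> carrier tits_cycles1"
  using push_tits_cycles1[OF flag_map_matrix] by blast

lemma SL3_push_ext: "SL3_push g (push ext c) = push ext (SL3_push g c)"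
  by (simp add: push_push ext_image)

text \<open>Five of the six flags have the point \<open>f\<close>, the point \<open>w\<close> or the
  plane of \<open>v\<close> and \<open>f\<close> as a member, all of them rational. The remaining
  one occurs with sign -1.\<close>

lemma lookup_hexagon_nonrational:
  assumes "rational (vec.span {f})" "rational (vec.span {w})" "rational (vec.span {v, f})"
    and "\<not> rational V" "\<not> rational W"
  shows "Poly_Mapping.lookup (hexagon v f w) [V, W] = - (1 when [vec.span {v}, vec.span {v, w}] = [V, W])"
proof -
  have "rational (vec.span {f, v})" using assms(3) by (simp add: insert_commute)
  then show ?thesis using assms
    by (auto simp: hexagon_def lookup_add lookup_minus lookup_single when_def)
qed

context quadratic
begin

definition irrational_flag :: "('e ^ 3) set list \<Rightarrow> bool"
  where "irrational_flag n \<longleftrightarrow> n \<in> tits_flags 2 \<and> (\<forall>U\<in>set n. \<not> rational U)"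

lemma irrational_flag_act:
  assumes "det g = 1"
  shows "irrational_flag (act_flag g n) \<longleftrightarrow> irrational_flag n"
proof -
  have *: "irrational_flag (act_flag g n)" if g: "det g = 1" and n: "irrational_flag n" for g n
  proof -
    obtain V W where VW: "n = [V, W]" "proper_subspace V" "proper_subspace W" "V \<subset> W" "\<not> rational V" "\<not> rational W"
      using n by (auto simp: irrational_flag_def tits_flags_2_iff)
    have "act_flag g n \<in> tits_flags 2" unfolding VW(1)
      using flag_map_matrix[OF g, where 'k = 'e] VW by (simp add: flag_map_def tits_flags_2_iff)
    then show ?thesis using VW by (simp add: irrational_flag_def rational_image_iff[OF g])
  qed
  have "det (adj3 g) * det g = 1" using adj3_mult(1)[OF assms] by (metis det_I det_mul)
  then have "det (adj3 g) = 1" using assms by simp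
  then show ?thesis using *[OF assms, of n] *[of "adj3 g" "act_flag g n"] act_flag_inverse(1)[OF assms, of n]
    by metis
qed

text \<open>The plane of \<open>b\<close> and \<open>e1\<close> is the coordinate plane, hence
  rational, and so is its image under \<open>d\<close>; the points of \<open>e1\<close> and
  \<open>a\<close> are rational by construction.\<close>

lemma lookup_base_hexagon:
  assumes st: "standard a b" and d: "det d = 1" and n: "irrational_flag n"
  shows "Poly_Mapping.lookup (base_hexagon d a b) n = - (1 when flag_of d a b = n)"
proof -
  obtain V W where VW: "n = [V, W]" "\<not> rational V" "\<not> rational W"
    using n by (auto simp: irrational_flag_def tits_flags_2_iff)
  have r: "rational (vec.span {mat_of_int d *v iemb x} :: ('e ^ 3) set)" for x
    using rational_iemb[of "d *v x"] by (simp add: iemb_mult)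
  have "cross b e1 \<noteq> 0"
    using standard_independent_int[OF st, of 0 1] by (auto simp: cross_def vec3_eq_iff)
  then have "vec.span {b, e1} = plane (vector [0, 0, 1])"
    using st cross_not_in_span
    by (intro span_pair_unique[symmetric] subspace_plane plane_not_UNIV)
      (auto simp: dot_def standard_def vec3_eq_iff)
  moreover have "vector [0, 0, 1] = (emb (vector [0, 0, 1]) :: 'e ^ 3)" by (simp add: vec3_eq_iff)
  ultimately have "rational (vec.span {b, e1})" using rational_plane[of "vector [0, 0, 1]"] by simp
  then have "rational ((*v) (mat_of_int d) ` vec.span {b, e1})" by (simp add: rational_image_iff[OF d])
  then have "rational (vec.span {mat_of_int d *v b, mat_of_int d *v e1})" by (simp add: matrix_image_span)
  then show ?thesis
    unfolding base_hexagon_def VW(1) flag_of_def using VW(2,3) r[of e1] r[of a]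
    by (intro lookup_hexagon_nonrational) simp_all
qed

end

section \<open>Compatible choices along the orbits of \<Gamma>\<close>

locale quadratic_level = quadratic s re im for s :: "'e::field_char_0" and re im +
  fixes \<Gamma> :: "(int ^ 3 ^ 3) set" and R :: "int ^ 3 \<Rightarrow> 'e ^ 3 \<Rightarrow> (int ^ 3 ^ 3) set"
  assumes \<Gamma>: "subgroup \<Gamma> SL3Z"
    and reps: "double_coset_reps SL3Z \<Gamma> (line_stabilizer a b) (R a b)"
begin

lemmas \<Gamma>_det = subgroup_SL3Z(1)[OF \<Gamma>]
lemmas \<Gamma>_mult = subgroup_SL3Z(2)[OF \<Gamma>]
lemmas \<Gamma>_inv = subgroup_SL3Z(3)[OF \<Gamma>]

lemma R_det: "d \<in> R a b \<Longrightarrow> det d = 1"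
  using reps[of a b] by (auto simp: double_coset_reps_def)

text \<open>This is why double cosets suffice: changing \<open>d\<close> on the right by the
  stabilizer of the two lines leaves its flag alone.\<close>

lemma line_stabilizer_flag:
  fixes b :: "'e ^ 3"
  assumes "g \<in> line_stabilizer a b"
  shows "flag_of (d ** g) a b = flag_of d a b"
proof -
  obtain c q where c: "c \<noteq> 0" "mat_of_int g *v b = c *s b"
    and q: "q \<noteq> 0" "mat_of_int g *v iemb a = (q::rat) *s iemb a"
    using assms by (auto simp: line_stabilizer_def)
  have "emb (mat_of_int g *v iemb a) = emb (q *s iemb a)" using q(2) by simp
  then have a: "mat_of_int g *v iemb a = (of_rat q *s iemb a :: 'e ^ 3)" by (simp add: emb_mat_of_int)
  have m: "mat_of_int (d ** g) *v v = mat_of_int d *v (mat_of_int g *v v)" for v :: "'e ^ 3"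
    by (simp add: map_matrix_of_int_mult matrix_vector_mul_assoc)
  show ?thesis unfolding flag_of_def m a c(2) vec.scale
    using c(1) q(1) by (simp add: span_scale span_pair_scale)
qed

text \<open>A presentation of the \<Gamma>-orbit of \<open>n\<close> by a flag in standard position,
  moved by one of the prescribed representatives.\<close>

definition datum :: "('e ^ 3) set list \<Rightarrow> (int ^ 3 ^ 3) \<times> (int ^ 3) \<times> ('e ^ 3) \<Rightarrow> bool"
  where "datum n = (\<lambda>(d, a, b). d \<in> R a b \<and> standard a b \<and> (\<exists>t\<in>\<Gamma>. n = act_flag t (flag_of d a b)))"

text \<open>If \<open>n\<close> is the flag of \<open>d\<close> and the representative of the double
  coset of \<open>d\<close> is \<open>r = g d h\<close>, then \<open>h\<close> does not change the
  flag, so the flag of \<open>r\<close> is the translate of \<open>n\<close> by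
  \<open>g\<close>.\<close>

lemma datum_exists:
  assumes "irrational_flag n"
  shows "\<exists>x. datum n x"
proof -
  interpret group SL3Z by (rule group_SL3Z)
  obtain V W where VW: "n = [V, W]" "[V, W] \<in> tits_flags 2" "\<not> rational V" "\<not> rational W"
    using assms by (auto simp: irrational_flag_def tits_flags_2_iff)
  obtain d a b where d: "det d = 1" and st: "standard a b" and n: "n = flag_of d a b"
    unfolding VW(1) by (rule nonrational_flag_standard[OF VW(2-4)])
  have "(\<Gamma> #>\<^bsub>SL3Z\<^esub> d) <#>\<^bsub>SL3Z\<^esub> line_stabilizer a b \<in> double_cosets SL3Z \<Gamma> (line_stabilizer a b)"
    using d by (auto simp: double_cosets_def)
  then obtain r where r: "r \<in> R a b" "r \<in> (\<Gamma> #>\<^bsub>SL3Z\<^esub> d) <#>\<^bsub>SL3Z\<^esub> line_stabilizer a b"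
    using reps[of a b] unfolding double_coset_reps_def by blast
  then obtain g h where g: "g \<in> \<Gamma>" and h: "h \<in> line_stabilizer a b" and rgh: "r = g ** d ** h"
    by (auto simp: set_mult_def r_coset_def)
  have "flag_of r a b = act_flag g n" unfolding rgh n act_flag_of line_stabilizer_flag[OF h] ..
  then have "n = act_flag (adj3 g) (flag_of r a b)" using act_flag_inverse(1)[OF \<Gamma>_det[OF g], of n] by simp
  then show ?thesis using r(1) st \<Gamma>_inv[OF g] by (intro exI[of _ "(r, a, b)"]) (auto simp: datum_def)
qed

text \<open>Equality of the predicates, so that the choice operator selects literally the same datum
  on a whole orbit.\<close>

lemma datum_act:
  assumes "g \<in> \<Gamma>"
  shows "datum (act_flag g n) = datum n"
proof -
  have *: "datum (act_flag g n) x" if g: "g \<in> \<Gamma>" and x: "datum n x" for g n x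
  proof -
    obtain d a b where dab: "x = (d, a, b)" by (cases x)
    obtain t where t: "t \<in> \<Gamma>" "n = act_flag t (flag_of d a b)" and o: "d \<in> R a b" "standard a b"
      using x unfolding datum_def dab by blast
    have "act_flag g n = act_flag (g ** t) (flag_of d a b)" unfolding t(2) act_flag_mult ..
    then show ?thesis unfolding datum_def dab using o \<Gamma>_mult[OF g t(1)] by blast
  qed
  show ?thesis using *[OF assms, of n] *[OF \<Gamma>_inv[OF assms], of "act_flag g n"]
      act_flag_inverse(1)[OF \<Gamma>_det[OF assms], of n] by (intro ext) metis
qed

text \<open>The choice of a datum depends only on the orbit of a flag.\<close>

definition the_datum where "the_datum n = (SOME x. datum n x)"

definition transporter where
  "transporter n = (SOME t. t \<in> \<Gamma> \<and> n = act_flag t (case the_datum n of (d, a, b) \<Rightarrow> flag_of d a b))"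

text \<open>Up to sign, a lift to St(E^3) of the generator of \<open>C\<close> at \<open>n\<close>.
  The transporter is determined only up to the stabilizer of the reference flag, so
  \<open>filling\<close> is equivariant only up to the symbols of the theorem.\<close>

definition filling :: "('e ^ 3) set list \<Rightarrow> ('e ^ 3) set list \<Rightarrow>\<^sub>0 rat"
  where "filling n = (if irrational_flag n
    then SL3_push (transporter n) (case the_datum n of (d, a, b) \<Rightarrow> base_hexagon d a b) else 0)"

lemma the_datum:
  assumes "irrational_flag n" "the_datum n = (d, a, b)"
  shows "d \<in> R a b" "standard a b" "transporter n \<in> \<Gamma>" "n = act_flag (transporter n) (flag_of d a b)"
    "filling n = SL3_push (transporter n) (base_hexagon d a b)"
proof -
  have x: "datum n (the_datum n)" unfolding the_datum_def using datum_exists[OF assms(1)] by (rule someI_ex)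
  then show "d \<in> R a b" "standard a b" unfolding assms(2) datum_def by auto
  have "\<exists>t. t \<in> \<Gamma> \<and> n = act_flag t (case the_datum n of (d, a, b) \<Rightarrow> flag_of d a b)"
    using x unfolding assms(2) datum_def by auto
  from someI_ex[OF this] show "transporter n \<in> \<Gamma>" "n = act_flag (transporter n) (flag_of d a b)"
    unfolding transporter_def[symmetric] by (simp_all add: assms(2))
  show "filling n = SL3_push (transporter n) (base_hexagon d a b)"
    using assms by (simp add: filling_def)
qed

lemma filling_cycle: "filling n \<in> carrier tits_cycles1"
proof (cases "irrational_flag n")
  case True
  obtain d a b where x: "the_datum n = (d, a, b)" by (cases "the_datum n")
  note t = the_datum[OF True x]
  show ?thesis unfolding t(5)
    by (intro SL3_push_cycle base_hexagon_cycle t \<Gamma>_det[OF t(3)] R_det[OF t(1)])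
qed (simp add: filling_def tits_cycles1_closed)

lemma SL3_push_base_hexagon: "SL3_push g (base_hexagon d a b) = base_hexagon (g ** d) a b"
  by (simp add: base_hexagon_def push_hexagon_matrix map_matrix_of_int_mult matrix_vector_mul_assoc)

lemma lookup_filling:
  assumes "irrational_flag n" "irrational_flag m"
  shows "Poly_Mapping.lookup (filling m) n = - (1 when m = n)"
proof -
  obtain d a b where x: "the_datum m = (d, a, b)" by (cases "the_datum m")
  note t = the_datum[OF assms(2) x]
  have "det (transporter m ** d) = 1" using \<Gamma>_det[OF t(3)] R_det[OF t(1)] by (simp add: det_mul)
  then show ?thesis
    unfolding t(5) SL3_push_base_hexagon using lookup_base_hexagon[OF t(2) _ assms(1)] t(4)
    by (simp add: act_flag_of)
qed

text \<open>The retraction onto the rational cycles; \<open>filling n\<close> has coefficient \<open>-1\<close> at \<open>n\<close>.\<close>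

definition rationalize :: "(('e ^ 3) set list \<Rightarrow>\<^sub>0 rat) \<Rightarrow> ('e ^ 3) set list \<Rightarrow>\<^sub>0 rat"
  where "rationalize z = z + lin_ext filling z"

lemma rationalize_add: "rationalize (y + z) = rationalize y + rationalize z"
  and rationalize_minus: "rationalize (y - z) = rationalize y - rationalize z"
  by (simp_all add: rationalize_def lin_ext_add lin_ext_minus)

text \<open>At a flag with two nonrational members only its own filling is nonzero, with coefficient
  -1, so the coefficient of \<open>z\<close> there cancels. What remains is a cycle in which every
  flag has a rational member.\<close>

lemma rationalize_rational:
  assumes "z \<in> carrier tits_cycles1"
  obtains q where "q \<in> carrier tits_cycles1" "rationalize z = push ext q"
proof -
  have "lin_ext filling z \<in> carrier tits_cycles1"
    by (intro lin_ext_closed tits_cycles1_closed filling_cycle)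
  then have c: "rationalize z \<in> carrier tits_cycles1"
    unfolding rationalize_def using assms by (intro tits_cycles1_closed)
  have zk: "Poly_Mapping.keys z \<subseteq> tits_flags 2" using assms by (simp add: tits_cycles1_simps)
  have half: "rational V \<or> rational W" if k: "[V, W] \<in> Poly_Mapping.keys (rationalize z)" for V W
  proof (rule ccontr)
    assume "\<not> ?thesis"
    then have n: "irrational_flag [V, W]"
      using k c by (auto simp: irrational_flag_def tits_cycles1_simps)
    have "Poly_Mapping.lookup (filling m) [V, W] = - (1 when m = [V, W])" for m
    proof (cases "irrational_flag m")
      case True
      then show ?thesis by (rule lookup_filling[OF n])
    next
      case False
      then show ?thesis using n by (auto simp: filling_def when_def)
    qed
    then have "Poly_Mapping.lookup (lin_ext filling z) [V, W] = - Poly_Mapping.lookup z [V, W]"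
      unfolding lookup_lin_ext[OF finite_keys order_refl]
      by (simp add: when_def sum_negf if_distrib[of "(*) _"] in_keys_iff cong: if_cong)
    then have "Poly_Mapping.lookup (rationalize z) [V, W] = 0" by (simp add: rationalize_def lookup_add)
    then show False using k by (simp add: in_keys_iff)
  qed
  note r = rational_cycle[OF c half_rational_cycle[OF c half]]
  show ?thesis by (rule that[OF r(1) r(2)[symmetric]])
qed

text \<open>Flags of a rational cycle have rational members, so nothing is filled in:
  \<open>rationalize\<close> restricts to the identity on rational cycles.\<close>

lemma rationalize_ext:
  assumes "q \<in> carrier tits_cycles1"
  shows "rationalize (push ext q) = push ext q"
proof -
  have "filling (map ext xs) = 0" if xs: "xs \<in> Poly_Mapping.keys q" for xs
  proof -
    have "xs \<in> tits_flags 2" using assms xs by (auto simp: tits_cycles1_simps)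
    then obtain V W where "xs = [V, W]" "vec.subspace V"
      unfolding tits_flags_2_iff proper_subspace_def by blast
    then have "\<not> irrational_flag (map ext xs)" by (auto simp: irrational_flag_def rational_def)
    then show ?thesis by (simp add: filling_def)
  qed
  then have "lin_ext filling (push ext q) = lin_ext (\<lambda>_. 0) q" unfolding lin_ext_push by (rule lin_ext_cong)
  also have "\<dots> = 0" by (simp add: lin_ext_def)
  finally show ?thesis by (simp add: rationalize_def)
qed

text \<open>The properties of the space of cycles whose classes lie in a given submodule of the coinvariants
  that contains the classes of the theorem.\<close>

definition level_space :: "((rat ^ 3) set list \<Rightarrow>\<^sub>0 rat) set \<Rightarrow> bool"
  where "level_space K \<longleftrightarrow> 0 \<in> K \<and> K \<subseteq> carrier tits_cycles1 \<and> (\<forall>x\<in>K. \<forall>y\<in>K. x + y \<in> K) \<and> (\<forall>q. \<forall>x\<in>K. scl q x \<in> K) \<and>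
    (\<forall>g\<in>\<Gamma>. \<forall>q\<in>carrier tits_cycles1. SL3_push g q - q \<in> K) \<and>
    (\<forall>a b d g. d \<in> R a b \<longrightarrow> standard a b \<longrightarrow> g \<in> \<Gamma> \<longrightarrow> act_flag g (flag_of d a b) = flag_of d a b \<longrightarrow>
      hexagon (iemb (d *v e1)) (iemb (g *v (d *v e1))) (iemb (d *v a)) \<in> K)"

context
  fixes K assumes K: "level_space K"
begin

lemma K_closed:
  shows "0 \<in> K" "x \<in> K \<Longrightarrow> y \<in> K \<Longrightarrow> x + y \<in> K" "x \<in> K \<Longrightarrow> scl q x \<in> K" "x \<in> K \<Longrightarrow> - x \<in> K"
    "x \<in> K \<Longrightarrow> x \<in> carrier tits_cycles1"
    "g \<in> \<Gamma> \<Longrightarrow> q' \<in> carrier tits_cycles1 \<Longrightarrow> SL3_push g q' - q' \<in> K"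
proof -
  show "0 \<in> K" "x \<in> K \<Longrightarrow> y \<in> K \<Longrightarrow> x + y \<in> K" and s: "x \<in> K \<Longrightarrow> scl q x \<in> K" for x q
    using K unfolding level_space_def by blast+
  show "x \<in> K \<Longrightarrow> - x \<in> K" using s[of x "-1"] by simp
  show "x \<in> K \<Longrightarrow> x \<in> carrier tits_cycles1" using K unfolding level_space_def by blast
  show "g \<in> \<Gamma> \<Longrightarrow> q' \<in> carrier tits_cycles1 \<Longrightarrow> SL3_push g q' - q' \<in> K"
    using K unfolding level_space_def by blast
qed

text \<open>Both terms are translates by \<open>t'\<close> of a lift at the same reference flag: of
  the lift itself and of its image under \<open>g0\<close>, an element of \<Gamma> that stabilizes
  this flag. Their difference is a translate of one of the symbols.\<close>

lemma filling_act:
  assumes g: "g \<in> \<Gamma>"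
  shows "filling (act_flag g n) - SL3_push g (filling n) \<in> push ext ` K"
proof (cases "irrational_flag n")
  case False
  then have "\<not> irrational_flag (act_flag g n)" using irrational_flag_act[OF \<Gamma>_det[OF g]] by blast
  then have "filling (act_flag g n) - SL3_push g (filling n) = push ext 0" using False by (simp add: filling_def)
  then show ?thesis using K_closed(1) by blast
next
  case True
  then have gn: "irrational_flag (act_flag g n)" using irrational_flag_act[OF \<Gamma>_det[OF g]] by blast
  obtain d a b where x: "the_datum n = (d, a, b)" by (cases "the_datum n")
  have gx: "the_datum (act_flag g n) = (d, a, b)" using x datum_act[OF g, of n] by (simp only: the_datum_def)
  define t t' where "t = transporter n" and "t' = transporter (act_flag g n)"
  note n = the_datum[OF True x, folded t_def] and n' = the_datum[OF gn gx, folded t'_def]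
  \<comment> \<open>\<open>t\<close> carries the reference flag to \<open>n\<close>,
    \<open>g\<close> carries \<open>n\<close> to its translate, and the inverse of \<open>t'\<close>
    leads back to the reference flag.\<close>
  define g0 where "g0 = adj3 t' ** g ** t"
  have g0: "g0 \<in> \<Gamma>" unfolding g0_def using \<Gamma>_mult \<Gamma>_inv n(3) n'(3) g by blast
  have t': "det t' = 1" using \<Gamma>_det n'(3) by blast
  have "act_flag g0 (flag_of d a b) = act_flag (adj3 t') (act_flag g n)"
    unfolding g0_def act_flag_mult n(4)[symmetric] ..
  also have "\<dots> = act_flag (adj3 t') (act_flag t' (flag_of d a b))" using n'(4) by simp
  also have "\<dots> = flag_of d a b" by (rule act_flag_inverse(1)[OF t'])
  finally have stab: "act_flag g0 (flag_of d a b) = flag_of d a b" .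
  define h :: "(rat ^ 3) set list \<Rightarrow>\<^sub>0 rat" where "h = hexagon (iemb (d *v e1)) (iemb (g0 *v (d *v e1))) (iemb (d *v a))"
  have h: "h \<in> K" unfolding h_def using K n(1,2) g0 stab unfolding level_space_def by blast
  note e = flag_stabilizer_eigen[OF n(2) R_det[OF n(1)] \<Gamma>_det[OF g0] stab]
  have base: "SL3_push g0 (base_hexagon d a b) - base_hexagon d a b = push ext h"
    using base_hexagon_action[OF n(2) R_det[OF n(1)] e(1) _ _ e(2)] e(3,4) unfolding h_def by blast
  have "SL3_push g (filling n) = SL3_push t' (SL3_push g0 (base_hexagon d a b))"
    unfolding n(5) g0_def SL3_push_mult SL3_push_inverse(2)[OF t'] ..
  then have "filling (act_flag g n) - SL3_push g (filling n) = push ext (- SL3_push t' h)"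
    unfolding n'(5) push_minus[symmetric] push_uminus SL3_push_ext[symmetric] base[symmetric]
    by (simp add: push_minus)
  \<comment> \<open>Translating by an element of \<Gamma> changes \<open>h\<close> only by a
    coinvariant relation.\<close>
  moreover have "- SL3_push t' h \<in> K"
    using K_closed(2,4) K_closed(6)[OF n'(3) K_closed(5)[OF h]] h by (metis diff_add_cancel)
  ultimately show ?thesis by blast
qed

text \<open>The element splits into the failure of \<open>rationalize\<close> to commute with
  \<open>g\<close>, a combination of the defects of \<open>filling_act\<close>, and the relation
  \<open>g q - q\<close> for the rational cycle \<open>q\<close> that \<open>rationalize z\<close>
  comes from.\<close>

lemma rationalize_act:
  assumes g: "g \<in> \<Gamma>" and z: "z \<in> carrier tits_cycles1"
  shows "rationalize (SL3_push g z - z) \<in> push ext ` K"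
proof -
  have add: "x + y \<in> push ext ` K" if "x \<in> push ext ` K" "y \<in> push ext ` K" for x y :: "('e ^ 3) set list \<Rightarrow>\<^sub>0 rat"
    using that by (auto simp: push_add[symmetric] intro!: imageI K_closed(2))
  have smult: "scl q x \<in> push ext ` K" if "x \<in> push ext ` K" for q and x :: "('e ^ 3) set list \<Rightarrow>\<^sub>0 rat"
    using that by (auto simp: push_scl[symmetric] intro!: imageI K_closed(3))
  have zero: "0 \<in> push (ext :: _ \<Rightarrow> ('e ^ 3) set) ` K" using K_closed(1) by (intro image_eqI[of _ _ 0]) simp_all
  have "rationalize (SL3_push g z) - SL3_push g (rationalize z) =
      lin_ext (\<lambda>n. filling (act_flag g n) - SL3_push g (filling n)) z"
    by (simp add: rationalize_def push_add lin_ext_push push_lin_ext lin_ext_minus_fun)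
  also have "\<dots> \<in> push ext ` K"
    by (intro lin_ext_closed zero add smult filling_act[OF g])
  finally have 1: "rationalize (SL3_push g z) - SL3_push g (rationalize z) \<in> push ext ` K" .
  obtain q where q: "q \<in> carrier tits_cycles1" "rationalize z = push ext q"
    by (rule rationalize_rational[OF z])
  have "SL3_push g (rationalize z) - rationalize z = push ext (SL3_push g q - q)"
    unfolding q(2) by (simp add: SL3_push_ext push_minus)
  then have 2: "SL3_push g (rationalize z) - rationalize z \<in> push ext ` K"
    using K_closed(6)[OF g q(1)] by simp
  show ?thesis using add[OF 1 2] by (simp add: rationalize_minus)
qed

end

end

section \<open>Generators of \<open>H(\<Gamma>, E)\<close>\<close>

lemma rat_module_minus_zero:
  assumes "rat_module M" "x \<in> carrier M"
  shows "x \<ominus>\<^bsub>M\<^esub> \<zero>\<^bsub>M\<^esub> = x"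
proof -
  interpret M: module rat_ring M by fact
  show ?thesis using assms(2) by (simp add: a_minus_def)
qed

section \<open>Powers of integral matrices\<close>

lemma eigen_pow:
  assumes "mat_of_int M *v v = c *s (v :: 'k::field_char_0 ^ 3)"
  shows "mat_of_int (M [^]\<^bsub>SL3Z\<^esub> n) *v v = c ^ n *s v"
proof -
  interpret group SL3Z by (rule group_SL3Z)
  show ?thesis
  proof (induction n)
    case (Suc n)
    have "mat_of_int (M [^]\<^bsub>SL3Z\<^esub> Suc n) *v v = mat_of_int (M [^]\<^bsub>SL3Z\<^esub> n) *v (mat_of_int M *v v)"
      by (simp add: map_matrix_of_int_mult matrix_vector_mul_assoc)
    also have "\<dots> = c ^ Suc n *s v" unfolding assms vec.scale Suc.IH by (simp add: mult.commute)
    finally show ?case .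
  qed simp
qed

lemma conjugate_pow:
  fixes n :: nat
  assumes "det d = 1" "det M = 1"
  shows "(d ** M ** adj3 d) [^]\<^bsub>SL3Z\<^esub> n ** d = d ** M [^]\<^bsub>SL3Z\<^esub> n"
proof -
  interpret group SL3Z by (rule group_SL3Z)
  show ?thesis
  proof (induction n)
    case (Suc n)
    have "(d ** M ** adj3 d) [^]\<^bsub>SL3Z\<^esub> Suc n ** d = (d ** M ** adj3 d) [^]\<^bsub>SL3Z\<^esub> n ** (d ** M ** (adj3 d ** d))"
      by (simp add: matrix_mul_assoc)
    also have "\<dots> = (d ** M ** adj3 d) [^]\<^bsub>SL3Z\<^esub> n ** d ** M"
      unfolding adj3_mult(1)[OF assms(1)] by (simp add: matrix_mul_assoc)
    also have "\<dots> = d ** M [^]\<^bsub>SL3Z\<^esub> Suc n" unfolding Suc.IH by (simp add: matrix_mul_assoc)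
    finally show ?case .
  qed simp
qed

text \<open>Pigeonhole: two powers of \<open>x\<close> lie in the same right coset, and the
  difference of the exponents is the required one.\<close>

lemma (in group) finite_index_power:
  assumes H: "subgroup H G" and fin: "finite (rcosets H)" and x: "x \<in> carrier G"
  shows "\<exists>n::nat. 0 < n \<and> x [^] n \<in> H"
proof -
  have "range (\<lambda>n::nat. H #> x [^] n) \<subseteq> rcosets H"
    using x subgroup.subset[OF H] by (auto simp: RCOSETS_def)
  then have "\<not> inj (\<lambda>n::nat. H #> x [^] n)"
    using fin finite_subset finite_imageD infinite_UNIV_nat by metis
  then obtain i j :: nat where ij: "i < j" "H #> x [^] i = H #> x [^] j"
    by (metis (mono_tags, lifting) injI linorder_neqE_nat)
  have "x [^] j \<in> H #> x [^] i" unfolding ij(2) using rcos_self[OF _ H] x by simp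
  then have "x [^] j \<otimes> inv (x [^] i) \<in> H" using subgroup.rcos_module_imp[OF H group_axioms] x by simp
  moreover have "x [^] j = x [^] (j - i) \<otimes> x [^] i" using x ij(1) by (simp add: nat_pow_mult)
  ultimately have "x [^] (j - i) \<in> H" using x by (simp add: m_assoc)
  then show ?thesis using ij(1) by (intro exI[of _ "j - i"]) simp
qed

lemma smallest_power_mem:
  assumes "subgroup H SL3Z" "finite (rcosets\<^bsub>SL3Z\<^esub> H)" "x \<in> carrier SL3Z"
  obtains n where "smallest_power SL3Z H x = x [^]\<^bsub>SL3Z\<^esub> (n::nat)" "smallest_power SL3Z H x \<in> H"
proof -
  interpret group SL3Z by (rule group_SL3Z)
  have "\<exists>n::nat. 0 < n \<and> x [^]\<^bsub>SL3Z\<^esub> n \<in> H" using finite_index_power[OF assms] .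
  from LeastI_ex[OF this] show ?thesis by (intro that) (auto simp: smallest_power_def)
qed

lemma smallest_power_self:
  assumes "x \<in> H" "x \<in> carrier SL3Z"
  shows "smallest_power SL3Z H x = x"
proof -
  interpret group SL3Z by (rule group_SL3Z)
  have x: "x [^]\<^bsub>SL3Z\<^esub> (1::nat) = x" by simp
  have "(LEAST n::nat. 0 < n \<and> x [^]\<^bsub>SL3Z\<^esub> n \<in> H) = 1"
  proof (rule Least_equality)
    show "0 < (1::nat) \<and> x [^]\<^bsub>SL3Z\<^esub> (1::nat) \<in> H" unfolding x using assms(1) by simp
  qed simp
  then show ?thesis unfolding smallest_power_def by (simp only: x)
qed

lemma unital_det:
  assumes "invertible (h :: int ^ 2 ^ 2)"
  shows "det h * det h = 1" "det (block_matrix h u) = 1"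
proof -
  obtain h' where "h ** h' = mat 1" using assms by (auto simp: invertible_def)
  then have "det h * det h' = 1" by (metis det_I det_mul)
  then show *: "det h * det h = 1" by (auto simp: zmult_eq_1_iff)
  have "det (block_matrix h u) = det h * (h$1$1 * h$2$2 - h$1$2 * h$2$1)"
    by (simp add: block_matrix_def det_3 algebra_simps)
  then show "det (block_matrix h u) = 1" using * by (simp add: det_2)
qed

context quadratic
begin

text \<open>If the eigenvector \<open>b\<close> is not in the plane of the first two coordinates, then \<open>h\<close> is the scalar
  \<open>1\<close> or \<open>-1\<close>, and the modular symbols of the statement degenerate.\<close>

lemma degenerate_block:
  assumes un: "unital TYPE('e) h" and b3: "b $ 3 \<noteq> 0"
    and t: "triple b (vec_map conj b) (iemb a :: 'e ^ 3) \<noteq> 0"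
    and b: "mat_of_int (block_matrix h u) *v b = c *s b"
  shows "h $ 2 $ 1 = 0"
proof (rule ccontr)
  assume h21: "h $ 2 $ 1 \<noteq> 0"
  let ?M = "block_matrix h u" and ?i = "of_int :: int \<Rightarrow> 'e"
  define \<epsilon> where "\<epsilon> = ?i (det h)"
  have \<epsilon>: "\<epsilon> * \<epsilon> = 1" unfolding \<epsilon>_def of_int_mult[symmetric]
    using unital_det(1) un by (simp add: unital_def)
  have "(mat_of_int ?M *v b) $ 3 = c * b $ 3" using b by simp
  \<comment> \<open>The third row of the block matrix is \<open>(0, 0, \<epsilon>)\<close>, so a
    nonzero third coordinate forces the eigenvalue \<epsilon>. It is rational, hence also the
    eigenvalue of the conjugate of \<open>b\<close>.\<close>
  then have c: "c = \<epsilon>" using b3 by (simp add: matrix_vector_mult_nth block_matrix_def \<epsilon>_def)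
  have conj_\<epsilon>: "conj \<epsilon> = \<epsilon>" unfolding \<epsilon>_def using conj_rat[of "of_int (det h)"] by simp
  \<comment> \<open>The combination of \<open>b\<close> and its conjugate without third coordinate;
    its first two entries form an eigenvector of \<open>h\<close> for \<epsilon>.\<close>
  define v where "v = conj (b$3) *s b - b$3 *s vec_map conj b"
  have v3: "v $ 3 = 0" by (simp add: v_def mult.commute)
  have Mv: "mat_of_int ?M *v v = \<epsilon> *s v"
    using b conj_matrix[OF b] unfolding c conj_\<epsilon> v_def
    by (simp add: vec.diff vec.scale vec.scale_right_diff_distrib mult.commute)
  have v12: "v$1 \<noteq> 0 \<or> v$2 \<noteq> 0"
  proof (rule ccontr)
    assume "\<not> ?thesis"
    then have "v = 0" using v3 by (simp add: vec3_eq_iff)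
    then have e: "conj (b$3) * b$i = b$3 * conj (b$i)" for i by (simp add: v_def vec_eq_iff)
    have "b$3 * (b$i * conj (b$j) - b$j * conj (b$i)) = 0" for i j
    proof -
      have "b$3 * (b$i * conj (b$j) - b$j * conj (b$i)) = b$i * (b$3 * conj (b$j)) - b$j * (b$3 * conj (b$i))"
        by (simp add: algebra_simps)
      also have "\<dots> = 0" unfolding e[of i, symmetric] e[of j, symmetric] by (simp add: mult_ac)
      finally show ?thesis .
    qed
    then have "b$i * conj (b$j) - b$j * conj (b$i) = 0" for i j using b3 by simp
    then have "cross b (vec_map conj b) = 0" by (simp add: vec3_eq_iff cross_def)
    then show False using t by (simp add: triple_def dot_def)
  qed
  have "(mat_of_int ?M *v v) $ 1 = \<epsilon> * v$1" "(mat_of_int ?M *v v) $ 2 = \<epsilon> * v$2" using Mv by simp_all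
  then have hv: "(?i (h$1$1) - \<epsilon>) * v$1 = - (?i (h$1$2) * v$2)" "?i (h$2$1) * v$1 = (\<epsilon> - ?i (h$2$2)) * v$2"
    using v3 by (simp_all add: matrix_vector_mult_nth block_matrix_def algebra_simps eq_neg_iff_add_eq_0)
  have v2: "v$2 \<noteq> 0" using hv(2) v12 h21 by auto
  have "?i (h$2$1) * ((?i (h$1$1) - \<epsilon>) * v$1) = (?i (h$1$1) - \<epsilon>) * (?i (h$2$1) * v$1)" by simp
  then have "((?i (h$1$1) - \<epsilon>) * (\<epsilon> - ?i (h$2$2)) + ?i (h$2$1) * ?i (h$1$2)) * v$2 = 0"
    unfolding hv by (simp add: algebra_simps)
  then have char: "(?i (h$1$1) - \<epsilon>) * (\<epsilon> - ?i (h$2$2)) + ?i (h$2$1) * ?i (h$1$2) = 0" using v2 by simp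
  have det: "\<epsilon> = ?i (h$1$1) * ?i (h$2$2) - ?i (h$1$2) * ?i (h$2$1)"
    by (simp add: \<epsilon>_def det_2)
  have "\<epsilon> * (?i (h$1$1) + ?i (h$2$2)) = (?i (h$1$1) - \<epsilon>) * (\<epsilon> - ?i (h$2$2)) + ?i (h$2$1) * ?i (h$1$2) +
      (?i (h$1$1) * ?i (h$2$2) - ?i (h$1$2) * ?i (h$2$1)) + \<epsilon> * \<epsilon>"
    by (simp add: algebra_simps)
  then have "\<epsilon> * (?i (h$1$1) + ?i (h$2$2)) = \<epsilon> + \<epsilon> * \<epsilon>" unfolding char by (simp flip: det)
  then have "\<epsilon> * (?i (h$1$1) + ?i (h$2$2)) = \<epsilon> * (1 + \<epsilon>)" by (simp add: algebra_simps)
  moreover have "\<epsilon> \<noteq> 0" using \<epsilon> by auto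
  \<comment> \<open>\<open>h\<close> has determinant \<epsilon> and eigenvalue \<epsilon>, so its
    other eigenvalue is 1.\<close>
  ultimately have tr: "?i (h$1$1) + ?i (h$2$2) = 1 + \<epsilon>" by simp
  obtain \<beta> c0 :: 'e where \<beta>: "\<beta> \<notin> \<rat>"
    and h\<beta>: "map_matrix of_int h *v vector [\<beta>, 1] = c0 *s (vector [\<beta>, 1] :: 'e ^ 2)"
    using un by (auto simp: unital_def)
  have "(map_matrix of_int h *v vector [\<beta>, 1]) $ 1 = c0 * \<beta>" "(map_matrix of_int h *v vector [\<beta>, 1]) $ 2 = c0"
    unfolding h\<beta> by simp_all
  then have e1: "(?i (h$1$1) - c0) * \<beta> = - ?i (h$1$2)" and e2: "?i (h$2$1) * \<beta> = c0 - ?i (h$2$2)"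
    by (simp_all add: matrix_vector_mult_def sum_2 algebra_simps eq_neg_iff_add_eq_0)
  have "(?i (h$1$1) - c0) * (?i (h$2$1) * \<beta>) = ?i (h$2$1) * ((?i (h$1$1) - c0) * \<beta>)" by simp
  then have "(?i (h$1$1) - c0) * (c0 - ?i (h$2$2)) = - (?i (h$1$2) * ?i (h$2$1))" unfolding e1 e2 by simp
  \<comment> \<open>\<open>c0\<close> is a root of the characteristic polynomial of
    \<open>h\<close>, so it is 1 or \<epsilon>. Being rational, it makes \<beta> rational as well,
    since \<beta> can be solved for when \<open>h $ 2 $ 1\<close> is nonzero.\<close>
  then have "c0 * c0 - c0 * (?i (h$1$1) + ?i (h$2$2)) + \<epsilon> = 0" unfolding det by (simp add: algebra_simps)
  then have "(c0 - 1) * (c0 - \<epsilon>) = 0" unfolding tr by (simp add: algebra_simps)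
  then have "c0 = 1 \<or> c0 = \<epsilon>" by simp
  then have "c0 \<in> \<rat>" by (auto simp: \<epsilon>_def)
  moreover have "\<beta> = (c0 - ?i (h$2$2)) / ?i (h$2$1)" using e2 h21 by (simp add: field_simps)
  ultimately have "\<beta> \<in> \<rat>" by simp
  then show False using \<beta> by simp
qed

end

section \<open>The sequence of Steinberg modules and the two inclusions\<close>

context quadratic_level
begin

abbreviation "\<Gamma>G \<equiv> SL3Z_subgroup \<Gamma>"

lemma steinberg_incl_eq: "steinberg_incl = steinberg_map ext"
  by (simp add: fun_eq_iff steinberg_incl_def ext_def[abs_def])

text \<open>Injectivity comes from restriction of scalars. The action descends to the quotient
  because extension of scalars commutes with integral matrices, and exactness in the middle is the
  construction of the quotient.\<close>

lemma coefficient_sequence_steinberg: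
  "coefficient_sequence \<Gamma>G (steinberg :: (rat, rat steinberg) module) int_action
    (steinberg :: (rat, 'e steinberg) module) int_action
    (steinberg_quotient :: (rat, 'e steinberg set) module) steinberg_quotient_action
    steinberg_incl (\<lambda>x. steinberg_rat +>\<^bsub>steinberg\<^esub> x)"
proof -
  let ?A = "steinberg :: (rat, rat steinberg) module" and ?B = "steinberg :: (rat, 'e steinberg) module"
  let ?Q = "steinberg_rat :: 'e steinberg set"
  have A: "group_module \<Gamma>G ?A int_action" and B: "group_module \<Gamma>G ?B int_action"
    using group_module_steinberg[OF \<Gamma>] by auto
  have incl: "rat_hom ?A ?B steinberg_incl"
    unfolding steinberg_incl_eq by (rule rat_hom_steinberg_map[OF flag_map_ext])
  have comm: "steinberg_incl (int_action g x) = int_action g (steinberg_incl x :: 'e steinberg)"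
    if "x \<in> carrier ?A" for g x
    using that by (auto simp: steinberg_simps int_action_singleton steinberg_incl_singleton SL3_push_ext)
  have Q: "submodule ?Q rat_ring ?B"
    unfolding steinberg_rat_def by (intro submodule_rat_hom_image[OF incl] submodule_carrier rat_module_steinberg)
  have pres: "int_action g x \<in> ?Q" if "g \<in> \<Gamma>" "x \<in> ?Q" for g x
  proof -
    obtain y where y: "y \<in> carrier ?A" "x = steinberg_incl y" using \<open>x \<in> ?Q\<close> by (auto simp: steinberg_rat_def)
    have "int_action g y \<in> carrier ?A" using rat_hom_closed[OF group_module_hom[OF A]] \<open>g \<in> \<Gamma>\<close> y(1) by simp
    then show ?thesis unfolding y(2) comm[OF y(1), symmetric] steinberg_rat_def by (rule imageI)
  qed
  have hom: "rat_hom ?B ?B (int_action g)" if "g \<in> \<Gamma>" for g using group_module_hom[OF B] that by simp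
  have action: "steinberg_quotient_action g (?Q +>\<^bsub>?B\<^esub> x) = ?Q +>\<^bsub>?B\<^esub> int_action g x"
    if "g \<in> \<Gamma>" "x \<in> carrier ?B" for g x
    unfolding steinberg_quotient_action_def using that pres by (intro coset_map_coset[OF hom] Q) auto
  have C: "group_module \<Gamma>G (steinberg_quotient :: (rat, 'e steinberg set) module) steinberg_quotient_action"
    unfolding group_module_def
  proof (intro conjI ballI)
    show "group \<Gamma>G" using A by (rule group_module_group)
    show "rat_module (steinberg_quotient :: (rat, 'e steinberg set) module)"
      unfolding steinberg_quotient_def by (rule rat_module_quotient[OF rat_module_steinberg Q])
    show "rat_hom steinberg_quotient (steinberg_quotient :: (rat, 'e steinberg set) module) (steinberg_quotient_action g)"
      if "g \<in> carrier \<Gamma>G" for g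
      unfolding steinberg_quotient_action_def[abs_def] steinberg_quotient_def
      using that pres by (intro rat_hom_coset_map[OF hom] Q) auto
    fix g h m assume "g \<in> carrier \<Gamma>G" "h \<in> carrier \<Gamma>G" and m: "m \<in> carrier (steinberg_quotient :: (rat, 'e steinberg set) module)"
    then have gh: "g \<in> \<Gamma>" "h \<in> \<Gamma>" by simp_all
    obtain x where x: "m = ?Q +>\<^bsub>?B\<^esub> x" "x \<in> carrier ?B"
      using m by (auto simp: steinberg_quotient_def quotient_module_simps)
    have "int_action (g \<otimes>\<^bsub>\<Gamma>G\<^esub> h) x = int_action g (int_action h x)"
      using group_module_mult[OF B] gh x(2) by simp
    then show "steinberg_quotient_action (g \<otimes>\<^bsub>\<Gamma>G\<^esub> h) m = steinberg_quotient_action g (steinberg_quotient_action h m)"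
      using x gh \<Gamma>_mult[OF gh] rat_hom_closed[OF hom] by (simp add: action)
  qed
  show ?thesis
  proof
    show "equivariant \<Gamma>G ?A int_action ?B int_action steinberg_incl"
      using incl comm by (simp add: equivariant_def)
    show "equivariant \<Gamma>G ?B int_action steinberg_quotient steinberg_quotient_action (\<lambda>x. ?Q +>\<^bsub>?B\<^esub> x)"
      unfolding equivariant_def
    proof (intro conjI ballI)
      show "rat_hom ?B steinberg_quotient (\<lambda>x. ?Q +>\<^bsub>?B\<^esub> x)"
        unfolding steinberg_quotient_def by (rule rat_hom_quotient[OF rat_module_steinberg Q])
    qed (simp add: action)
    show "inj_on (steinberg_incl :: _ \<Rightarrow> 'e steinberg) (carrier ?A)"
    proof (rule inj_onI)
      fix x y assume "x \<in> carrier ?A" "y \<in> carrier ?A" and e: "(steinberg_incl x :: 'e steinberg) = steinberg_incl y"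
      then obtain c d where c: "x = {c}" "c \<in> carrier tits_cycles1" and d: "y = {d}" "d \<in> carrier tits_cycles1"
        by (auto simp: steinberg_simps)
      have "push (ext :: _ \<Rightarrow> ('e ^ 3) set) c = push ext d" using e by (simp add: c d steinberg_incl_singleton)
      from arg_cong[OF this, of "push res"] show "x = y"
        unfolding push_res_ext[OF c(2)] push_res_ext[OF d(2)] c(1) d(1) by simp
    qed
    show "(\<lambda>x. ?Q +>\<^bsub>?B\<^esub> x) ` carrier ?B = carrier steinberg_quotient"
      by (simp add: steinberg_quotient_def quotient_module_simps)
    fix x assume x: "x \<in> carrier ?B"
    interpret B: module rat_ring ?B by (rule rat_module_steinberg)
    have "\<zero>\<^bsub>steinberg_quotient\<^esub> = ?Q +>\<^bsub>?B\<^esub> \<zero>\<^bsub>?B\<^esub>"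
      using coset_zero[OF rat_module_steinberg Q] by (simp add: steinberg_quotient_def quotient_module_simps)
    then show "?Q +>\<^bsub>?B\<^esub> x = \<zero>\<^bsub>steinberg_quotient\<^esub> \<longleftrightarrow> x \<in> steinberg_incl ` carrier ?A"
      using coset_eq_iff[OF rat_module_steinberg Q x B.zero_closed] x
      by (simp add: steinberg_rat_def rat_module_minus_zero[OF rat_module_steinberg])
  qed (fact A B C)+
qed

lemma H_field_eq:
  "H_field \<Gamma> TYPE('e) = H0_class \<Gamma>G steinberg int_action ` {a \<in> carrier steinberg.
    steinberg_incl a \<in> bar_d1 \<Gamma>G (steinberg :: (rat, 'e steinberg) module) int_action `
      carrier (bar1 \<Gamma>G (steinberg :: (rat, 'e steinberg) module))}"
  unfolding H_field_def by (rule coefficient_sequence.connecting_hom_image[OF coefficient_sequence_steinberg])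

lemma submodule_H_field: "submodule (H_field \<Gamma> TYPE('e)) rat_ring (steinberg_coinvariants \<Gamma>)"
  unfolding H_field_def
  by (rule coefficient_sequence.submodule_connecting_hom_image[OF coefficient_sequence_steinberg])

text \<open>The chain with value \<open>z\<close> at the inverse of \<open>g\<close> has boundary
  \<open>g z - z\<close>, since the bar differential acts through inverses.\<close>

lemma boundary_in_H_field:
  assumes "g \<in> \<Gamma>" "z \<in> carrier tits_cycles1" "q \<in> carrier tits_cycles1"
    and "SL3_push g z - z = push (ext :: _ \<Rightarrow> ('e ^ 3) set) q"
  shows "H0_class \<Gamma>G steinberg int_action {q} \<in> H_field \<Gamma> TYPE('e)"
proof -
  note B = group_module_steinberg[OF \<Gamma>, where 'k = 'e]
  interpret G: group \<Gamma>G using B by (rule group_module_group)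
  have zB: "{z} \<in> carrier steinberg" using assms(2) by (simp add: steinberg_simps)
  have gi: "inv\<^bsub>\<Gamma>G\<^esub> g \<in> carrier \<Gamma>G" "inv\<^bsub>\<Gamma>G\<^esub> (inv\<^bsub>\<Gamma>G\<^esub> g) = g"
    using G.inv_closed[of g] G.inv_inv[of g] assms(1) by simp_all
  have "bar_d1 \<Gamma>G steinberg int_action (fs_single steinberg (inv\<^bsub>\<Gamma>G\<^esub> g) {z}) = int_action g {z} \<ominus>\<^bsub>steinberg\<^esub> {z}"
    using bar_d1_single[OF B gi(1) zB] gi(2) by simp
  also have "\<dots> = steinberg_incl {q}"
    using assms by (simp add: int_action_singleton steinberg_minus steinberg_incl_singleton)
  finally have "steinberg_incl {q} = bar_d1 \<Gamma>G steinberg int_action (fs_single steinberg (inv\<^bsub>\<Gamma>G\<^esub> g) {z})" ..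
  moreover have "fs_single steinberg (inv\<^bsub>\<Gamma>G\<^esub> g) {z} \<in> carrier (bar1 \<Gamma>G steinberg)"
    using gi(1) zB by (intro fs_single_closed rat_module_steinberg) auto
  moreover have "{q} \<in> carrier steinberg" using assms(3) by (simp add: steinberg_simps)
  ultimately show ?thesis unfolding H_field_eq by blast
qed

definition generators :: "rat steinberg set set"
  where "generators = {modular_symbol_class \<Gamma> f (\<gamma> *v f) (d *v a) | f \<gamma> d a.
         \<exists>h u b.
           unital TYPE('e) h \<and>
           eigenbasis (map_matrix of_int (block_matrix h u))
             b (vec_map galois_conj b) (vec_map of_int a) \<and>
           d \<in> R a b \<and>
           \<gamma> = smallest_power SL3Z \<Gamma> (d \<otimes>\<^bsub>SL3Z\<^esub> block_matrix h u \<otimes>\<^bsub>SL3Z\<^esub> inv\<^bsub>SL3Z\<^esub> d) \<and>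
           f = d *v vector [1, 0, 0]}"

text \<open>If \<open>b $ 3 = 0\<close>, the data are in standard position and
  \<open>\<gamma> = d N d^-1\<close> with a power \<open>N\<close> of the block matrix, which has
  the same eigenvectors. The symbol is then the boundary computed in
  \<open>base_hexagon_action\<close>. Otherwise it is zero.\<close>

lemma generators_subset:
  assumes fin: "finite (rcosets\<^bsub>SL3Z\<^esub> \<Gamma>)"
  shows "generators \<subseteq> H_field \<Gamma> TYPE('e)"
proof
  fix y assume "y \<in> generators"
  then obtain h u b \<gamma> d a where un: "unital TYPE('e) h"
    and eb: "eigenbasis (mat_of_int (block_matrix h u)) b (vec_map galois_conj b) (iemb a)"
    and d: "d \<in> R a b"
    and \<gamma>: "\<gamma> = smallest_power SL3Z \<Gamma> (d \<otimes>\<^bsub>SL3Z\<^esub> block_matrix h u \<otimes>\<^bsub>SL3Z\<^esub> inv\<^bsub>SL3Z\<^esub> d)"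
    and y: "y = modular_symbol_class \<Gamma> (d *v e1) (\<gamma> *v (d *v e1)) (d *v a)"
    unfolding generators_def by blast
  interpret group SL3Z by (rule group_SL3Z)
  define M where "M = block_matrix h u"
  have M: "det M = 1" unfolding M_def using un by (intro unital_det) (simp add: unital_def)
  have d1: "det d = 1" using R_det[OF d] .
  have x: "d ** M ** adj3 d \<in> carrier SL3Z"
    using m_closed[of "d ** M" "inv\<^bsub>SL3Z\<^esub> d"] inv_closed[of d] d1 M by (simp add: det_mul SL3Z_inv)
  obtain n where n: "\<gamma> = (d ** M ** adj3 d) [^]\<^bsub>SL3Z\<^esub> (n::nat)" "\<gamma> \<in> \<Gamma>"
    using smallest_power_mem[OF \<Gamma> fin x] unfolding \<gamma> M_def by (auto simp: SL3Z_inv[OF d1])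
  define N where "N = M [^]\<^bsub>SL3Z\<^esub> n"
  have N: "det N = 1" using nat_pow_closed[of M n] M by (simp add: N_def)
  have gd: "\<gamma> ** d = d ** N" unfolding n(1) N_def by (rule conjugate_pow[OF d1 M])
  then have gf: "\<gamma> *v (d *v e1) = d *v (N *v e1)" by (simp add: matrix_vector_mul_assoc)
  have t: "triple b (vec_map conj b) (iemb a) \<noteq> 0"
    using eb by (simp add: eigenbasis_def is_basis3_iff galois_conj_eq)
  obtain c c' where c: "mat_of_int M *v b = c *s b" and c': "mat_of_int M *v iemb a = c' *s (iemb a :: 'e ^ 3)"
    using eb by (auto simp: eigenbasis_def M_def)
  define w :: "rat steinberg" where "w = modular_symbol (iemb (d *v e1)) (iemb (d *v (N *v e1))) (iemb (d *v a))"
  have yw: "y = H0_class \<Gamma>G steinberg int_action w"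
    by (simp add: y w_def modular_symbol_class_def gf)
  show "y \<in> H_field \<Gamma> TYPE('e)"
  proof (cases "b $ 3 = 0")
    case True
    have st: "standard a b" using t True by (simp add: standard_iff)
    note Nb = eigen_pow[OF c, of n, folded N_def] and Na = eigen_pow[OF c', of n, folded N_def]
    have a3: "a $ 3 \<noteq> 0" using st by (simp add: standard_def)
    note hex = modular_symbol_hexagon[OF d1 a3 standard_eigenvector(1)[OF st Nb] N, where 'k = rat]
    have "H0_class \<Gamma>G steinberg int_action {hexagon (iemb (d *v e1)) (iemb (d *v (N *v e1))) (iemb (d *v a))}
        \<in> H_field \<Gamma> TYPE('e)"
      using base_hexagon_action[OF st d1 N Nb Na gd]
      by (intro boundary_in_H_field[OF n(2) base_hexagon_cycle[OF st d1] hex(2)]) (simp add: gf)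
    then show ?thesis unfolding yw w_def hex(1) .
  next
    case False
    \<comment> \<open>Now \<open>e1\<close> is an eigenvector of \<open>M\<close> and of its powers,
      so \<open>f\<close> and \<open>\<gamma> f\<close> are proportional and the symbol is
      degenerate.\<close>
    have "h $ 2 $ 1 = 0" using degenerate_block[OF un False t c[unfolded M_def]] .
    then have "M *v e1 = M$1$1 *s e1" by (simp add: vec3_eq_iff matrix_vector_mult_nth M_def block_matrix_def)
    then have "mat_of_int M *v (e1 :: rat ^ 3) = of_int (M$1$1) *s e1"
      by (simp add: vec3_eq_iff matrix_vector_mult_nth)
    then have "mat_of_int N *v (e1 :: rat ^ 3) = of_int (M$1$1) ^ n *s e1"
      unfolding N_def by (rule eigen_pow)
    then have "triple (iemb (d *v e1)) (iemb (d *v (N *v e1))) (iemb (d *v a) :: rat ^ 3) = 0"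
      by (simp add: iemb_mult triple_matrix) (simp add: triple_def dot_def cross_def)
    then have "w = {0}" by (simp add: w_def modular_symbol_def is_basis3_iff steinberg_simps)
    then have "y = H0_class \<Gamma>G steinberg int_action \<zero>\<^bsub>steinberg\<^esub>" by (simp add: yw steinberg_simps)
    also have "\<dots> = \<zero>\<^bsub>steinberg_coinvariants \<Gamma>\<^esub>"
      by (rule rat_hom_zero[OF rat_hom_H0_class[OF group_module_steinberg[OF \<Gamma>]]])
    finally show ?thesis
      using submodule_zero[OF _ submodule_H_field]
        rat_hom_cod[OF rat_hom_H0_class[OF group_module_steinberg[OF \<Gamma>]]] by simp
  qed
qed

text \<open>Conjugating \<open>g\<close> by \<open>d\<close> gives an integral matrix with
  eigenvectors \<open>b\<close> and \<open>a\<close> in standard position, hence a block matrix with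
  unital \<open>h\<close>. As \<open>g\<close> lies in \<Gamma>, the smallest power is the first and
  \<open>\<gamma> = g\<close>.\<close>

lemma generators_hexagon:
  assumes d: "d \<in> R a b" and st: "standard a b" and g: "g \<in> \<Gamma>"
    and stab: "act_flag g (flag_of d a b) = flag_of d a b"
  shows "H0_class \<Gamma>G steinberg int_action {hexagon (iemb (d *v e1)) (iemb (g *v (d *v e1))) (iemb (d *v a))} \<in> generators"
    and "hexagon (iemb (d *v e1)) (iemb (g *v (d *v e1))) (iemb (d *v a) :: rat ^ 3) \<in> carrier tits_cycles1"
proof -
  note d1 = R_det[OF d] and g1 = \<Gamma>_det[OF g]
  define M where "M = adj3 d ** g ** d"
  note e = flag_stabilizer_eigen[OF st d1 g1 stab, folded M_def]
  obtain c c' where c: "mat_of_int M *v b = c *s b" and c': "mat_of_int M *v (iemb a :: 'e ^ 3) = c' *s iemb a"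
    using e(3,4) by blast
  obtain h u where hu: "unital TYPE('e) h" "M = block_matrix h u"
    "eigenbasis (mat_of_int (block_matrix h u)) b (vec_map galois_conj b) (iemb a)"
    by (rule standard_block_matrix[OF st e(1) c c'])
  have gf: "g *v (d *v e1) = d *v (M *v e1)" using e(2) by (simp add: matrix_vector_mul_assoc)
  have a3: "a $ 3 \<noteq> 0" using st by (simp add: standard_def)
  note hex = modular_symbol_hexagon[OF d1 a3 standard_eigenvector(1)[OF st c] e(1), where 'k = rat, folded gf]
  show "hexagon (iemb (d *v e1)) (iemb (g *v (d *v e1))) (iemb (d *v a) :: rat ^ 3) \<in> carrier tits_cycles1"
    by (rule hex(2))
  have "d ** M ** adj3 d = g ** (d ** adj3 d)" by (simp add: e(2)[symmetric] matrix_mul_assoc)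
  then have "d \<otimes>\<^bsub>SL3Z\<^esub> block_matrix h u \<otimes>\<^bsub>SL3Z\<^esub> inv\<^bsub>SL3Z\<^esub> d = g"
    by (simp add: SL3Z_inv[OF d1] adj3_mult(2)[OF d1] flip: hu(2))
  then have "g = smallest_power SL3Z \<Gamma> (d \<otimes>\<^bsub>SL3Z\<^esub> block_matrix h u \<otimes>\<^bsub>SL3Z\<^esub> inv\<^bsub>SL3Z\<^esub> d)"
    using smallest_power_self[OF g] g1 by simp
  then have "modular_symbol_class \<Gamma> (d *v e1) (g *v (d *v e1)) (d *v a) \<in> generators"
    unfolding generators_def using hu d by blast
  then show "H0_class \<Gamma>G steinberg int_action {hexagon (iemb (d *v e1)) (iemb (g *v (d *v e1))) (iemb (d *v a))} \<in> generators"
    unfolding modular_symbol_class_def hex(1) .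
qed

text \<open>A rational cycle that bounds a chain over St(E^3) is a sum of terms
  \<open>g z - z\<close>, each of which the retraction sends into \<open>K\<close>; being rational,
  the cycle is its own image. An arbitrary submodule \<open>H\<close> fits the description of the
  span as an intersection.\<close>

lemma H_field_subset:
  assumes H: "submodule H rat_ring (steinberg_coinvariants \<Gamma>)" and gen: "generators \<subseteq> H"
  shows "H_field \<Gamma> TYPE('e) \<subseteq> H"
proof
  let ?cl = "H0_class \<Gamma>G (steinberg :: (rat, rat steinberg) module) int_action"
  note A = group_module_steinberg[OF \<Gamma>, where 'k = rat]
  note B = group_module_steinberg[OF \<Gamma>, where 'k = 'e]
  note cl = rat_hom_H0_class[OF A]
  note H_closed = submodule_zero[OF rat_hom_cod[OF cl] H] submodule_add[OF rat_hom_cod[OF cl] H]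
    submodule_smult[OF rat_hom_cod[OF cl] H]
  define K where "K = {q \<in> carrier tits_cycles1. ?cl {q} \<in> H}"
  have car: "{q} \<in> carrier steinberg" if "q \<in> carrier tits_cycles1" for q :: "(rat ^ 3) set list \<Rightarrow>\<^sub>0 rat"
    using that by (simp add: steinberg_simps)
  have K: "level_space K"
    unfolding level_space_def
  proof (intro conjI ballI allI impI)
    have "?cl {0} \<in> H" using rat_hom_zero[OF cl] H_closed(1) by (simp add: steinberg_simps)
    then show "0 \<in> K" by (simp add: K_def tits_cycles1_closed)
    show "K \<subseteq> carrier tits_cycles1" by (auto simp: K_def)
    show "x + y \<in> K" if "x \<in> K" "y \<in> K" for x y
      using that rat_hom_add[OF cl car car, of x y] H_closed(2)
      by (auto simp: K_def steinberg_simps tits_cycles1_closed)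
    show "scl q x \<in> K" if "x \<in> K" for q x
      using that rat_hom_smult[OF cl car, of x q] H_closed(3)
      by (auto simp: K_def steinberg_simps tits_cycles1_closed)
    show "SL3_push g q - q \<in> K" if g: "g \<in> \<Gamma>" and q: "q \<in> carrier tits_cycles1" for g q
    proof -
      have gq: "SL3_push g q - q \<in> carrier tits_cycles1"
        by (intro tits_cycles1_closed SL3_push_cycle \<Gamma>_det g q)
      interpret A: module rat_ring "steinberg :: (rat, rat steinberg) module" by (rule rat_module_steinberg)
      have "{SL3_push g q - q} = int_action g {q} \<ominus>\<^bsub>steinberg\<^esub> {q}"
        using q by (simp add: int_action_singleton steinberg_minus)
      also have "\<dots> \<in> coinvariant_relations \<Gamma>G steinberg int_action"
        using g car[OF q] by (intro coinvariant_relations_generator) auto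
      finally have "?cl {SL3_push g q - q} = ?cl \<zero>\<^bsub>steinberg\<^esub>"
        using H0_class_eq_iff[OF A car[OF gq] A.zero_closed] car[OF gq]
        by (simp add: rat_module_minus_zero[OF rat_module_steinberg])
      then show ?thesis using gq H_closed(1) rat_hom_zero[OF cl] by (simp add: K_def)
    qed
    show "hexagon (iemb (d *v e1)) (iemb (g *v (d *v e1))) (iemb (d *v a)) \<in> K"
      if "d \<in> R a b" "standard a b" "g \<in> \<Gamma>" "act_flag g (flag_of d a b) = flag_of d a b" for a b d g
      using generators_hexagon[OF that] gen by (auto simp: K_def)
  qed
  \<comment> \<open>The cycles that the retraction sends into \<open>K\<close>; they form a
    submodule, so it suffices to test boundaries term by term.\<close>
  define T :: "'e steinberg set" where "T = {{z} | z. z \<in> carrier tits_cycles1 \<and> rationalize z \<in> push ext ` K}"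
  have T: "submodule T rat_ring steinberg"
  proof (rule rat_submodule_intro[OF rat_module_steinberg])
    show "T \<subseteq> carrier steinberg" by (auto simp: T_def steinberg_simps)
    have "rationalize 0 = push ext 0" by (simp add: rationalize_def)
    then have "rationalize 0 \<in> push ext ` K" using K_closed(1)[OF K] by (rule image_eqI)
    then show "\<zero>\<^bsub>steinberg\<^esub> \<in> T" by (simp add: T_def steinberg_simps tits_cycles1_closed)
    show "x \<oplus>\<^bsub>steinberg\<^esub> y \<in> T" if "x \<in> T" "y \<in> T" for x y
      using that K_closed(2)[OF K] unfolding T_def
      by (auto simp: steinberg_simps tits_cycles1_closed rationalize_add push_add[symmetric] intro!: imageI)
    show "q \<odot>\<^bsub>steinberg\<^esub> x \<in> T" if xT: "x \<in> T" for q x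
    proof -
      obtain z k where z: "x = {z}" "z \<in> carrier tits_cycles1" "rationalize z = push ext k" "k \<in> K"
        using xT unfolding T_def by blast
      have "rationalize (scl q z) = scl q (rationalize z)" by (simp add: rationalize_def lin_ext_scl)
      then have "rationalize (scl q z) = push ext (scl q k)" by (simp add: z(3) push_scl)
      then show ?thesis using z K_closed(3)[OF K] by (auto simp: T_def steinberg_simps tits_cycles1_closed)
    qed
  qed
  fix y assume "y \<in> H_field \<Gamma> TYPE('e)"
  then obtain a w where a: "a \<in> carrier steinberg" "y = ?cl a"
    and w: "w \<in> carrier (bar1 \<Gamma>G (steinberg :: (rat, 'e steinberg) module))"
      "steinberg_incl a = bar_d1 \<Gamma>G (steinberg :: (rat, 'e steinberg) module) int_action w"
    unfolding H_field_eq by blast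
  interpret G: group \<Gamma>G using B by (rule group_module_group)
  have "bar_d1 \<Gamma>G (steinberg :: (rat, 'e steinberg) module) int_action w \<in> T"
    unfolding bar_d1_def
  proof (rule submodule_finsum[OF rat_module_steinberg T])
    fix g assume "g \<in> {g. w g \<noteq> \<zero>\<^bsub>steinberg\<^esub>}"
    then have "g \<in> carrier \<Gamma>G" using w(1) by (auto simp: fin_supp_carrier_iff)
    then have g: "inv\<^bsub>\<Gamma>G\<^esub> g \<in> \<Gamma>" using G.inv_closed by simp
    obtain z where z: "w g = {z}" "z \<in> carrier tits_cycles1"
      using fin_supp_closed[OF rat_module_steinberg w(1), of g] by (auto simp: steinberg_simps)
    show "int_action (inv\<^bsub>\<Gamma>G\<^esub> g) (w g) \<ominus>\<^bsub>steinberg\<^esub> w g \<in> T"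
      unfolding z(1) int_action_singleton steinberg_minus[OF z(2)] T_def
      using rationalize_act[OF K g z(2)] tits_cycles1_closed(2)[OF SL3_push_cycle[OF \<Gamma>_det[OF g] z(2)] z(2)]
      by blast
  qed
  moreover obtain q where q: "a = {q}" "q \<in> carrier tits_cycles1" using a(1) by (auto simp: steinberg_simps)
  ultimately have "rationalize (push ext q) \<in> push ext ` K"
    unfolding w(2)[symmetric] by (simp add: steinberg_incl_singleton T_def)
  then obtain k where k: "k \<in> K" "push (ext :: _ \<Rightarrow> ('e ^ 3) set) q = push ext k"
    using rationalize_ext[OF q(2)] by auto
  \<comment> \<open>Restriction of scalars cancels \<open>ext\<close>, so the rational cycle itself
    lies in \<open>K\<close>.\<close>
  from arg_cong[OF k(2), of "push res"] have "q = k"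
    unfolding push_res_ext[OF q(2)] push_res_ext[OF K_closed(5)[OF K k(1)]] .
  then show "y \<in> H" using k(1) by (simp add: a(2) q(1) K_def)
qed

end

theorem theorem5p6:
  fixes \<Gamma> :: "(int ^ 3 ^ 3) set"
    and R :: "int ^ 3 \<Rightarrow> 'e::field_char_0 ^ 3 \<Rightarrow> (int ^ 3 ^ 3) set"
  assumes "real_quadratic_field TYPE('e)"
    and "subgroup \<Gamma> SL3Z"
    and "finite (rcosets\<^bsub>SL3Z\<^esub> \<Gamma>)"
    and "\<And>a b. double_coset_reps SL3Z \<Gamma> (line_stabilizer a b) (R a b)"
  shows "H_field \<Gamma> TYPE('e) =
    rat_span (steinberg_coinvariants \<Gamma>)
      {modular_symbol_class \<Gamma> f (\<gamma> *v f) (d *v a) | f \<gamma> d a.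
         \<exists>h u b.
           unital TYPE('e) h \<and>
           eigenbasis (map_matrix of_int (block_matrix h u))
             b (vec_map galois_conj b) (vec_map of_int a) \<and>
           d \<in> R a b \<and>
           \<gamma> = smallest_power SL3Z \<Gamma> (d \<otimes>\<^bsub>SL3Z\<^esub> block_matrix h u \<otimes>\<^bsub>SL3Z\<^esub> inv\<^bsub>SL3Z\<^esub> d) \<and>
           f = d *v vector [1, 0, 0]}"
proof -
  obtain s :: 'e and re im where "quadratic s re im"
    by (rule real_quadratic_field_quadratic[OF assms(1)])
  then interpret quadratic_level s re im \<Gamma> R
    using assms(2,4) by (simp add: quadratic_level_def quadratic_level_axioms_def)
  show ?thesis unfolding generators_def[symmetric]
  proof
    show "H_field \<Gamma> TYPE('e) \<subseteq> rat_span (steinberg_coinvariants \<Gamma>) generators"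
      unfolding rat_span_def using H_field_subset by blast
    show "rat_span (steinberg_coinvariants \<Gamma>) generators \<subseteq> H_field \<Gamma> TYPE('e)"
      by (rule rat_span_least[OF submodule_H_field generators_subset[OF assms(3)]])
  qed
qed

end
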